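(* Let $(M,g)$ be a compact connected Hermitian manifold of complex dimension $n\ge 2$ with associated real $(1,1)$ form $\omega=\sqrt{-1}\sum_{i,j}g_{i\overline{j}}\,dz^i\wedge d\overline{z^j}$, and let $F:M\to\mathbb{R}$ be a smooth function. Then for every integer $k\ge 0$ there exists a constant $C_k$, depending only on $k$, $(M,\omega)$ and $F$, such that every smooth function $\varphi:M\to\mathbb{R}$ satisfying $$(\omega+\sqrt{-1}\,\partial\overline{\partial}\varphi)^n=e^F\omega^n,\qquad \omega+\sqrt{-1}\,\partial\overline{\partial}\varphi>0,\qquad \sup_M\varphi=0,$$ satisfies $\|\varphi\|_{C^k(M,g)}\le C_k$.
   Context: The Hermitian metric $g$ is smooth and is not assumed to be Kähler (no condition on $d\omega$ is imposed). For a real $(1,1)$ form $\eta$, the notation $\eta>0$ means that $\eta$ is positive definite at every point of $M$. The norm $\|\cdot\|_{C^k(M,g)}$ is the $C^k$ norm on functions on $M$ with respect to the fixed metric $g$. *)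

theory Defs
  imports "HOL-Analysis.Analysis"
begin

section \<open>Smooth and holomorphic maps between open subsets of vector spaces\<close>

definition dir_deriv ::
  "'a::real_normed_vector \<Rightarrow> ('a \<Rightarrow> 'b::real_normed_vector) \<Rightarrow> 'a \<Rightarrow> 'b"
  where "dir_deriv v f x = frechet_derivative f (at x) v"

text \<open>Meaningful for open \<open>S\<close>, the only case used below.\<close>

primrec Ck_on ::
  "nat \<Rightarrow> 'a::real_normed_vector set \<Rightarrow> ('a \<Rightarrow> 'b::real_normed_vector) \<Rightarrow> bool"
  where
    "Ck_on 0 S f \<longleftrightarrow> continuous_on S f"
  | "Ck_on (Suc k) S f \<longleftrightarrow>
       (\<forall>x\<in>S. f differentiable (at x)) \<and> (\<forall>v. Ck_on k S (dir_deriv v f))"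

definition smooth_on :: "'a::real_normed_vector set \<Rightarrow> ('a \<Rightarrow> 'b::real_normed_vector) \<Rightarrow> bool"
  where "smooth_on S f \<longleftrightarrow> (\<forall>k. Ck_on k S f)"

definition holomorphic_map_on ::
  "(complex^'n::finite) set \<Rightarrow> (complex^'n \<Rightarrow> complex^'m::finite) \<Rightarrow> bool"
  where "holomorphic_map_on S f \<longleftrightarrow>
    (\<forall>x\<in>S. \<exists>D. (f has_derivative D) (at x) \<and> (\<forall>c v. D (c *s v) = c *s D v))"


section \<open>Complex manifolds\<close>

text \<open>A chart is a coordinate domain \<open>U\<close> together with a coordinate map, whose values
  outside \<open>U\<close> are irrelevant.\<close>

type_synonym ('a, 'n) chart = "'a set \<times> ('a \<Rightarrow> complex^'n)"

definition chart_dom :: "('a, 'n::finite) chart \<Rightarrow> 'a set"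
  where "chart_dom c = fst c"

definition chart_map :: "('a, 'n::finite) chart \<Rightarrow> 'a \<Rightarrow> complex^'n"
  where "chart_map c = snd c"

definition chart_img :: "('a, 'n::finite) chart \<Rightarrow> (complex^'n) set"
  where "chart_img c = chart_map c ` chart_dom c"

definition chart_inv :: "('a, 'n::finite) chart \<Rightarrow> complex^'n \<Rightarrow> 'a"
  where "chart_inv c = inv_into (chart_dom c) (chart_map c)"

definition transition ::
  "('a, 'n::finite) chart \<Rightarrow> ('a, 'n) chart \<Rightarrow> complex^'n \<Rightarrow> complex^'n"
  where "transition c d = chart_map d \<circ> chart_inv c"

definition transition_dom ::
  "('a, 'n::finite) chart \<Rightarrow> ('a, 'n) chart \<Rightarrow> (complex^'n) set"
  where "transition_dom c d = chart_map c ` (chart_dom c \<inter> chart_dom d)"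

definition complex_manifold :: "'a topology \<Rightarrow> ('a, 'n::finite) chart set \<Rightarrow> bool"
  where "complex_manifold X \<A> \<longleftrightarrow>
    Hausdorff_space X \<and> second_countable X \<and>
    (\<Union>c\<in>\<A>. chart_dom c) = topspace X \<and>
    (\<forall>c\<in>\<A>. openin X (chart_dom c) \<and> open (chart_img c) \<and>
      homeomorphic_map (subtopology X (chart_dom c)) (top_of_set (chart_img c)) (chart_map c)) \<and>
    (\<forall>c\<in>\<A>. \<forall>d\<in>\<A>. holomorphic_map_on (transition_dom c d) (transition c d))"

definition in_chart :: "('a, 'n::finite) chart \<Rightarrow> ('a \<Rightarrow> real) \<Rightarrow> complex^'n \<Rightarrow> real"
  where "in_chart c f = f \<circ> chart_inv c"

definition smooth_function :: "('a, 'n::finite) chart set \<Rightarrow> ('a \<Rightarrow> real) \<Rightarrow> bool"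
  where "smooth_function \<A> f \<longleftrightarrow> (\<forall>c\<in>\<A>. smooth_on (chart_img c) (in_chart c f))"


section \<open>Hermitian metrics\<close>

text \<open>A Hermitian metric is given by its coefficient matrices \<open>g c x $ i $ j\<close>
  (that is, $g_{i\bar j}$) at the points \<open>x\<close> of the image of each chart \<open>c\<close>. These have to define
  the same sesquilinear form on overlaps. Holomorphic tangent vectors are identified with real
  ones by \<open>v \<leftrightarrow> 2 Re (\<Sum>i. v $ i * \<partial>/\<partial>z\<^sub>i)\<close>, i.e. with elements of
  the real vector space underlying \<open>complex^'n\<close>.\<close>

type_synonym ('a, 'n) metric = "('a, 'n) chart \<Rightarrow> complex^'n \<Rightarrow> complex^'n^'n"

definition sesq :: "complex^'n^'n \<Rightarrow> complex^'n::finite \<Rightarrow> complex^'n \<Rightarrow> complex"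
  where "sesq h v w = (\<Sum>i\<in>UNIV. \<Sum>j\<in>UNIV. h $ i $ j * v $ i * cnj (w $ j))"

definition pos_def_hermitian :: "complex^'n^'n::finite \<Rightarrow> bool"
  where "pos_def_hermitian h \<longleftrightarrow>
    (\<forall>i j. h $ j $ i = cnj (h $ i $ j)) \<and> (\<forall>v. v \<noteq> 0 \<longrightarrow> Re (sesq h v v) > 0)"

definition hermitian_metric :: "('a, 'n::finite) chart set \<Rightarrow> ('a, 'n) metric \<Rightarrow> bool"
  where "hermitian_metric \<A> g \<longleftrightarrow>
    (\<forall>c\<in>\<A>. smooth_on (chart_img c) (g c) \<and> (\<forall>x\<in>chart_img c. pos_def_hermitian (g c x))) \<and>
    (\<forall>c\<in>\<A>. \<forall>d\<in>\<A>. \<forall>x\<in>transition_dom c d. \<forall>v w.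
      sesq (g c x) v w =
      sesq (g d (transition c d x))
        (dir_deriv v (transition c d) x) (dir_deriv w (transition c d) x))"


section \<open>Differential forms in a chart\<close>

text \<open>A complex-valued \<open>p\<close>-form at a point is an alternating real-multilinear function of the
  tangent vectors \<open>v 0, \<dots>, v (p - 1)\<close>; the remaining entries of \<open>v\<close> are ignored.\<close>

type_synonym 'n cform = "(nat \<Rightarrow> complex^'n) \<Rightarrow> complex"

definition wedge :: "nat \<Rightarrow> nat \<Rightarrow> 'n::finite cform \<Rightarrow> 'n cform \<Rightarrow> 'n cform"
  where "wedge p q \<alpha> \<beta> v =
    (\<Sum>\<sigma> | \<sigma> permutes {..<p + q}.
      of_int (sign \<sigma>) * \<alpha> (\<lambda>i. v (\<sigma> i)) * \<beta> (\<lambda>i. v (\<sigma> (p + i)))) / (fact p * fact q)"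

text \<open>The \<open>m\<close>-fold wedge power of a 2-form.\<close>

primrec wedge_pow :: "nat \<Rightarrow> 'n::finite cform \<Rightarrow> 'n cform"
  where
    "wedge_pow 0 \<alpha> = (\<lambda>v. 1)"
  | "wedge_pow (Suc m) \<alpha> = wedge 2 (2 * m) \<alpha> (wedge_pow m \<alpha>)"

definition dz :: "'n::finite \<Rightarrow> 'n cform"
  where "dz i v = v 0 $ i"

definition dzbar :: "'n::finite \<Rightarrow> 'n cform"
  where "dzbar i v = cnj (v 0 $ i)"

definition wirt :: "'n::finite \<Rightarrow> (complex^'n \<Rightarrow> complex) \<Rightarrow> complex^'n \<Rightarrow> complex"
  where "wirt i f x = (dir_deriv (axis i 1) f x - \<i> * dir_deriv (axis i \<i>) f x) / 2"

definition wirtbar :: "'n::finite \<Rightarrow> (complex^'n \<Rightarrow> complex) \<Rightarrow> complex^'n \<Rightarrow> complex"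
  where "wirtbar i f x = (dir_deriv (axis i 1) f x + \<i> * dir_deriv (axis i \<i>) f x) / 2"

text \<open>The operators $\partial$ and $\bar\partial$ on fields of \<open>p\<close>-forms.\<close>

definition del :: "nat \<Rightarrow> (complex^'n \<Rightarrow> 'n::finite cform) \<Rightarrow> complex^'n \<Rightarrow> 'n cform"
  where "del p \<alpha> x v = (\<Sum>i\<in>UNIV. wedge 1 p (dz i) (\<lambda>w. wirt i (\<lambda>y. \<alpha> y w) x) v)"

definition delbar :: "nat \<Rightarrow> (complex^'n \<Rightarrow> 'n::finite cform) \<Rightarrow> complex^'n \<Rightarrow> 'n cform"
  where "delbar p \<alpha> x v = (\<Sum>i\<in>UNIV. wedge 1 p (dzbar i) (\<lambda>w. wirtbar i (\<lambda>y. \<alpha> y w) x) v)"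

definition i_ddbar :: "(complex^'n \<Rightarrow> real) \<Rightarrow> complex^'n::finite \<Rightarrow> 'n cform"
  where "i_ddbar f x v = \<i> * del 1 (delbar 0 (\<lambda>y w. of_real (f y))) x v"

definition assoc_form :: "complex^'n^'n \<Rightarrow> 'n::finite cform"
  where "assoc_form h v =
    \<i> * (\<Sum>i\<in>UNIV. \<Sum>j\<in>UNIV. h $ i $ j * wedge 1 1 (dz i) (dzbar j) v)"

text \<open>Positivity of a real (1,1)-form: \<open>\<eta>(v, J v) > 0\<close> for \<open>v \<noteq> 0\<close>, where \<open>J\<close> is
  multiplication by \<open>\<i>\<close>. For $\eta = \sqrt{-1} \sum h_{i\bar j} dz^i \wedge d\bar z^j$
  one has \<open>\<eta>(v, J v) = 2 * sesq h v v\<close>.\<close>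

definition positive_form :: "'n::finite cform \<Rightarrow> bool"
  where "positive_form \<eta> \<longleftrightarrow>
    (\<forall>v. v \<noteq> 0 \<longrightarrow>
      (let t = \<eta> (\<lambda>i. if i = 0 then v else \<i> *s v) in t \<in> \<real> \<and> Re t > 0))"

text \<open>The form $\omega + \sqrt{-1}\partial\bar\partial\varphi$ in the chart \<open>c\<close>.\<close>

definition deformed_form ::
  "('a, 'n::finite) metric \<Rightarrow> ('a \<Rightarrow> real) \<Rightarrow> ('a, 'n) chart \<Rightarrow> complex^'n \<Rightarrow> 'n cform"
  where "deformed_form g \<phi> c x v = assoc_form (g c x) v + i_ddbar (in_chart c \<phi>) x v"

definition monge_ampere ::
  "('a, 'n::finite) chart set \<Rightarrow> ('a, 'n) metric \<Rightarrow> ('a \<Rightarrow> real) \<Rightarrow> ('a \<Rightarrow> real) \<Rightarrow> bool"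
  where "monge_ampere \<A> g F \<phi> \<longleftrightarrow>
    (\<forall>c\<in>\<A>. \<forall>x\<in>chart_img c. \<forall>v.
      wedge_pow CARD('n) (deformed_form g \<phi> c x) v =
      of_real (exp (in_chart c F x)) * wedge_pow CARD('n) (assoc_form (g c x)) v)"

definition deformed_positive ::
  "('a, 'n::finite) chart set \<Rightarrow> ('a, 'n) metric \<Rightarrow> ('a \<Rightarrow> real) \<Rightarrow> bool"
  where "deformed_positive \<A> g \<phi> \<longleftrightarrow>
    (\<forall>c\<in>\<A>. \<forall>x\<in>chart_img c. positive_form (deformed_form g \<phi> c x))"


section \<open>\<open>C^k\<close> norms with respect to a metric\<close>

text \<open>The Riemannian metric underlying \<open>g\<close>, normalised by $g(\partial_i, \partial_{\bar j}) = g_{i\bar j}$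
  for its complex bilinear extension, i.e. \<open>G(v, w) = \<omega>(v, J w)\<close>.\<close>

definition riem :: "(complex^'n \<Rightarrow> complex^'n^'n) \<Rightarrow>
    complex^'n::finite \<Rightarrow> complex^'n \<Rightarrow> complex^'n \<Rightarrow> real"
  where "riem h x v w = 2 * Re (sesq (h x) v w)"

text \<open>The Levi-Civita covariant derivative $\nabla_v w$ at \<open>x\<close> for constant vector fields \<open>v\<close>, \<open>w\<close>,
  given by the Koszul formula.\<close>

definition christoffel :: "('v \<Rightarrow> 'v \<Rightarrow> 'v \<Rightarrow> real) \<Rightarrow> 'v::real_normed_vector \<Rightarrow> 'v \<Rightarrow> 'v \<Rightarrow> 'v"
  where "christoffel G x v w = (THE z. \<forall>u.
    G x z u = (dir_deriv v (\<lambda>y. G y w u) x + dir_deriv w (\<lambda>y. G y v u) x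
               - dir_deriv u (\<lambda>y. G y v w) x) / 2)"

text \<open>\<open>cov_deriv G f j x v\<close> is the \<open>j\<close>-th iterated covariant derivative of the function \<open>f\<close>
  at \<open>x\<close>, evaluated at the tangent vectors \<open>v 0, \<dots>, v (j - 1)\<close>; the last derivative is taken in
  the direction \<open>v 0\<close>.\<close>

primrec cov_deriv :: "('v \<Rightarrow> 'v \<Rightarrow> 'v \<Rightarrow> real) \<Rightarrow> ('v \<Rightarrow> real) \<Rightarrow> nat \<Rightarrow>
    'v::real_normed_vector \<Rightarrow> (nat \<Rightarrow> 'v) \<Rightarrow> real"
  where
    "cov_deriv G f 0 = (\<lambda>x v. f x)"
  | "cov_deriv G f (Suc j) = (\<lambda>x v. let w = (\<lambda>i. v (Suc i)) in
       dir_deriv (v 0) (\<lambda>y. cov_deriv G f j y w) x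
       - (\<Sum>i<j. cov_deriv G f j x (w(i := christoffel G x (v 0) (w i)))))"

definition orthonormal_frame :: "('v::euclidean_space \<Rightarrow> 'v \<Rightarrow> real) \<Rightarrow> (nat \<Rightarrow> 'v) \<Rightarrow> bool"
  where "orthonormal_frame B e \<longleftrightarrow>
    (\<forall>a<DIM('v). \<forall>b<DIM('v). B (e a) (e b) = (if a = b then 1 else 0))"

text \<open>The norm induced by the inner product \<open>B\<close> on covariant \<open>j\<close>-tensors; it does not depend on
  the choice of the orthonormal frame.\<close>

definition tensor_norm ::
  "('v::euclidean_space \<Rightarrow> 'v \<Rightarrow> real) \<Rightarrow> nat \<Rightarrow> ((nat \<Rightarrow> 'v) \<Rightarrow> real) \<Rightarrow> real"
  where "tensor_norm B j T =
    (let e = (SOME e. orthonormal_frame B e)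
     in sqrt (\<Sum>I\<in>{..<j} \<rightarrow>\<^sub>E {..<DIM('v)}. (T (\<lambda>i. e (I i)))\<^sup>2))"

text \<open>$\sum_{j \le k} \sup_M |\nabla^j f|_g$. The suprema are taken in \<open>ennreal\<close>, so that an
  upper bound on the norm includes finiteness.\<close>

definition Ck_norm ::
  "('a, 'n::finite) chart set \<Rightarrow> ('a, 'n) metric \<Rightarrow> nat \<Rightarrow> ('a \<Rightarrow> real) \<Rightarrow> ennreal"
  where "Ck_norm \<A> g k f =
    (\<Sum>j\<le>k. SUP c\<in>\<A>. SUP x\<in>chart_img c.
      ennreal (tensor_norm (riem (g c) x) j (cov_deriv (riem (g c)) (in_chart c f) j x)))"

end

theory Submission
  imports Defs "HOL-Complex_Analysis.Cauchy_Integral_Formula"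
begin

text \<open>The data \<open>F\<close> being fixed, including its additive constant, the normalised solution is unique, so
  the \<open>C^k\<close> norm of that single solution is an admissible \<open>C\<^sub>k\<close>: no a priori estimate is needed.

  Uniqueness: if \<open>\<phi>\<close> and \<open>\<psi>\<close> solve the equation, the eigenvalues of $\omega_\varphi$ relative to
  $\omega_\psi$ have product 1, so their sum is at least \<open>n\<close>; hence \<open>\<phi> - \<psi>\<close> is a subsolution of the
  Laplacian of $\omega_\psi$, and it is constant by the strong maximum principle.

  Finiteness: the covariant derivatives of a smooth function are locally bounded in one chart and
  coordinate invariant, so compactness bounds them in all charts simultaneously.\<close>

text \<open>The trace of the complex Hessian of the difference of two solutions with respect to the
  second deformed metric contains no first-order term, whatever the differential of the metric form
  is; hence the maximum principle applies to any Hermitian metric. The equation, an identity of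
  wedge powers, is read off at a single tuple: a simultaneous eigenbasis, each vector followed by
  its multiple by \<open>\<i>\<close>. There both forms are block diagonal and their powers become a
  common positive constant times a product of eigenvalues. Two features of the definitions shape the
  finiteness part. The supremum in \<open>Ck_norm\<close> runs over all charts of an atlas that may
  be infinite and whose images need not be bounded, so a bound has to be carried from one chart to
  all the others. And a transition map is only known to have a complex linear derivative at each
  point; Cauchy's formula upgrades it to class C^2. This serves every order, because the induction
  for the transformation law of \<open>cov_deriv\<close> cancels the second derivatives of the
  transition map at each step.\<close>

section \<open>Smooth maps\<close>

lemma Ck_on_cong:
  assumes "open S" "Ck_on k S f" "\<And>x. x \<in> S \<Longrightarrow> f x = g x"
  shows "Ck_on k S g"
  using assms(2,3)
proof (induction k arbitrary: f g)
  case 0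
  then show ?case by (metis Ck_on.simps(1) continuous_on_cong)
next
  case (Suc k)
  have D: "(g has_derivative D) (at x) \<longleftrightarrow> (f has_derivative D) (at x)" if "x \<in> S" for x D
    using has_derivative_transform_within_open[OF _ \<open>open S\<close> that] Suc.prems(2) by metis
  have "dir_deriv v f x = dir_deriv v g x" if "x \<in> S" for x v
    unfolding dir_deriv_def frechet_derivative_def using D[OF that] by simp
  moreover have "g differentiable at x" if "x \<in> S" for x
    using D[OF that] Suc.prems(1) that by (auto simp: differentiable_def)
  ultimately show ?case using Suc by (simp, metis)
qed

text \<open>No differentiability is assumed: \<open>frechet_derivative\<close> is chosen from the
  set of derivatives at the point, and functions with the same germ have the same set.\<close>

lemma dir_deriv_cong_open:
  assumes "open S" "x \<in> S" "\<And>y. y \<in> S \<Longrightarrow> f y = g y"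
  shows "dir_deriv v f x = dir_deriv v g x"
proof -
  have "(g has_derivative D) (at x) \<longleftrightarrow> (f has_derivative D) (at x)" for D
    using has_derivative_transform_within_open[OF _ assms(1,2)] assms(3) by metis
  then show ?thesis unfolding dir_deriv_def frechet_derivative_def by simp
qed

lemma Ck_on_imp_continuous_on: "Ck_on k S f \<Longrightarrow> continuous_on S f"
  by (cases k) (auto intro!: differentiable_imp_continuous_on
      simp: differentiable_on_def differentiable_at_withinI)

lemma Ck_on_Suc_D: "Ck_on (Suc k) S f \<Longrightarrow> Ck_on k S f"
proof (induction k arbitrary: f)
  case 0
  then show ?case using Ck_on_imp_continuous_on by (metis Ck_on.simps(1))
next
  case (Suc k)
  then show ?case by (metis Ck_on.simps(2))
qed

lemma smooth_on_imp_differentiable: "smooth_on S f \<Longrightarrow> x \<in> S \<Longrightarrow> f differentiable (at x)"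
  unfolding smooth_on_def by (metis Ck_on.simps(2))

lemma smooth_on_imp_continuous_on: "smooth_on S f \<Longrightarrow> continuous_on S f"
  unfolding smooth_on_def by (metis Ck_on.simps(1))

lemma smooth_on_dir_deriv: "smooth_on S f \<Longrightarrow> smooth_on S (dir_deriv v f)"
  unfolding smooth_on_def by (metis Ck_on.simps(2))

lemma smooth_on_cong:
  "open S \<Longrightarrow> smooth_on S f \<Longrightarrow> (\<And>x. x \<in> S \<Longrightarrow> f x = g x) \<Longrightarrow> smooth_on S g"
  unfolding smooth_on_def using Ck_on_cong by blast

lemma dir_deriv_eqI: "(f has_derivative D) (at x) \<Longrightarrow> dir_deriv v f x = D v"
  unfolding dir_deriv_def using frechet_derivative_at by fastforce

lemma has_derivative_dir_deriv:
  "f differentiable (at x) \<Longrightarrow> (f has_derivative (\<lambda>v. dir_deriv v f x)) (at x)"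
  unfolding dir_deriv_def by (simp add: frechet_derivative_works)

lemma dir_deriv_const [simp]: "dir_deriv v (\<lambda>x. c) = (\<lambda>x. 0)"
  by (rule ext, rule dir_deriv_eqI[where D="\<lambda>_. 0"]) simp

lemma Ck_on_const: "Ck_on k S (\<lambda>x. c)"
  by (induction k arbitrary: c) auto

lemma smooth_on_const [simp]: "smooth_on S (\<lambda>x. c)"
  by (simp add: smooth_on_def Ck_on_const)

lemma Ck_on_add:
  assumes "open S" "Ck_on k S f" "Ck_on k S g"
  shows "Ck_on k S (\<lambda>x. f x + g x)"
  using assms(2,3)
proof (induction k arbitrary: f g)
  case 0
  then show ?case by (simp add: continuous_on_add)
next
  case (Suc k)
  have D: "((\<lambda>x. f x + g x) has_derivative (\<lambda>v. dir_deriv v f x + dir_deriv v g x)) (at x)"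
    if "x \<in> S" for x
    using Suc.prems that by (intro has_derivative_add has_derivative_dir_deriv) auto
  have "Ck_on k S (dir_deriv v (\<lambda>x. f x + g x))" for v
  proof (rule Ck_on_cong[OF \<open>open S\<close>])
    show "Ck_on k S (\<lambda>x. dir_deriv v f x + dir_deriv v g x)" using Suc by simp
  qed (simp add: dir_deriv_eqI[OF D])
  then show ?case using D by (auto simp: differentiable_def)
qed

text \<open>By the Leibniz rule each directional derivative is a sum of two maps of the same shape,
  so induction on \<open>k\<close> applies. A general bounded bilinear map covers products, scalar
  multiples, coordinates and, with one factor constant, linear maps.\<close>

lemma Ck_on_bilinear:
  assumes bl: "bounded_bilinear (B :: 'b::real_normed_vector \<Rightarrow> 'c::real_normed_vector \<Rightarrow> 'd::real_normed_vector)"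
    and S: "open S" and f: "Ck_on k S f" and g: "Ck_on k S g"
  shows "Ck_on k S (\<lambda>x. B (f x) (g x))"
  using f g
proof (induction k arbitrary: f g)
  case 0
  then show ?case using bounded_bilinear.continuous_on[OF bl] by simp
next
  case (Suc k)
  have df: "f differentiable at x" "g differentiable at x" if "x \<in> S" for x
    using Suc.prems that by auto
  have D: "((\<lambda>x. B (f x) (g x)) has_derivative
      (\<lambda>v. B (f x) (dir_deriv v g x) + B (dir_deriv v f x) (g x))) (at x)" if "x \<in> S" for x
    using bounded_bilinear.FDERIV[OF bl has_derivative_dir_deriv has_derivative_dir_deriv] df[OF that] by blast
  have "Ck_on k S (dir_deriv v (\<lambda>x. B (f x) (g x)))" for v
  proof (rule Ck_on_cong[OF S])
    show "Ck_on k S (\<lambda>x. B (f x) (dir_deriv v g x) + B (dir_deriv v f x) (g x))"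
      using Suc by (intro Ck_on_add[OF S] Suc.IH) (auto intro: Ck_on_Suc_D[of k S, simplified])
  qed (simp add: dir_deriv_eqI[OF D])
  then show ?case using D by (auto simp: differentiable_def)
qed

lemma smooth_on_add:
  "open S \<Longrightarrow> smooth_on S f \<Longrightarrow> smooth_on S g \<Longrightarrow> smooth_on S (\<lambda>x. f x + g x)"
  by (simp add: smooth_on_def Ck_on_add)

lemma smooth_on_bilinear:
  "bounded_bilinear B \<Longrightarrow> open S \<Longrightarrow> smooth_on S f \<Longrightarrow> smooth_on S g \<Longrightarrow> smooth_on S (\<lambda>x. B (f x) (g x))"
  by (simp add: smooth_on_def Ck_on_bilinear)

lemma smooth_on_mult:
  fixes f g :: "_ \<Rightarrow> _::real_normed_algebra"
  shows "open S \<Longrightarrow> smooth_on S f \<Longrightarrow> smooth_on S g \<Longrightarrow> smooth_on S (\<lambda>x. f x * g x)"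
  by (rule smooth_on_bilinear[OF bounded_bilinear_mult])

lemma smooth_on_linear:
  assumes "bounded_linear L" "open S" "smooth_on S f"
  shows "smooth_on S (\<lambda>x. L (f x))"
proof -
  \<comment> \<open>A linear map is a bilinear one in \<open>r\<close> and \<open>y\<close>, taken
    at the constant \<open>r = 1\<close>.\<close>
  have "bounded_bilinear (\<lambda>(r::real) y. r *\<^sub>R L y)"
    using bounded_bilinear.comp[OF bounded_bilinear_scaleR bounded_linear_ident assms(1)] by simp
  from smooth_on_bilinear[OF this assms(2) smooth_on_const[of _ 1] assms(3)] show ?thesis by simp
qed

lemma smooth_on_minus:
  "open S \<Longrightarrow> smooth_on S f \<Longrightarrow> smooth_on S (\<lambda>x. - f x)"
  by (rule smooth_on_linear[OF bounded_linear_minus[OF bounded_linear_ident]])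

lemma smooth_on_diff:
  "open S \<Longrightarrow> smooth_on S f \<Longrightarrow> smooth_on S g \<Longrightarrow> smooth_on S (\<lambda>x. f x - g x)"
  using smooth_on_add[of S f "\<lambda>x. - g x"] by (simp add: smooth_on_minus)

lemma smooth_on_sum:
  assumes "open S" "\<And>i. i \<in> I \<Longrightarrow> smooth_on S (f i)"
  shows "smooth_on S (\<lambda>x. \<Sum>i\<in>I. f i x)"
  using assms(2) by (induction I rule: infinite_finite_induct) (auto intro!: smooth_on_add assms(1))

lemma smooth_on_prod:
  fixes f :: "_ \<Rightarrow> _ \<Rightarrow> 'b::real_normed_field"
  assumes "open S" "\<And>i. i \<in> I \<Longrightarrow> smooth_on S (f i)"
  shows "smooth_on S (\<lambda>x. \<Prod>i\<in>I. f i x)"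
  using assms(2) by (induction I rule: infinite_finite_induct) (auto intro!: smooth_on_mult assms(1))

lemma Ck_on_subset: "Ck_on k S f \<Longrightarrow> T \<subseteq> S \<Longrightarrow> Ck_on k T f"
  by (induction k arbitrary: f) (auto intro: continuous_on_subset)

lemma smooth_on_subset: "smooth_on S f \<Longrightarrow> T \<subseteq> S \<Longrightarrow> smooth_on T f"
  unfolding smooth_on_def using Ck_on_subset by blast

text \<open>The derivative involves only the inverse itself and a derivative of \<open>f\<close>; as
  \<open>f\<close> is smooth, class \<open>k\<close> of the inverse yields class
  \<open>k + 1\<close>.\<close>

lemma smooth_on_inverse:
  fixes f :: "_ \<Rightarrow> 'b::real_normed_field"
  assumes S: "open S" and f: "smooth_on S f" and nz: "\<And>x. x \<in> S \<Longrightarrow> f x \<noteq> 0"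
  shows "smooth_on S (\<lambda>x. inverse (f x))"
proof -
  have D: "((\<lambda>x. inverse (f x)) has_derivative
      (\<lambda>v. - (inverse (f x) * dir_deriv v f x * inverse (f x)))) (at x)" if "x \<in> S" for x
    by (intro Deriv.has_derivative_inverse nz that has_derivative_dir_deriv
        smooth_on_imp_differentiable[OF f that])
  have "Ck_on k S (\<lambda>x. inverse (f x))" for k
  proof (induction k)
    case 0
    then show ?case using smooth_on_imp_continuous_on[OF f] nz by (simp add: continuous_on_inverse)
  next
    case (Suc k)
    have "Ck_on k S (dir_deriv v (\<lambda>x. inverse (f x)))" for v
    proof (rule Ck_on_cong[OF S])
      have a: "Ck_on k S (\<lambda>x. inverse (f x) * dir_deriv v f x * inverse (f x))"
        using smooth_on_dir_deriv[OF f] Suc unfolding smooth_on_def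
        by (intro Ck_on_bilinear[OF bounded_bilinear_mult S]) auto
      show "Ck_on k S (\<lambda>x. (-1) * (inverse (f x) * dir_deriv v f x * inverse (f x)))"
        by (rule Ck_on_bilinear[OF bounded_bilinear_mult S Ck_on_const a])
    qed (simp add: dir_deriv_eqI[OF D])
    then show ?case using D by (auto simp: differentiable_def)
  qed
  then show ?thesis by (simp add: smooth_on_def)
qed

text \<open>The mean value theorem twice: in \<open>s\<close> for the difference of \<open>f\<close>
  between \<open>t = h\<close> and \<open>t = 0\<close>, then in \<open>t\<close> for
  \<open>dir_deriv v f\<close>. The second difference is symmetric in \<open>v\<close> and
  \<open>w\<close>, which is what the symmetry of mixed derivatives rests on.\<close>

lemma second_difference_mean_value:
  fixes f :: "'a::real_normed_vector \<Rightarrow> real"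
  assumes h: "h > 0" and S: "\<And>s t. 0 \<le> s \<Longrightarrow> s \<le> h \<Longrightarrow> 0 \<le> t \<Longrightarrow> t \<le> h \<Longrightarrow> x + s *\<^sub>R v + t *\<^sub>R w \<in> S"
    and f: "\<And>y. y \<in> S \<Longrightarrow> f differentiable at y"
    and df: "\<And>y. y \<in> S \<Longrightarrow> dir_deriv v f differentiable at y"
  obtains s t where "0 \<le> s" "s \<le> h" "0 \<le> t" "t \<le> h"
    "f (x + h *\<^sub>R v + h *\<^sub>R w) - f (x + h *\<^sub>R v) - f (x + h *\<^sub>R w) + f x =
      h * h * dir_deriv w (dir_deriv v f) (x + s *\<^sub>R v + t *\<^sub>R w)"
proof -
  have D1: "((\<lambda>s. f (x + s *\<^sub>R v + t *\<^sub>R w)) has_real_derivative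
      dir_deriv v f (x + s *\<^sub>R v + t *\<^sub>R w)) (at s)" if "0 \<le> s" "s \<le> h" "0 \<le> t" "t \<le> h" for s t
  proof -
    have "((\<lambda>s. x + s *\<^sub>R v + t *\<^sub>R w) has_derivative (\<lambda>r. r *\<^sub>R v)) (at s)"
      by (auto intro!: derivative_eq_intros)
    from has_derivative_compose[OF this has_derivative_dir_deriv[OF f[OF S[OF that]]]]
    have "((\<lambda>s. f (x + s *\<^sub>R v + t *\<^sub>R w)) has_derivative
        (\<lambda>r. dir_deriv (r *\<^sub>R v) f (x + s *\<^sub>R v + t *\<^sub>R w))) (at s)" .
    moreover have "dir_deriv (r *\<^sub>R v) f y = dir_deriv v f y * r" if "y \<in> S" for r y
      using linear_scale[OF has_derivative_linear[OF has_derivative_dir_deriv[OF f[OF that]]], of r v] by simp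
    ultimately show ?thesis by (simp add: has_field_derivative_def S that)
  qed
  have D2: "((\<lambda>t. dir_deriv v f (x + s *\<^sub>R v + t *\<^sub>R w)) has_real_derivative
      dir_deriv w (dir_deriv v f) (x + s *\<^sub>R v + t *\<^sub>R w)) (at t)" if "0 \<le> s" "s \<le> h" "0 \<le> t" "t \<le> h" for s t
  proof -
    have "((\<lambda>t. x + s *\<^sub>R v + t *\<^sub>R w) has_derivative (\<lambda>r. r *\<^sub>R w)) (at t)"
      by (auto intro!: derivative_eq_intros)
    from has_derivative_compose[OF this has_derivative_dir_deriv[OF df[OF S[OF that]]]]
    have "((\<lambda>t. dir_deriv v f (x + s *\<^sub>R v + t *\<^sub>R w)) has_derivative
        (\<lambda>r. dir_deriv (r *\<^sub>R w) (dir_deriv v f) (x + s *\<^sub>R v + t *\<^sub>R w))) (at t)" .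
    moreover have "dir_deriv (r *\<^sub>R w) (dir_deriv v f) y = dir_deriv w (dir_deriv v f) y * r" if "y \<in> S" for r y
      using linear_scale[OF has_derivative_linear[OF has_derivative_dir_deriv[OF df[OF that]]], of r w] by simp
    ultimately show ?thesis by (simp add: has_field_derivative_def S that)
  qed
  have "\<exists>s>0. s < h \<and> (f (x + h *\<^sub>R v + h *\<^sub>R w) - f (x + h *\<^sub>R v + 0 *\<^sub>R w)) - (f (x + 0 *\<^sub>R v + h *\<^sub>R w) - f (x + 0 *\<^sub>R v + 0 *\<^sub>R w)) =
     (h - 0) * (dir_deriv v f (x + s *\<^sub>R v + h *\<^sub>R w) - dir_deriv v f (x + s *\<^sub>R v + 0 *\<^sub>R w))"
    by (rule MVT2[OF h]) (intro derivative_intros D1, use h in auto)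
  then obtain s where s: "0 < s" "s < h"
    "f (x + h *\<^sub>R v + h *\<^sub>R w) - f (x + h *\<^sub>R v) - f (x + h *\<^sub>R w) + f x =
     h * (dir_deriv v f (x + s *\<^sub>R v + h *\<^sub>R w) - dir_deriv v f (x + s *\<^sub>R v + 0 *\<^sub>R w))"
    by auto
  have "\<exists>t>0. t < h \<and> dir_deriv v f (x + s *\<^sub>R v + h *\<^sub>R w) - dir_deriv v f (x + s *\<^sub>R v + 0 *\<^sub>R w) =
      (h - 0) * dir_deriv w (dir_deriv v f) (x + s *\<^sub>R v + t *\<^sub>R w)"
    by (rule MVT2[OF h]) (intro D2, use s in auto)
  then obtain t where "0 < t" "t < h" "dir_deriv v f (x + s *\<^sub>R v + h *\<^sub>R w) - dir_deriv v f (x + s *\<^sub>R v + 0 *\<^sub>R w) =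
      h * dir_deriv w (dir_deriv v f) (x + s *\<^sub>R v + t *\<^sub>R w)" by auto
  with s that[of s t] show ?thesis by simp
qed

text \<open>By the symmetry of the second difference, the value of one mixed derivative at some
  point of a small parallelogram at \<open>x\<close> equals the value of the other at another such
  point; continuity carries this to \<open>x\<close>.\<close>

lemma dir_deriv_commute_real:
  fixes f :: "'a::real_normed_vector \<Rightarrow> real"
  assumes S: "open S" and f: "Ck_on 2 S f" and x: "x \<in> S"
  shows "dir_deriv v (dir_deriv w f) x = dir_deriv w (dir_deriv v f) x"
proof (rule ccontr)
  assume ne: "\<not> ?thesis"
  \<comment> \<open>Half the gap, so that a number within \<open>e\<close> of one value cannot be
    within \<open>e\<close> of the other.\<close>
  define e where "e = \<bar>dir_deriv v (dir_deriv w f) x - dir_deriv w (dir_deriv v f) x\<bar> / 2"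
  have e: "e > 0" using ne by (simp add: e_def)
  have d: "f differentiable at y" "dir_deriv u f differentiable at y"
    "continuous_on S (dir_deriv u' (dir_deriv u f))" if "y \<in> S" for u u' y
    using f that by (auto simp: numeral_2_eq_2)
  have near: "\<exists>d>0. \<forall>y. dist y x < d \<longrightarrow> y \<in> S \<and> \<bar>dir_deriv u' (dir_deriv u f) y - dir_deriv u' (dir_deriv u f) x\<bar> < e" for u u'
  proof -
    have "isCont (dir_deriv u' (dir_deriv u f)) x"
      using d(3)[OF x, of u' u] S x by (simp add: continuous_on_eq_continuous_at)
    then obtain d1 where "d1 > 0" "\<And>y. dist y x < d1 \<Longrightarrow> \<bar>dir_deriv u' (dir_deriv u f) y - dir_deriv u' (dir_deriv u f) x\<bar> < e"
      using e unfolding continuous_at_eps_delta dist_real_def by (metis dist_commute)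
    moreover obtain d2 where "d2 > 0" "\<And>y. dist y x < d2 \<Longrightarrow> y \<in> S"
      using S x by (auto simp: open_dist)
    ultimately show ?thesis by (intro exI[of _ "min d1 d2"]) auto
  qed
  obtain d1 where d1: "d1 > 0" "\<And>y. dist y x < d1 \<Longrightarrow> y \<in> S"
     "\<And>y. dist y x < d1 \<Longrightarrow> \<bar>dir_deriv v (dir_deriv w f) y - dir_deriv v (dir_deriv w f) x\<bar> < e"
    using near[of v w] by blast
  obtain d2 where d2: "d2 > 0" "\<And>y. dist y x < d2 \<Longrightarrow> y \<in> S"
     "\<And>y. dist y x < d2 \<Longrightarrow> \<bar>dir_deriv w (dir_deriv v f) y - dir_deriv w (dir_deriv v f) x\<bar> < e"
    using near[of w v] by blast
  define d where "d = min d1 d2"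
  \<comment> \<open>The parallelogram with sides \<open>h\<close> times \<open>v\<close> and
    \<open>w\<close> has to stay within distance \<open>d\<close> of \<open>x\<close>.\<close>
  define h where "h = d / (2 * (norm v + norm w + 1))"
  have pos: "norm v + norm w + 1 > 0" by (smt (verit) norm_ge_zero)
  have h: "h > 0" using d1(1) d2(1) pos by (auto simp: h_def d_def)
  have close: "dist (x + s *\<^sub>R v + t *\<^sub>R w) x < d" "dist (x + t *\<^sub>R w + s *\<^sub>R v) x < d" if "0 \<le> s" "s \<le> h" "0 \<le> t" "t \<le> h" for s t
  proof -
    have "dist (x + s *\<^sub>R v + t *\<^sub>R w) x \<le> norm (s *\<^sub>R v) + norm (t *\<^sub>R w)"
      using norm_triangle_ineq[of "s *\<^sub>R v" "t *\<^sub>R w"] by (simp add: dist_norm add.assoc)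
    also have "\<dots> \<le> h * norm v + h * norm w" using that by (auto intro!: add_mono mult_right_mono)
    also have "\<dots> < h * (2 * (norm v + norm w + 1))" 
    proof -
      have "h * (2 * (norm v + norm w + 1)) - (h * norm v + h * norm w) = h * (norm v + norm w + 2)"
        by (simp add: algebra_simps)
      then show ?thesis using h pos by (smt (verit) mult_pos_pos)
    qed
    also have "\<dots> = d" using pos by (simp add: h_def)
    finally show "dist (x + s *\<^sub>R v + t *\<^sub>R w) x < d" .
    then show "dist (x + t *\<^sub>R w + s *\<^sub>R v) x < d" by (simp add: algebra_simps)
  qed
  obtain s t where 1: "0 \<le> s" "s \<le> h" "0 \<le> t" "t \<le> h"
    "f (x + h *\<^sub>R v + h *\<^sub>R w) - f (x + h *\<^sub>R v) - f (x + h *\<^sub>R w) + f x =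
      h * h * dir_deriv w (dir_deriv v f) (x + s *\<^sub>R v + t *\<^sub>R w)"
    by (rule second_difference_mean_value[OF h, of x v w S f])
      (use close d2 d in \<open>auto simp: d_def\<close>)
  obtain s' t' where 2: "0 \<le> s'" "s' \<le> h" "0 \<le> t'" "t' \<le> h"
    "f (x + h *\<^sub>R w + h *\<^sub>R v) - f (x + h *\<^sub>R w) - f (x + h *\<^sub>R v) + f x =
      h * h * dir_deriv v (dir_deriv w f) (x + s' *\<^sub>R w + t' *\<^sub>R v)"
    by (rule second_difference_mean_value[OF h, of x w v S f])
      (use close d2 d in \<open>auto simp: d_def\<close>)
  have "h * h * dir_deriv w (dir_deriv v f) (x + s *\<^sub>R v + t *\<^sub>R w) = h * h * dir_deriv v (dir_deriv w f) (x + s' *\<^sub>R w + t' *\<^sub>R v)"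
    unfolding 1(5)[symmetric] 2(5)[symmetric] by (simp add: algebra_simps)
  then have "dir_deriv w (dir_deriv v f) (x + s *\<^sub>R v + t *\<^sub>R w) = dir_deriv v (dir_deriv w f) (x + s' *\<^sub>R w + t' *\<^sub>R v)"
    using h by simp
  moreover have "\<bar>dir_deriv w (dir_deriv v f) (x + s *\<^sub>R v + t *\<^sub>R w) - dir_deriv w (dir_deriv v f) x\<bar> < e"
    using d2(3) close(1)[of s t] 1 by (auto simp: d_def)
  moreover have "\<bar>dir_deriv v (dir_deriv w f) (x + s' *\<^sub>R w + t' *\<^sub>R v) - dir_deriv v (dir_deriv w f) x\<bar> < e"
    using d1(3) close(2)[of t' s'] 2 by (auto simp: d_def)
  moreover have False if "p = q" "\<bar>p - a\<bar> < \<bar>b - a\<bar> / 2" "\<bar>q - b\<bar> < \<bar>b - a\<bar> / 2" for a b p q :: real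
    using that by (auto simp: abs_real_def split: if_splits)
  ultimately show False unfolding e_def by blast
qed

lemma dir_deriv_linear_map:
  assumes "bounded_linear L" "f differentiable at x"
  shows "dir_deriv v (\<lambda>y. L (f y)) x = L (dir_deriv v f x)"
  by (rule dir_deriv_eqI)
    (rule bounded_linear.has_derivative[OF assms(1) has_derivative_dir_deriv[OF assms(2)]])

lemma dir_deriv_commute:
  fixes f :: "'a::real_normed_vector \<Rightarrow> 'b::euclidean_space"
  assumes S: "open S" and f: "Ck_on 2 S f" and x: "x \<in> S"
  shows "dir_deriv v (dir_deriv w f) x = dir_deriv w (dir_deriv v f) x"
proof (rule euclidean_eqI)
  fix b :: 'b assume "b \<in> Basis"
  have bl: "bounded_linear (\<lambda>y. y \<bullet> b)" by (rule bounded_linear_inner_left)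
  have d: "f differentiable at y" "dir_deriv u f differentiable at y" 
    if "y \<in> S" for u y
    using f that by (auto simp: numeral_2_eq_2)
  have 1: "dir_deriv u (\<lambda>y. f y \<bullet> b) y = dir_deriv u f y \<bullet> b" if "y \<in> S" for u y
    by (rule dir_deriv_linear_map[OF bl d(1)[OF that]])
  have 2: "dir_deriv u (dir_deriv u' (\<lambda>y. f y \<bullet> b)) y = dir_deriv u (dir_deriv u' f) y \<bullet> b" if "y \<in> S" for u u' y
    using dir_deriv_cong_open[OF S that 1] dir_deriv_linear_map[OF bl d(2)[OF that]] by simp
  have "Ck_on 2 S (\<lambda>y. f y \<bullet> b)"
    by (rule Ck_on_bilinear[OF bounded_bilinear_inner S f Ck_on_const])
  from dir_deriv_commute_real[OF S this x, of v w] 2[OF x]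
  show "dir_deriv v (dir_deriv w f) x \<bullet> b = dir_deriv w (dir_deriv v f) x \<bullet> b" by simp
qed

section \<open>Holomorphic maps\<close>

definition holomorphic_function_on :: "(complex^'n::finite) set \<Rightarrow> (complex^'n \<Rightarrow> complex) \<Rightarrow> bool"
  where "holomorphic_function_on S f \<longleftrightarrow>
    (\<forall>x\<in>S. \<exists>D. (f has_derivative D) (at x) \<and> (\<forall>c v. D (c *s v) = c * D v))"

lemma holomorphic_function_on_dir_deriv:
  assumes "holomorphic_function_on S f" "x \<in> S"
  shows "(f has_derivative (\<lambda>v. dir_deriv v f x)) (at x)"
    and "dir_deriv (c *s v) f x = c * dir_deriv v f x"
proof -
  obtain D where D: "(f has_derivative D) (at x)" "\<And>c v. D (c *s v) = c * D v"
    using assms by (auto simp: holomorphic_function_on_def)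
  then show "dir_deriv (c *s v) f x = c * dir_deriv v f x"
    by (simp add: dir_deriv_eqI[OF D(1)])
  show "(f has_derivative (\<lambda>v. dir_deriv v f x)) (at x)"
    using D(1) by (simp add: dir_deriv_eqI[OF D(1)])
qed

section \<open>Cauchy's formula along complex lines\<close>

lemma norm_scalar_mult_complex: "norm (c *s (v :: complex^'n::finite)) = cmod c * norm v"
  by (simp add: norm_vec_def norm_mult L2_set_right_distrib)

lemma bounded_bilinear_scalar_mult: "bounded_bilinear (\<lambda>c (v :: complex^'n::finite). c *s v)"
proof (rule bounded_bilinear.intro)
  show "\<exists>K. \<forall>a b. norm (a *s (b :: complex^'n)) \<le> norm a * norm b * K"
    by (rule exI[of _ 1]) (simp add: norm_scalar_mult_complex)
qed (simp_all add: vec_eq_iff algebra_simps)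

text \<open>Cauchy's formula for the derivative at 0 of the one-variable function taking
  \<open>z\<close> to \<open>f (x + z *s v)\<close>. The right-hand side contains no derivative of
  \<open>f\<close>, so regularity of \<open>f\<close> in \<open>x\<close> is inherited by its
  derivative.\<close>

lemma dir_deriv_Cauchy_integral:
  fixes f :: "complex^'n::finite \<Rightarrow> complex"
  assumes f: "holomorphic_function_on S f" and r: "r > 0"
    and S: "\<And>z. cmod z \<le> r \<Longrightarrow> x + z *s v \<in> S" and opn: "open S"
  shows "dir_deriv v f x = integral (cbox 0 1)
    (\<lambda>t::real. f (x + (r * exp (2 * of_real pi * \<i> * t)) *s v) * (exp (- (2 * of_real pi * \<i> * t)) / r))"
proof -
  define F where "F z = f (x + z *s v)" for z
  have D: "(F has_field_derivative dir_deriv v f (x + z *s v)) (at z)" if "x + z *s v \<in> S" for z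
  proof -
    have "((\<lambda>z. x + z *s v) has_derivative (\<lambda>r. r *s v)) (at z)"
      using bounded_linear_imp_has_derivative[OF bounded_bilinear.bounded_linear_left[OF bounded_bilinear_scalar_mult[where 'n='n]], of v "at z"]
      by (auto intro!: derivative_eq_intros)
    from has_derivative_compose[OF this holomorphic_function_on_dir_deriv(1)[OF f that]]
    show ?thesis unfolding F_def has_field_derivative_def
      by (rule has_derivative_eq_rhs) (simp add: holomorphic_function_on_dir_deriv(2)[OF f that] mult.commute fun_eq_iff)
  qed
  have "F holomorphic_on cball 0 r"
  proof (rule holomorphic_onI)
    fix z :: complex assume "z \<in> cball 0 r"
    then have "x + z *s v \<in> S" using S by simp
    from has_field_derivative_at_within[OF D[OF this]]
    show "F field_differentiable at z within cball 0 r" unfolding field_differentiable_def by blast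
  qed
  then have "contour_integral (circlepath 0 r) (\<lambda>u. F u / (u - 0)^2) = (2 * pi * \<i>) * deriv F 0"
    using r by (intro Cauchy_contour_integral_circlepath_2 holomorphic_on_imp_continuous_on
        holomorphic_on_subset[OF _ ball_subset_cball]) auto
  moreover have "deriv F 0 = dir_deriv v f x"
    using DERIV_imp_deriv[OF D[of 0]] S[of 0] r by simp
  ultimately have "dir_deriv v f x = contour_integral (circlepath 0 r) (\<lambda>u. F u / u^2) / (2 * pi * \<i>)"
    by (simp add: field_simps)
  also have "\<dots> = integral {0..1} (\<lambda>t. F (circlepath 0 r t) / (circlepath 0 r t)^2 * vector_derivative (circlepath 0 r) (at t)) / (2 * pi * \<i>)"
    by (simp add: contour_integral_integral)
  also have "\<dots> = integral {0..1} (\<lambda>t. F (circlepath 0 r t) / (circlepath 0 r t)^2 * vector_derivative (circlepath 0 r) (at t) * (1 / (2 * pi * \<i>)))"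
    by (subst integral_mult_left) simp
  \<comment> \<open>The circle c(t) satisfies c' = 2 pi i c, so c' / (2 pi i c^2) = 1 / c.\<close>
  also have "\<dots> = integral {0..1} (\<lambda>t::real. f (x + (r * exp (2 * of_real pi * \<i> * t)) *s v) * (exp (- (2 * of_real pi * \<i> * t)) / r))"
    unfolding vector_derivative_circlepath
    using r by (intro integral_cong) (simp add: F_def circlepath vector_derivative_circlepath field_simps exp_minus power2_eq_square)
  finally show ?thesis by simp
qed

text \<open>One radius serves all base points of \<open>ball x0 R\<close>, so the Cauchy integral is
  taken over a fixed circle and depends on the base point only as a parameter.\<close>

lemma scalar_mult_cball_subset:
  fixes v :: "complex^'n::finite"
  assumes "R > 0"
  obtains r where "r > 0" "\<And>x z. x \<in> ball x0 R \<Longrightarrow> cmod z \<le> r \<Longrightarrow> x + z *s v \<in> ball x0 (2 * R)"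
proof
  show "R / (norm v + 1) > 0" using assms by (simp add: add_nonneg_pos)
  fix x z assume "x \<in> ball x0 R" "cmod z \<le> R / (norm v + 1)"
  have "norm (z *s v) \<le> R / (norm v + 1) * norm v"
    unfolding norm_scalar_mult_complex using \<open>cmod z \<le> _\<close> by (rule mult_right_mono) simp
  also have "\<dots> \<le> R"
  proof -
    have "norm v + 1 > 0" by (simp add: add_nonneg_pos)
    then show ?thesis using assms by (simp add: pos_divide_le_eq algebra_simps)
  qed
  finally have "norm (z *s v) \<le> R" .
  moreover have "dist x0 (x + z *s v) \<le> dist x0 x + norm (z *s v)"
    by (metis dist_norm dist_triangle dist_add_cancel add.right_neutral dist_0_norm)
  ultimately show "x + z *s v \<in> ball x0 (2 * R)" using \<open>x \<in> _\<close> by simp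
qed

lemma holomorphic_function_on_imp_continuous_on:
  assumes "holomorphic_function_on S f"
  shows "continuous_on S f"
proof (rule continuous_at_imp_continuous_on, rule ballI)
  show "isCont f x" if "x \<in> S" for x
    by (rule has_derivative_continuous[OF holomorphic_function_on_dir_deriv(1)[OF assms that]])
qed

text \<open>The Cauchy integrand is jointly continuous in the base point and the angle. This has to
  precede differentiation under the integral sign, whose rule asks for a continuous derivative of
  the integrand.\<close>

lemma holomorphic_function_on_continuous_dir_deriv:
  fixes f :: "complex^'n::finite \<Rightarrow> complex"
  assumes f: "holomorphic_function_on S f" and opn: "open S"
  shows "continuous_on S (dir_deriv v f)"
proof -
  have "\<exists>R>0. continuous_on (ball x0 R) (dir_deriv v f)" if "x0 \<in> S" for x0
  proof -
    obtain R' where "R' > 0" "ball x0 R' \<subseteq> S"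
      using opn \<open>x0 \<in> S\<close> open_contains_ball by blast
    then obtain R where R: "R > 0" "ball x0 (2 * R) \<subseteq> S"
      by (intro that[of "R' / 2"]) auto
    obtain r where r: "r > 0" "\<And>x z. x \<in> ball x0 R \<Longrightarrow> cmod z \<le> r \<Longrightarrow> x + z *s v \<in> ball x0 (2 * R)"
      using scalar_mult_cball_subset[OF R(1)] by metis
    have cf: "continuous_on S f"
      by (rule holomorphic_function_on_imp_continuous_on[OF f])
    define \<gamma> where "\<gamma> t = (r * exp (2 * of_real pi * \<i> * t)) *s v" for t :: real
    define k where "k t = exp (- (2 * of_real pi * \<i> * t)) / r" for t :: real
    have inS: "x + \<gamma> t \<in> S" if "x \<in> ball x0 R" for x t
      using subsetD[OF R(2) r(2)[OF that]] r by (simp add: \<gamma>_def norm_mult)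
    have cg: "continuous_on T \<gamma>" for T unfolding \<gamma>_def
      by (intro continuous_intros bounded_bilinear.continuous_on[OF bounded_bilinear_scalar_mult])
    have ck: "continuous_on T k" for T unfolding k_def using r by (intro continuous_intros) auto
    have c1: "continuous_on T (\<lambda>p. fst p + \<gamma> (snd p))" for T
      by (intro continuous_on_add continuous_on_fst continuous_on_snd continuous_on_id
          continuous_on_compose2[OF cg[of UNIV] continuous_on_snd]) auto
    have "continuous_on (ball x0 R \<times> cbox 0 1) (\<lambda>p. f (fst p + \<gamma> (snd p)) * k (snd p))"
      by (intro continuous_on_mult continuous_on_compose2[OF cf c1] continuous_on_compose2[OF ck[of UNIV] continuous_on_snd] continuous_on_id)
        (auto simp del: mem_ball intro: inS)
    then have "continuous_on (ball x0 R \<times> cbox 0 1) (\<lambda>(x, t). f (x + \<gamma> t) * k t)"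
      by (simp add: case_prod_unfold)
    from integral_continuous_on_param[OF this]
    have "continuous_on (ball x0 R) (\<lambda>x. integral (cbox 0 1) (\<lambda>t. f (x + \<gamma> t) * k t))" .
    moreover have "integral (cbox 0 1) (\<lambda>t. f (x + \<gamma> t) * k t) = dir_deriv v f x" if "x \<in> ball x0 R" for x
      unfolding \<gamma>_def k_def
      by (rule dir_deriv_Cauchy_integral[OF f r(1) subsetD[OF R(2) r(2)[OF that]] opn, symmetric])
    ultimately have "continuous_on (ball x0 R) (dir_deriv v f)"
      by (rule continuous_on_eq)
    with R show ?thesis by blast
  qed
  then have "isCont (dir_deriv v f) x" if "x \<in> S" for x
    using that continuous_on_eq_continuous_at[OF open_ball] centre_in_ball by blast
  then show ?thesis by (simp add: continuous_at_imp_continuous_on)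
qed

text \<open>Differentiating the Cauchy integral under the integral sign gives the derivatives of
  \<open>dir_deriv v f\<close>, which are again parameter integrals and hence continuous.\<close>

lemma holomorphic_function_on_Ck2:
  fixes f :: "complex^'n::finite \<Rightarrow> complex"
  assumes f: "holomorphic_function_on S f" and opn: "open S"
  shows "Ck_on 2 S f"
proof -
  have cD: "continuous_on S (dir_deriv v f)" for v
    by (rule holomorphic_function_on_continuous_dir_deriv[OF f opn])
  \<comment> \<open>All first derivatives as one map into the bounded linear operators, the form in
    which the Leibniz rule takes the derivative of the integrand.\<close>
  define Df where "Df y = Blinfun (\<lambda>v. dir_deriv v f y)" for y
  have Df: "blinfun_apply (Df y) = (\<lambda>v. dir_deriv v f y)" if "y \<in> S" for y
    unfolding Df_def by (rule bounded_linear_Blinfun_apply)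
      (rule has_derivative_bounded_linear[OF holomorphic_function_on_dir_deriv(1)[OF f that]])
  have cDf: "continuous_on S Df"
    by (rule continuous_on_blinfun_componentwise)
      (rule continuous_on_cong[THEN iffD1, OF refl _ cD], simp add: Df)
  have "\<exists>R>0. (\<forall>x\<in>ball x0 R. dir_deriv v f differentiable at x) \<and> (\<forall>w. continuous_on (ball x0 R) (dir_deriv w (dir_deriv v f)))" if "x0 \<in> S" for x0 v
  proof -
    obtain R' where "R' > 0" "ball x0 R' \<subseteq> S"
      using opn \<open>x0 \<in> S\<close> open_contains_ball by blast
    then obtain R where R: "R > 0" "ball x0 (2 * R) \<subseteq> S"
      by (intro that[of "R' / 2"]) auto
    obtain r where r: "r > 0" "\<And>x z. x \<in> ball x0 R \<Longrightarrow> cmod z \<le> r \<Longrightarrow> x + z *s v \<in> ball x0 (2 * R)"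
      using scalar_mult_cball_subset[OF R(1)] by metis
    define \<gamma> where "\<gamma> t = (r * exp (2 * of_real pi * \<i> * t)) *s v" for t :: real
    define k where "k t = exp (- (2 * of_real pi * \<i> * t)) / r" for t :: real
    have inS: "x + \<gamma> t \<in> S" if "x \<in> ball x0 R" for x t
      using subsetD[OF R(2) r(2)[OF that]] r by (simp add: \<gamma>_def norm_mult)
    have cg: "continuous_on T \<gamma>" for T unfolding \<gamma>_def
      by (intro continuous_intros bounded_bilinear.continuous_on[OF bounded_bilinear_scalar_mult])
    have ck: "continuous_on T k" for T unfolding k_def using r by (intro continuous_intros) auto
    define fx where "fx x t = blinfun_mult_left (k t) o\<^sub>L Df (x + \<gamma> t)" for x t
    have fx: "((\<lambda>x. f (x + \<gamma> t) * k t) has_derivative blinfun_apply (fx x t)) (at x within ball x0 R)"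
      if "x \<in> ball x0 R" for x t
    proof -
      have "((\<lambda>x. x + \<gamma> t) has_derivative (\<lambda>h. h)) (at x within ball x0 R)"
        by (auto intro!: derivative_eq_intros)
      from has_derivative_compose[OF this holomorphic_function_on_dir_deriv(1)[OF f inS[OF that]]]
      have "((\<lambda>x. f (x + \<gamma> t)) has_derivative (\<lambda>h. dir_deriv h f (x + \<gamma> t))) (at x within ball x0 R)" .
      from has_derivative_mult_left[OF this, of "k t"]
      show ?thesis by (simp add: fx_def Df[OF inS[OF that]] fun_eq_iff blinfun.bilinear_simps has_derivative_eq_rhs)
    qed
    have c1: "continuous_on T (\<lambda>p. fst p + \<gamma> (snd p))" for T
      by (intro continuous_on_add continuous_on_fst continuous_on_snd continuous_on_id
          continuous_on_compose2[OF cg[of UNIV] continuous_on_snd]) auto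
    have "continuous_on (ball x0 R \<times> cbox 0 1) (\<lambda>p. fx (fst p) (snd p))"
      unfolding fx_def
      by (intro bounded_bilinear.continuous_on[OF bounded_bilinear_blinfun_compose]
          bounded_linear.continuous_on[OF bounded_linear_blinfun_mult_left]
          continuous_on_compose2[OF ck[of UNIV] continuous_on_snd] continuous_on_id
          continuous_on_compose2[OF cDf c1]) (auto simp del: mem_ball intro: inS)
    then have c2: "continuous_on (ball x0 R \<times> cbox 0 1) (\<lambda>(x, t). fx x t)"
      by (simp add: case_prod_unfold)
    have cf: "continuous_on S f"
      by (rule holomorphic_function_on_imp_continuous_on[OF f])
    have eq: "dir_deriv v f x = integral (cbox 0 1) (\<lambda>t. f (x + \<gamma> t) * k t)" if "x \<in> ball x0 R" for x
      unfolding \<gamma>_def k_def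
      by (rule dir_deriv_Cauchy_integral[OF f r(1) subsetD[OF R(2) r(2)[OF that]] opn])
    have D: "(dir_deriv v f has_derivative blinfun_apply (integral (cbox 0 1) (fx x))) (at x)" if "x \<in> ball x0 R" for x
    proof -
      have "((\<lambda>x. integral (cbox 0 1) (\<lambda>t. f (x + \<gamma> t) * k t)) has_derivative integral (cbox 0 1) (fx x)) (at x within ball x0 R)"
      proof (rule leibniz_rule[where fx=fx, OF _ _ c2 that convex_ball])
        show "((\<lambda>x. f (x + \<gamma> t) * k t) has_derivative blinfun_apply (fx x t)) (at x within ball x0 R)"
          if "x \<in> ball x0 R" for x t by (rule fx[OF that])
        fix x assume "x \<in> ball x0 R"
        then have "continuous_on (cbox 0 1) (\<lambda>t. f (x + \<gamma> t))"
          by (intro continuous_on_compose2[OF cf, of _ "\<lambda>t. x + \<gamma> t"] continuous_on_add continuous_on_const cg image_subsetI inS)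
        then show "(\<lambda>t. f (x + \<gamma> t) * k t) integrable_on cbox 0 1"
          by (intro integrable_continuous continuous_on_mult ck)
      qed
      then have "((\<lambda>x. integral (cbox 0 1) (\<lambda>t. f (x + \<gamma> t) * k t)) has_derivative integral (cbox 0 1) (fx x)) (at x)"
        unfolding at_within_open[OF that open_ball] .
      then show ?thesis
        by (rule has_derivative_transform_within_open[OF _ open_ball that]) (simp add: eq)
    qed
    have "continuous_on (ball x0 R) (\<lambda>x. integral (cbox 0 1) (fx x))"
      by (rule integral_continuous_on_param[OF c2])
    then have "continuous_on (ball x0 R) (\<lambda>x. blinfun_apply (integral (cbox 0 1) (fx x)) w)" for w
      by (intro continuous_intros)
    then have "continuous_on (ball x0 R) (dir_deriv w (dir_deriv v f))" for w
      by (rule continuous_on_cong[THEN iffD1, rotated 2]) (auto simp: dir_deriv_eqI[OF D])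
    then show ?thesis using R(1) differentiableI[OF D] by blast
  qed
  note loc = this
  have "isCont (dir_deriv w (dir_deriv v f)) x" if "x \<in> S" for x v w
    using loc[OF that, of v] continuous_on_eq_continuous_at[OF open_ball] centre_in_ball by blast
  then have "continuous_on S (dir_deriv w (dir_deriv v f))" for v w
    by (simp add: continuous_at_imp_continuous_on)
  moreover have "dir_deriv v f differentiable at x" if "x \<in> S" for x v
    using loc[OF that, of v] that centre_in_ball by blast
  moreover have "f differentiable at x" if "x \<in> S" for x
    by (rule differentiableI[OF holomorphic_function_on_dir_deriv(1)[OF f that]])
  ultimately show ?thesis by (simp add: numeral_2_eq_2)
qed

lemma Ck_on_vec:
  fixes f :: "'a::real_normed_vector \<Rightarrow> complex^'m::finite"
  assumes "open S" "\<And>i. Ck_on k S (\<lambda>x. f x $ i)"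
  shows "Ck_on k S f"
proof -
  have bl: "bounded_bilinear (\<lambda>c v. c *s (v :: complex^'m))" by (rule bounded_bilinear_scalar_mult)
  have "Ck_on k S (\<lambda>x. \<Sum>i\<in>I. (f x $ i) *s axis i 1)" for I
    by (induction I rule: infinite_finite_induct)
      (simp_all add: Ck_on_const Ck_on_add[OF assms(1)] Ck_on_bilinear[OF bl assms(1) assms(2) Ck_on_const])
  from this[of UNIV] show ?thesis
    by (rule Ck_on_cong[OF assms(1)]) (simp add: basis_expansion)
qed

text \<open>Supplies, component by component, the two derivatives of a transition map that enter the
  transformation law of the Christoffel symbols.\<close>

lemma holomorphic_map_on_Ck2:
  assumes "holomorphic_map_on S T" "open S"
  shows "Ck_on 2 S T"
proof (rule Ck_on_vec[OF assms(2)])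
  fix i
  have "holomorphic_function_on S (\<lambda>x. T x $ i)"
    unfolding holomorphic_function_on_def
  proof
    fix x assume "x \<in> S"
    then obtain D where "(T has_derivative D) (at x)" "\<And>c v. D (c *s v) = c *s D v"
      using assms(1) by (auto simp: holomorphic_map_on_def)
    then show "\<exists>D. ((\<lambda>x. T x $ i) has_derivative D) (at x) \<and> (\<forall>c v. D (c *s v) = c * D v)"
      by (intro exI[of _ "\<lambda>v. D v $ i"]) (auto intro: bounded_linear.has_derivative[OF bounded_linear_vec_nth])
  qed
  then show "Ck_on 2 S (\<lambda>x. T x $ i)" using assms(2) by (rule holomorphic_function_on_Ck2)
qed

section \<open>Top powers of diagonal 2-forms\<close>

text \<open>Lets \<open>\<tau>\<close> act on the argument slots of the second factor in
  \<open>wedge 2 (2 * m)\<close>.\<close>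

definition shift_perm :: "(nat \<Rightarrow> nat) \<Rightarrow> nat \<Rightarrow> nat"
  where "shift_perm \<tau> n = (if n < 2 then n else 2 + \<tau> (n - 2))"

lemma permutation_of_permutes: "\<sigma> permutes {..<m::nat} \<Longrightarrow> permutation \<sigma>"
  by (rule permutes_imp_permutation[of "{..<m}"]) auto

text \<open>Induction over transpositions, which shifting turns into transpositions.\<close>

lemma shift_perm_permutes_sign:
  assumes "\<tau> permutes {..<m}"
  shows "shift_perm \<tau> permutes {..<2 + m} \<and> sign (shift_perm \<tau>) = sign \<tau>"
  using assms finite_lessThan
proof (induction rule: permutes_induct)
  case id
  have "shift_perm id = id" by (rule ext) (auto simp: shift_perm_def)
  then show ?case by (simp only: permutes_id sign_id simp_thms)
next
  case (swap a b p)
  have eq: "shift_perm (Transposition.transpose a b \<circ> p) = Transposition.transpose (2 + a) (2 + b) \<circ> shift_perm p"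
    by (rule ext) (simp add: shift_perm_def Transposition.transpose_def)
  have t: "Transposition.transpose (2 + a) (2 + b) permutes {..<2 + m}"
    using swap by (intro permutes_swap_id) auto
  have "sign (shift_perm (Transposition.transpose a b \<circ> p)) = sign (Transposition.transpose (2 + a) (2 + b)) * sign (shift_perm p)"
    unfolding eq using t swap by (intro sign_compose permutation_of_permutes) auto
  also have "\<dots> = sign (Transposition.transpose a b \<circ> p)"
    using swap by (subst sign_compose) (auto intro: permutation_of_permutes simp: sign_swap_id permutation_swap_id)
  finally have "sign (shift_perm (Transposition.transpose a b \<circ> p)) = sign (Transposition.transpose a b \<circ> p)" .
  moreover have "shift_perm (Transposition.transpose a b \<circ> p) permutes {..<2 + m}"
    unfolding eq using t swap by (intro permutes_compose) auto
  ultimately show ?case by blast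
qed

text \<open>For a fixed inner permutation \<open>\<tau>\<close>, \<open>shift_perm \<tau>\<close> is
  absorbed into the outer one by translation in the group. The resulting equal sums,
  \<open>fact (2 * m)\<close> in number, cancel that factor, and each wedge leaves
  \<open>fact 2\<close> in the denominator.\<close>

lemma wedge_pow_eq_sum_permutations:
  "wedge_pow m (\<lambda>w. E (w 0) (w 1)) v =
    (\<Sum>\<sigma> | \<sigma> permutes {..<2 * m}.
      of_int (sign \<sigma>) * (\<Prod>k<m. E (v (\<sigma> (2 * k))) (v (\<sigma> (2 * k + 1))))) / 2 ^ m"
proof (induction m arbitrary: v)
  case 0
  then show ?case by simp
next
  case (Suc m)
  define N where "N = 2 + 2 * m"
  define g where "g \<rho> = of_int (sign \<rho>) * (\<Prod>k<Suc m. E (v (\<rho> (2 * k))) (v (\<rho> (2 * k + 1))))" for \<rho> :: "nat \<Rightarrow> nat"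
  define h where "h \<sigma> \<tau> = of_int (sign \<sigma>) * E (v (\<sigma> 0)) (v (\<sigma> 1)) *
     (of_int (sign \<tau>) * (\<Prod>k<m. E (v (\<sigma> (2 + \<tau> (2 * k)))) (v (\<sigma> (2 + \<tau> (2 * k + 1))))))" for \<sigma> \<tau> :: "nat \<Rightarrow> nat"
  have hg: "h \<sigma> \<tau> = g (\<sigma> \<circ> shift_perm \<tau>)" if "\<sigma> permutes {..<N}" "\<tau> permutes {..<2 * m}" for \<sigma> \<tau>
  proof -
    note s = shift_perm_permutes_sign[OF that(2)]
    have "sign (\<sigma> \<circ> shift_perm \<tau>) = sign \<sigma> * sign \<tau>"
      using s that(1) by (subst sign_compose) (auto intro: permutation_of_permutes simp: N_def)
    moreover have "(\<Prod>k<Suc m. E (v ((\<sigma> \<circ> shift_perm \<tau>) (2 * k))) (v ((\<sigma> \<circ> shift_perm \<tau>) (2 * k + 1)))) =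
      E (v (\<sigma> 0)) (v (\<sigma> 1)) * (\<Prod>k<m. E (v (\<sigma> (2 + \<tau> (2 * k)))) (v (\<sigma> (2 + \<tau> (2 * k + 1)))))"
      unfolding prod.lessThan_Suc_shift by (simp add: shift_perm_def)
    ultimately show ?thesis by (simp add: h_def g_def)
  qed
  have "wedge_pow (Suc m) (\<lambda>w. E (w 0) (w 1)) v =
     (\<Sum>\<sigma> | \<sigma> permutes {..<N}. \<Sum>\<tau> | \<tau> permutes {..<2 * m}. h \<sigma> \<tau>) / 2 ^ m / (2 * fact (2 * m))"
    unfolding wedge_pow.simps wedge_def Suc.IH
    by (simp add: h_def N_def sum_divide_distrib sum_distrib_left)
  also have "(\<Sum>\<sigma> | \<sigma> permutes {..<N}. \<Sum>\<tau> | \<tau> permutes {..<2 * m}. h \<sigma> \<tau>) =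
     (\<Sum>\<tau> | \<tau> permutes {..<2 * m}. \<Sum>\<sigma> | \<sigma> permutes {..<N}. g (\<sigma> \<circ> shift_perm \<tau>))"
    by (subst sum.swap) (intro sum.cong refl, simp add: hg)
  also have "\<dots> = (\<Sum>\<tau> | \<tau> permutes {..<2 * m}. \<Sum>\<sigma> | \<sigma> permutes {..<N}. g \<sigma>)"
  proof (rule sum.cong[OF refl])
    fix \<tau> assume "\<tau> \<in> {\<tau>. \<tau> permutes {..<2 * m}}"
    then have "shift_perm \<tau> permutes {..<N}" using shift_perm_permutes_sign by (auto simp: N_def)
    from sum_permutations_compose_right[OF this, of g]
    show "(\<Sum>\<sigma> | \<sigma> permutes {..<N}. g (\<sigma> \<circ> shift_perm \<tau>)) = (\<Sum>\<sigma> | \<sigma> permutes {..<N}. g \<sigma>)" by simp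
  qed
  also have "\<dots> = fact (2 * m) * (\<Sum>\<sigma> | \<sigma> permutes {..<N}. g \<sigma>)"
    by (simp add: card_permutations[OF refl])
  finally show ?case by (simp add: N_def g_def)
qed

section \<open>Permutations of the pairs {2k, 2k + 1}\<close>

definition partner :: "nat \<Rightarrow> nat"
  where "partner a = (if even a then Suc a else a - 1)"

definition double_perm :: "(nat \<Rightarrow> nat) \<Rightarrow> nat \<Rightarrow> nat"
  where "double_perm \<pi> n = 2 * \<pi> (n div 2) + n mod 2"

definition flip_perm :: "nat set \<Rightarrow> nat \<Rightarrow> nat"
  where "flip_perm S n = (if n div 2 \<in> S then partner n else n)"

text \<open>Exchanging two pairs takes two transpositions of indices, hence is even.\<close>

lemma double_perm_permutes_sign:
  assumes "\<pi> permutes {..<m}"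
  shows "double_perm \<pi> permutes {..<2 * m} \<and> sign (double_perm \<pi>) = 1"
  using assms finite_lessThan
proof (induction rule: permutes_induct)
  case id
  have "double_perm id = id" by (rule ext) (simp add: double_perm_def)
  then show ?case by (simp only: permutes_id sign_id simp_thms)
next
  case (swap a b p)
  have eq: "double_perm (Transposition.transpose a b \<circ> p) =
      Transposition.transpose (2 * a) (2 * b) \<circ> (Transposition.transpose (Suc (2 * a)) (Suc (2 * b)) \<circ> double_perm p)"
  proof
    fix n :: nat
    have e: "Transposition.transpose (Suc (2 * a)) (Suc (2 * b)) (2 * x) = 2 * x"
      "Transposition.transpose (2 * a) (2 * b) (2 * x) = 2 * Transposition.transpose a b x"
      "Transposition.transpose (Suc (2 * a)) (Suc (2 * b)) (Suc (2 * x)) = Suc (2 * Transposition.transpose a b x)"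
      "Transposition.transpose (2 * a) (2 * b) (Suc (2 * x)) = Suc (2 * x)" for x
      unfolding Transposition.transpose_def by (simp_all, presburger+)
    have "n mod 2 = 0 \<or> n mod 2 = 1" by linarith
    then show "double_perm (Transposition.transpose a b \<circ> p) n =
      (Transposition.transpose (2 * a) (2 * b) \<circ> (Transposition.transpose (Suc (2 * a)) (Suc (2 * b)) \<circ> double_perm p)) n"
      by (elim disjE) (simp_all add: double_perm_def e)
  qed
  have t: "Transposition.transpose (2 * a) (2 * b) permutes {..<2 * m}" "Transposition.transpose (Suc (2 * a)) (Suc (2 * b)) permutes {..<2 * m}"
    using swap by (auto intro!: permutes_swap_id)
  have p: "Transposition.transpose (Suc (2 * a)) (Suc (2 * b)) \<circ> double_perm p permutes {..<2 * m}"
    using t swap by (intro permutes_compose) auto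
  have "sign (double_perm (Transposition.transpose a b \<circ> p)) = 
     sign (Transposition.transpose (2 * a) (2 * b)) * (sign (Transposition.transpose (Suc (2 * a)) (Suc (2 * b))) * sign (double_perm p))"
    unfolding eq using t swap p
    by (subst sign_compose, (auto intro: permutation_of_permutes)[2])+ simp
  also have "\<dots> = 1" using swap by (simp add: sign_swap_id)
  finally have "sign (double_perm (Transposition.transpose a b \<circ> p)) = 1" .
  then show ?case using permutes_compose[OF p t(1)] unfolding eq by blast
qed

text \<open>Each flipped pair contributes one transposition.\<close>

lemma flip_perm_permutes_sign:
  assumes "finite S" "S \<subseteq> {..<m}"
  shows "flip_perm S permutes {..<2 * m} \<and> sign (flip_perm S) = (-1) ^ card S"
  using assms
proof (induction rule: finite_induct)
  case empty
  have "flip_perm {} = id" by (rule ext) (simp add: flip_perm_def)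
  then show ?case by (simp only: permutes_id sign_id simp_thms card.empty power_0)
next
  case (insert k S)
  have eq: "flip_perm (insert k S) = Transposition.transpose (2 * k) (Suc (2 * k)) \<circ> flip_perm S"
  proof
    fix n :: nat
    have "n = 2 * k \<or> n = Suc (2 * k) \<or> n div 2 \<noteq> k" by presburger
    then consider "n = 2 * k" | "n = Suc (2 * k)" | "n div 2 \<noteq> k" by blast
    then show "flip_perm (insert k S) n = (Transposition.transpose (2 * k) (Suc (2 * k)) \<circ> flip_perm S) n"
    proof cases
      case 3
      then have "partner n div 2 \<noteq> k" unfolding partner_def by presburger
      then have "flip_perm S n \<noteq> 2 * k" "flip_perm S n \<noteq> Suc (2 * k)"
        using 3 unfolding flip_perm_def by auto
      then show ?thesis using 3 by (simp add: flip_perm_def)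
    qed (use insert in \<open>simp_all add: flip_perm_def partner_def\<close>)
  qed
  have t: "Transposition.transpose (2 * k) (Suc (2 * k)) permutes {..<2 * m}"
    using insert by (intro permutes_swap_id) auto
  have "sign (flip_perm (insert k S)) = - sign (flip_perm S)"
    unfolding eq using t insert
    by (subst sign_compose) (auto intro: permutation_of_permutes simp: sign_swap_id)
  then have "sign (flip_perm (insert k S)) = (- 1) ^ card (insert k S)" using insert by simp
  moreover have "flip_perm (insert k S) permutes {..<2 * m}"
    unfolding eq using insert t by (intro permutes_compose) auto
  ultimately show ?case by blast
qed

text \<open>The permutations that map pairs to pairs: the hyperoctahedral group, whose elements are
  a flip of some pairs followed by a permutation of the pairs.\<close>

definition pair_perms :: "nat \<Rightarrow> (nat \<Rightarrow> nat) set"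
  where "pair_perms m = {\<sigma>. \<sigma> permutes {..<2 * m} \<and> (\<forall>k<m. \<sigma> (2 * k + 1) = partner (\<sigma> (2 * k)))}"

text \<open>The sign of \<open>\<sigma>\<close> is -1 to the number of flipped pairs, and
  antisymmetry puts as many minus signs into the product; the two cancel.\<close>

lemma pair_perm_sum_term:
  fixes \<mu> :: "nat \<Rightarrow> complex"
  assumes \<sigma>: "\<sigma> \<in> pair_perms m"
  shows "of_int (sign \<sigma>) * (\<Prod>k<m. (if even (\<sigma> (2 * k)) then \<mu> (\<sigma> (2 * k) div 2) else - \<mu> (\<sigma> (2 * k) div 2))) = (\<Prod>k<m. \<mu> k)"
proof -
  have perm: "\<sigma> permutes {..<2 * m}" and good: "\<And>k. k < m \<Longrightarrow> \<sigma> (2 * k + 1) = partner (\<sigma> (2 * k))"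
    using \<sigma> by (auto simp: pair_perms_def)
  \<comment> \<open>The induced permutation of the pairs; \<open>S\<close> below collects the pairs
    that arrive flipped, so that
    \<open>\<sigma> = double_perm \<pi> \<circ> flip_perm S\<close>.\<close>
  define \<pi> where "\<pi> k = (if k < m then \<sigma> (2 * k) div 2 else k)" for k
  define S where "S = {k. k < m \<and> odd (\<sigma> (2 * k))}"
  have finS: "finite S" "S \<subseteq> {..<m}" by (auto simp: S_def)
  have lt: "\<sigma> n < 2 * m" if "n < 2 * m" for n :: nat using permutes_in_image[OF perm, of n] that by simp
  have inj: "inj \<sigma>" using perm by (rule permutes_inj)
  have \<pi>perm: "\<pi> permutes {..<m}"
  proof (rule bij_imp_permutes)
    have "\<sigma> (2 * k) div 2 < m" if "k < m" for k using lt[of "2 * k"] that by linarith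
    then have img: "\<pi> ` {..<m} \<subseteq> {..<m}" by (auto simp: \<pi>_def)
    have "inj_on \<pi> {..<m}"
    proof (rule inj_onI)
      fix k l assume kl: "k \<in> {..<m}" "l \<in> {..<m}" "\<pi> k = \<pi> l"
      then have "\<sigma> (2 * k) div 2 = \<sigma> (2 * l) div 2" by (simp add: \<pi>_def)
      then have "\<sigma> (2 * k) = \<sigma> (2 * l) \<or> \<sigma> (2 * k) = partner (\<sigma> (2 * l))"
        unfolding partner_def by presburger
      then have "\<sigma> (2 * k) = \<sigma> (2 * l) \<or> \<sigma> (2 * k) = \<sigma> (2 * l + 1)"
        using good[of l] kl by auto
      then have "2 * k = 2 * l \<or> 2 * k = 2 * l + 1" using injD[OF inj] by blast
      then show "k = l" by presburger
    qed
    then show "bij_betw \<pi> {..<m} {..<m}"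
      using endo_inj_surj[OF _ img] by (simp add: bij_betw_def)
  qed (simp add: \<pi>_def)
  have dec: "\<sigma> = double_perm \<pi> \<circ> flip_perm S"
  proof
    fix n :: nat
    define k where "k = n div 2"
    show "\<sigma> n = (double_perm \<pi> \<circ> flip_perm S) n"
    proof (cases "n < 2 * m")
      case True
      then have k: "k < m" by (simp add: k_def)
      have "n = 2 * k \<or> n = 2 * k + 1" unfolding k_def by presburger
      then consider "n = 2 * k" | "n = 2 * k + 1" by blast
      then show ?thesis
      proof cases
        case 1
        then show ?thesis using k
          by (cases "odd (\<sigma> (2 * k))") (auto simp: S_def flip_perm_def partner_def double_perm_def \<pi>_def)
      next
        case 2
        then show ?thesis using k good[OF k]
          by (cases "odd (\<sigma> (2 * k))") (auto simp: S_def flip_perm_def partner_def double_perm_def \<pi>_def)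
      qed
    next
      case False
      then have "\<sigma> n = n" using permutes_not_in[OF perm] by simp
      with False show ?thesis by (simp add: S_def flip_perm_def double_perm_def \<pi>_def)
    qed
  qed
  have "sign \<sigma> = sign (double_perm \<pi>) * sign (flip_perm S)"
    unfolding dec by (rule sign_compose)
      (use double_perm_permutes_sign[OF \<pi>perm] flip_perm_permutes_sign[OF finS] in \<open>auto intro: permutation_of_permutes\<close>)
  then have s: "sign \<sigma> = (-1) ^ card S"
    using double_perm_permutes_sign[OF \<pi>perm] flip_perm_permutes_sign[OF finS] by simp
  have "(\<Prod>k<m. (if even (\<sigma> (2 * k)) then \<mu> (\<sigma> (2 * k) div 2) else - \<mu> (\<sigma> (2 * k) div 2)))
      = (\<Prod>k<m. (if k \<in> S then -1 else 1) * \<mu> (\<pi> k))"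
    by (rule prod.cong) (auto simp: S_def \<pi>_def)
  also have "\<dots> = (\<Prod>k<m. (if k \<in> S then -1 else 1)) * (\<Prod>k<m. \<mu> (\<pi> k))"
    by (rule prod.distrib)
  also have "(\<Prod>k<m. \<mu> (\<pi> k)) = (\<Prod>k<m. \<mu> k)"
    using prod.permute[OF \<pi>perm, of \<mu>] by (simp add: o_def)
  also have "(\<Prod>k<m. (if k \<in> S then -1 else 1)) = (-1 :: complex) ^ card S"
    using finS by (simp add: prod.If_cases Int_absorb1)
  finally show ?thesis
    unfolding s by (simp add: mult.assoc[symmetric] power_mult_distrib[symmetric])
qed

text \<open>A permutation outside \<open>pair_perms\<close> meets a vanishing entry, and all others
  contribute the same product. The constant is m!; it can stay a cardinality because it cancels when
  two forms are compared.\<close>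

lemma wedge_pow_diagonal:
  fixes E :: "complex^'n::finite \<Rightarrow> complex^'n \<Rightarrow> complex"
  assumes E: "\<And>a b. a < 2 * m \<Longrightarrow> b < 2 * m \<Longrightarrow> E (v a) (v b) =
    (if b = partner a then (if even a then \<mu> (a div 2) else - \<mu> (a div 2)) else 0)"
  shows "wedge_pow m (\<lambda>w. E (w 0) (w 1)) v = of_nat (card (pair_perms m)) / 2 ^ m * (\<Prod>k<m. \<mu> k)"
proof -
  define t where "t \<sigma> = of_int (sign \<sigma>) * (\<Prod>k<m. E (v (\<sigma> (2 * k))) (v (\<sigma> (2 * k + 1))))" for \<sigma> :: "nat \<Rightarrow> nat"
  have lt: "\<sigma> n < 2 * m" if "n < 2 * m" "\<sigma> permutes {..<2 * m}" for n \<sigma>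
    using permutes_in_image[OF that(2), of n] that by simp
  have "(\<Sum>\<sigma> | \<sigma> permutes {..<2 * m}. t \<sigma>) = (\<Sum>\<sigma>\<in>pair_perms m. t \<sigma>)"
  proof (rule sum.mono_neutral_right)
    show "finite {\<sigma>. \<sigma> permutes {..<2 * m}}" by (rule finite_permutations) simp
    show "pair_perms m \<subseteq> {\<sigma>. \<sigma> permutes {..<2 * m}}" by (auto simp: pair_perms_def)
    show "\<forall>\<sigma>\<in>{\<sigma>. \<sigma> permutes {..<2 * m}} - pair_perms m. t \<sigma> = 0"
    proof
      fix \<sigma> assume a: "\<sigma> \<in> {\<sigma>. \<sigma> permutes {..<2 * m}} - pair_perms m"
      then obtain k where k: "k < m" "\<sigma> (2 * k + 1) \<noteq> partner (\<sigma> (2 * k))" by (auto simp: pair_perms_def)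
      have "E (v (\<sigma> (2 * k))) (v (\<sigma> (2 * k + 1))) = 0"
        using a k lt[of "2 * k" \<sigma>] lt[of "2 * k + 1" \<sigma>] by (simp add: E)
      with k(1) show "t \<sigma> = 0" unfolding t_def by auto
    qed
  qed
  also have "\<dots> = (\<Sum>\<sigma>\<in>pair_perms m. \<Prod>k<m. \<mu> k)"
  proof (rule sum.cong[OF refl])
    fix \<sigma> assume \<sigma>: "\<sigma> \<in> pair_perms m"
    have "t \<sigma> = of_int (sign \<sigma>) * (\<Prod>k<m. (if even (\<sigma> (2 * k)) then \<mu> (\<sigma> (2 * k) div 2) else - \<mu> (\<sigma> (2 * k) div 2)))"
      unfolding t_def
    proof (intro arg_cong2[where f="(*)"] refl prod.cong)
      fix k assume "k \<in> {..<m}"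
      then show "E (v (\<sigma> (2 * k))) (v (\<sigma> (2 * k + 1))) =
        (if even (\<sigma> (2 * k)) then \<mu> (\<sigma> (2 * k) div 2) else - \<mu> (\<sigma> (2 * k) div 2))"
        using \<sigma> lt[of "2 * k" \<sigma>] lt[of "2 * k + 1" \<sigma>] by (simp add: E pair_perms_def)
    qed
    then show "t \<sigma> = (\<Prod>k<m. \<mu> k)" using pair_perm_sum_term[OF \<sigma>] by simp
  qed
  finally show ?thesis unfolding wedge_pow_eq_sum_permutations t_def by simp
qed

lemma card_pair_perms_pos: "card (pair_perms m) > 0"
proof -
  have "id \<in> pair_perms m" by (simp add: pair_perms_def partner_def permutes_id)
  moreover have "finite (pair_perms m)"
    by (rule finite_subset[of _ "{\<sigma>. \<sigma> permutes {..<2 * m}}"]) (auto simp: pair_perms_def intro: finite_permutations)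
  ultimately show ?thesis by (auto simp: card_gt_0_iff)
qed

section \<open>Hermitian forms\<close>

definition hermitian :: "complex^'n^'n::finite \<Rightarrow> bool"
  where "hermitian h \<longleftrightarrow> (\<forall>i j. h $ j $ i = cnj (h $ i $ j))"

lemma pos_def_hermitian_imp_hermitian: "pos_def_hermitian h \<Longrightarrow> hermitian h"
  unfolding pos_def_hermitian_def hermitian_def by blast

lemma sesq_simps:
  "sesq h (v + w) u = sesq h v u + sesq h w u"
  "sesq h v (w + u) = sesq h v w + sesq h v u"
  "sesq h (v - w) u = sesq h v u - sesq h w u"
  "sesq h v (w - u) = sesq h v w - sesq h v u"
  "sesq h (c *s v) w = c * sesq h v w"
  "sesq h v (c *s w) = cnj c * sesq h v w"
  "sesq h (r *\<^sub>R v) w = r *\<^sub>R sesq h v w"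
  "sesq h v (r *\<^sub>R w) = r *\<^sub>R sesq h v w"
  "sesq h 0 w = 0" "sesq h v 0 = 0"
  by (simp_all add: sesq_def sum.distrib sum_subtractf sum_distrib_left scaleR_sum_right algebra_simps)

lemma sesq_add_matrix: "sesq (h + k) v w = sesq h v w + sesq k v w"
  by (simp add: sesq_def sum.distrib algebra_simps)

lemma sesq_scaleR_matrix: "sesq (r *\<^sub>R k) v w = r *\<^sub>R sesq k v w"
  by (simp add: sesq_def scaleR_sum_right)

lemma sesq_sum_left: "sesq h (\<Sum>i\<in>I. f i) w = (\<Sum>i\<in>I. sesq h (f i) w)"
  by (induction I rule: infinite_finite_induct) (simp_all add: sesq_simps)

lemma sesq_sum_right: "sesq h v (\<Sum>i\<in>I. f i) = (\<Sum>i\<in>I. sesq h v (f i))"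
  by (induction I rule: infinite_finite_induct) (simp_all add: sesq_simps)

lemma sesq_commute:
  assumes "hermitian h"
  shows "sesq h w v = cnj (sesq h v w)"
proof -
  have H: "cnj (h $ i $ j) = h $ j $ i" for i j using assms unfolding hermitian_def by metis
  show ?thesis unfolding sesq_def
    by (subst sum.swap) (simp add: H mult.commute mult.left_commute)
qed

lemma sesq_diag_real: "hermitian h \<Longrightarrow> sesq h v v = of_real (Re (sesq h v v))"
  using sesq_commute[of h v v] by (simp add: complex_eq_iff)

lemma continuous_on_sesq [continuous_intros]:
  "continuous_on S h \<Longrightarrow> continuous_on S f \<Longrightarrow> continuous_on S g \<Longrightarrow>
    continuous_on S (\<lambda>x. sesq (h x) (f x) (g x))"
  unfolding sesq_def by (intro continuous_intros)

text \<open>Divide by \<open>t\<close> and let it tend to 0. This is the first-order condition at a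
  maximum of a quadratic form; the chosen \<open>t\<close> keeps the second-order term below half of
  \<open>a\<close>.\<close>

lemma quadratic_bound_zero:
  fixes a b :: real
  assumes "\<And>t. t > 0 \<Longrightarrow> t * a + t * t * b \<le> 0"
  shows "a \<le> 0"
proof (rule ccontr)
  assume "\<not> a \<le> 0"
  define t where "t = a / (2 * (\<bar>b\<bar> + 1))"
  have t: "t > 0" using \<open>\<not> a \<le> 0\<close> by (simp add: t_def add_nonneg_pos)
  have "t * (a + t * b) \<le> 0" using assms[OF t] by (simp add: algebra_simps)
  then have "a + t * b \<le> 0" using t by (simp add: mult_le_0_iff)
  moreover have "t * (\<bar>b\<bar> + 1) = a / 2" by (simp add: t_def field_simps add_nonneg_pos)
  moreover have "t * b \<ge> - (t * (\<bar>b\<bar> + 1))"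
  proof -
    have "0 \<le> t * (b + (\<bar>b\<bar> + 1))" using t by (intro mult_nonneg_nonneg) auto
    then show ?thesis by (simp add: algebra_simps)
  qed
  ultimately show False using \<open>\<not> a \<le> 0\<close> by linarith
qed

text \<open>The conditions are the rows of a square matrix in which every row outside
  \<open>S\<close> is zero, so the matrix is singular and has a kernel.\<close>

lemma exists_common_orthogonal:
  fixes f :: "'n::finite \<Rightarrow> complex^'n"
  assumes "S \<noteq> UNIV"
  obtains w where "w \<noteq> 0" "\<And>i. i \<in> S \<Longrightarrow> sesq h w (f i) = 0"
proof -
  obtain i0 where i0: "i0 \<notin> S" using assms by auto
  define A :: "complex^'n^'n" where
    "A = (\<chi> i j. if i \<in> S then (\<Sum>k\<in>UNIV. h $ j $ k * cnj (f i $ k)) else 0)"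
  have A: "(A *v w) $ i = (if i \<in> S then sesq h w (f i) else 0)" for w i
    by (simp add: A_def matrix_vector_mult_def sesq_def sum_distrib_left sum_distrib_right mult_ac)
  have "\<not> (\<exists>B. B ** A = mat 1)"
  proof
    assume "\<exists>B. B ** A = mat 1"
    then obtain B where "A ** B = mat 1" using matrix_left_right_inverse by metis
    then have "A *v (B *v axis i0 1) = axis i0 1" by (simp add: matrix_vector_mul_assoc)
    then have "(axis i0 1 :: complex^'n) $ i0 = 0" using A[of "B *v axis i0 1" i0] i0 by simp
    then show False by simp
  qed
  then obtain w where w: "A *v w = 0" "w \<noteq> 0" using matrix_left_invertible_ker by blast
  have "sesq h w (f i) = 0" if "i \<in> S" for i using A[of w i] w(1) that by simp
  with w(2) that show ?thesis by blast
qed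

text \<open>The spectral theorem for \<open>h\<close> relative to \<open>k\<close>, one eigenvector
  at a time: the next one maximises the Rayleigh quotient on the \<open>k\<close>-orthogonal
  complement of those found so far. The eigenvector equation is demanded against every
  \<open>v\<close>, so that earlier eigenvectors are \<open>h\<close>-orthogonal to the complement
  as well.\<close>

lemma exists_generalized_eigenbasis_on:
  fixes h k :: "complex^'n^'n::finite" and S :: "'n set"
  assumes h: "hermitian h" and k: "pos_def_hermitian k"
  shows "\<exists>e \<mu>. \<forall>i\<in>S. (\<forall>j\<in>S. sesq k (e i) (e j) = (if i = j then 1 else 0)) \<and>
    (\<forall>v. sesq h v (e i) = of_real (\<mu> i :: real) * sesq k v (e i))"
  using finite[of S]
proof (induction S rule: finite_induct)
  case empty
  then show ?case by simp
next
  case (insert p S)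
  have hk: "hermitian k" using k by (rule pos_def_hermitian_imp_hermitian)
  have kpos: "Re (sesq k v v) > 0" if "v \<noteq> 0" for v using k that by (simp add: pos_def_hermitian_def)
  obtain e :: "'n \<Rightarrow> complex^'n" and l :: "'n \<Rightarrow> real" where
    e: "\<And>i j. i \<in> S \<Longrightarrow> j \<in> S \<Longrightarrow> sesq k (e i) (e j) = (if i = j then 1 else 0)"
    and eig: "\<And>i v. i \<in> S \<Longrightarrow> sesq h v (e i) = of_real (l i) * sesq k v (e i)"
    using insert.IH by blast
  define W where "W = {w. \<forall>i\<in>S. sesq k w (e i) = 0}"
  have Wlin: "v + c *s w \<in> W" if "v \<in> W" "w \<in> W" for v w c
    using that by (simp add: W_def sesq_simps)
  have Wscale: "r *\<^sub>R v \<in> W" if "v \<in> W" for v r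
    using that by (simp add: W_def sesq_simps)
  define q where "q w = Re (sesq h w w) / Re (sesq k w w)" for w
  have "W = (\<Inter>i\<in>S. {w. sesq k w (e i) = 0})" by (auto simp: W_def)
  then have "closed W"
    by (auto intro!: closed_INT closed_Collect_eq continuous_intros)
  then have "compact (W \<inter> sphere 0 1)" by (intro closed_Int_compact compact_sphere)
  moreover have "W \<inter> sphere 0 1 \<noteq> {}"
  proof -
    have "S \<noteq> UNIV" using insert by auto
    then obtain w where w: "w \<noteq> 0" "\<And>i. i \<in> S \<Longrightarrow> sesq k w (e i) = 0"
      using exists_common_orthogonal by metis
    then have "(1 / norm w) *\<^sub>R w \<in> W" by (intro Wscale) (simp add: W_def)
    moreover have "norm ((1 / norm w) *\<^sub>R w) = 1" using w by simp
    ultimately show ?thesis by (auto simp del: norm_scaleR)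
  qed
  moreover have "continuous_on (W \<inter> sphere 0 1) q"
    unfolding q_def
  proof (intro continuous_intros ballI)
    fix x :: "complex^'n" assume "x \<in> W \<inter> sphere 0 1"
    then have "x \<noteq> 0" by auto
    then show "Re (sesq k x x) \<noteq> 0" using kpos[of x] by simp
  qed
  ultimately obtain w0 where "w0 \<in> W \<inter> sphere 0 1" "\<forall>w\<in>W \<inter> sphere 0 1. q w \<le> q w0"
    using continuous_attains_sup[of "W \<inter> sphere 0 1" q] by blast
  then have w0: "w0 \<in> W" "norm w0 = 1" and max: "\<And>w. w \<in> W \<Longrightarrow> norm w = 1 \<Longrightarrow> q w \<le> q w0"
    by simp_all
  define m where "m = q w0"
  \<comment> \<open>\<open>K\<close> is nonpositive on \<open>W\<close> and vanishes at the
    maximiser \<open>w0\<close>; it remains to see that \<open>w0\<close> lies in its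
    kernel.\<close>
  define K where "K v w = sesq h v w - of_real m * sesq k v w" for v w
  have K_le: "Re (K w w) \<le> 0" if "w \<in> W" for w
  proof (cases "w = 0")
    case False
    have "q ((1 / norm w) *\<^sub>R w) \<le> m"
      unfolding m_def using False by (intro max Wscale that) simp
    moreover have "q ((1 / norm w) *\<^sub>R w) = q w" using False by (simp add: q_def sesq_simps)
    ultimately have "q w \<le> m" by simp
    then show ?thesis using kpos[OF False] by (simp add: K_def q_def pos_divide_le_eq)
  next
    case True
    then show ?thesis by (simp add: K_def sesq_simps(9))
  qed
  have w0nz: "w0 \<noteq> 0" using w0(2) by auto
  have K0: "K w0 w0 = 0"
    using kpos[OF w0nz] sesq_diag_real[OF h, of w0] sesq_diag_real[OF hk, of w0]
    by (simp add: K_def m_def q_def complex_eq_iff)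
  have Kherm: "K v w = cnj (K w v)" for v w
    using sesq_commute[OF h, of v w] sesq_commute[OF hk, of v w] by (simp add: K_def)
  have Klin: "K (v + c *s w) u = K v u + c * K w u" "K u (v + c *s w) = K u v + cnj c * K u w" for u v w c
    by (simp_all add: K_def sesq_simps algebra_simps)
  have KW: "K w w0 = 0" if w: "w \<in> W" for w
  proof -
    \<comment> \<open>With this factor, moving from \<open>w0\<close> along \<open>w\<close> has
      first-order term twice the square of \<open>cmod (K w w0)\<close>, and nonpositivity of
      \<open>K\<close> forces it to vanish.\<close>
    define z where "z = cnj (K w w0)"
    have "t * (2 * (cmod z)\<^sup>2) + t * t * ((cmod z)\<^sup>2 * Re (K w w)) \<le> 0" if "t > 0" for t
    proof -
      have "Re (K (w0 + (of_real t * z) *s w) (w0 + (of_real t * z) *s w)) \<le> 0"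
        by (intro K_le Wlin w0 w)
      also have "K (w0 + (of_real t * z) *s w) (w0 + (of_real t * z) *s w) =
         of_real (2 * t) * (z * cnj z) + of_real (t * t) * (z * cnj z) * K w w"
        unfolding Klin K0 using Kherm[of w0 w] by (simp add: z_def algebra_simps)
      also have "\<dots> = of_real (t * (2 * (cmod z)\<^sup>2)) + of_real (t * t * (cmod z)\<^sup>2) * K w w"
        by (simp add: complex_norm_square[symmetric] algebra_simps)
      finally show ?thesis by (simp add: algebra_simps)
    qed
    from quadratic_bound_zero[OF this] have "z = 0" by simp
    then show ?thesis by (simp add: z_def)
  qed
  have KS: "K (e i) w0 = 0" if "i \<in> S" for i
  proof -
    have "K w0 (e i) = 0" using eig[OF that, of w0] w0(1) that by (simp add: K_def W_def)
    then show ?thesis using Kherm[of "e i" w0] by simp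
  qed
  have Kall: "K v w0 = 0" for v
  proof -
    \<comment> \<open>Removing the \<open>k\<close>-projection onto the earlier eigenvectors leaves
      a vector of \<open>W\<close>, so \<open>KW\<close> and \<open>KS\<close> together cover all
      \<open>v\<close>.\<close>
    define u where "u = v - (\<Sum>i\<in>S. sesq k v (e i) *s e i)"
    have "u \<in> W"
    proof -
      have "sesq k u (e j) = 0" if "j \<in> S" for j
      proof -
        have "(\<Sum>i\<in>S. sesq k v (e i) * sesq k (e i) (e j)) = (\<Sum>i\<in>S. if i = j then sesq k v (e j) else 0)"
          using e that by (intro sum.cong) auto
        then show ?thesis using that insert by (simp add: u_def sesq_simps sesq_sum_left)
      qed
      then show ?thesis by (simp add: W_def)
    qed
    then have "K u w0 = 0" by (rule KW)
    moreover have "K v w0 = K u w0 + (\<Sum>i\<in>S. sesq k v (e i) * K (e i) w0)"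
      by (simp add: K_def u_def sesq_simps sesq_sum_left sum_distrib_left right_diff_distrib sum_subtractf algebra_simps)
    ultimately show ?thesis using KS by simp
  qed
  define r where "r = Re (sesq k w0 w0)"
  have r: "r > 0" using kpos[OF w0nz] by (simp add: r_def)
  define e0 where "e0 = (1 / sqrt r) *\<^sub>R w0"
  have e0n: "sesq k e0 e0 = 1"
  proof -
    have "sesq k e0 e0 = (1 / sqrt r * (1 / sqrt r)) *\<^sub>R of_real r"
      using sesq_diag_real[OF hk, of w0] unfolding e0_def sesq_simps r_def by simp
    also have "\<dots> = of_real (1 / sqrt r * (1 / sqrt r) * r)" by (simp only: scaleR_conv_of_real of_real_mult)
    also have "1 / sqrt r * (1 / sqrt r) * r = 1" using r by simp
    finally show ?thesis by simp
  qed
  have e0S: "sesq k e0 (e i) = 0" "sesq k (e i) e0 = 0" if "i \<in> S" for i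
  proof -
    have "sesq k w0 (e i) = 0" using w0(1) that by (simp add: W_def)
    then show "sesq k e0 (e i) = 0" unfolding e0_def sesq_simps by simp
    then show "sesq k (e i) e0 = 0" using sesq_commute[OF hk, of e0 "e i"] by simp
  qed
  have e0eig: "sesq h v e0 = of_real m * sesq k v e0" for v
    using Kall[of v] unfolding K_def e0_def sesq_simps by simp
  show ?case
  proof (rule exI[of _ "e(p := e0)"], rule exI[of _ "l(p := m)"], intro ballI conjI allI)
    have ne: "i \<noteq> p" if "i \<in> S" for i using insert.hyps that by auto
    fix i assume i: "i \<in> insert p S"
    show "sesq k ((e(p := e0)) i) ((e(p := e0)) j) = (if i = j then 1 else 0)" if j: "j \<in> insert p S" for j
      using i j ne[of i] ne[of j] by (cases "i = p"; cases "j = p") (simp_all add: e e0n e0S)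
    show "sesq h v ((e(p := e0)) i) = of_real ((l(p := m)) i) * sesq k v ((e(p := e0)) i)" for v
      using i ne[of i] by (cases "i = p") (simp_all add: eig e0eig)
  qed
qed

lemma exists_generalized_eigenbasis:
  fixes h k :: "complex^'n^'n::finite"
  assumes "hermitian h" "pos_def_hermitian k"
  obtains e :: "'n \<Rightarrow> complex^'n" and \<mu> :: "'n \<Rightarrow> real" where
    "\<And>i j. sesq k (e i) (e j) = (if i = j then 1 else 0)"
    "\<And>i j. sesq h (e i) (e j) = (if i = j then of_real (\<mu> i) else 0)"
proof -
  obtain e :: "'n \<Rightarrow> complex^'n" and \<mu> :: "'n \<Rightarrow> real" where
    e: "\<And>i j. sesq k (e i) (e j) = (if i = j then 1 else 0)"
    and eig: "\<And>i v. sesq h v (e i) = of_real (\<mu> i) * sesq k v (e i)"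
    using exists_generalized_eigenbasis_on[OF assms, of UNIV] by blast
  show ?thesis by (rule that[of e \<mu>]) (auto simp: e eig)
qed

section \<open>Top powers of associated forms\<close>

lemma wedge_dz_dzbar: "wedge 1 1 (dz i) (dzbar j) v = v 0 $ i * cnj (v 1 $ j) - v 1 $ i * cnj (v 0 $ j)"
proof -
  have "{\<sigma>. \<sigma> permutes {..<1 + 1::nat}} = {id, Transposition.transpose 0 1}"
  proof -
    have "{..<1 + 1::nat} = {0, 1}" by auto
    then show ?thesis by (auto simp: permutes_doubleton_iff)
  qed
  moreover have "(id :: nat \<Rightarrow> nat) \<noteq> Transposition.transpose 0 1"
  proof
    assume "(id :: nat \<Rightarrow> nat) = Transposition.transpose 0 1"
    then have "id (0 :: nat) = Transposition.transpose 0 1 0" by (rule fun_cong)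
    then show False by simp
  qed
  ultimately show ?thesis unfolding wedge_def
    by (simp add: dz_def dzbar_def sign_swap_id algebra_simps)
qed

text \<open>For Hermitian \<open>h\<close> the value is \<open>\<i> * (z - cnj z)\<close> with
  \<open>z = sesq h (v 0) (v 1)\<close>. This is the two-argument shape to which
  \<open>wedge_pow_diagonal\<close> applies.\<close>

lemma assoc_form_eq:
  fixes h :: "complex^'n^'n::finite"
  assumes "hermitian h"
  shows "assoc_form h = (\<lambda>v. of_real (- 2 * Im (sesq h (v 0) (v 1))))"
proof
  fix v :: "nat \<Rightarrow> complex^'n"
  have "assoc_form h v = \<i> * (sesq h (v 0) (v 1) - sesq h (v 1) (v 0))"
    unfolding assoc_form_def wedge_dz_dzbar sesq_def
    by (simp add: sum_subtractf[symmetric] algebra_simps)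
  then show "assoc_form h v = of_real (- 2 * Im (sesq h (v 0) (v 1)))"
    using sesq_commute[OF assms, of "v 1" "v 0"] by (simp add: complex_eq_iff)
qed

text \<open>On this tuple the form pairs \<open>e l\<close> with \<open>\<i> *s e l\<close> to
  \<open>2 * \<mu> l\<close>, and vectors from different pairs to 0, because \<open>sesq h\<close>
  is diagonal in \<open>e\<close> with real entries.\<close>

lemma wedge_pow_assoc_form_diagonal:
  fixes h :: "complex^'n^'n::finite"
  assumes h: "hermitian h" and b: "bij_betw b {..<CARD('n)} (UNIV :: 'n set)"
    and e: "\<And>i j. sesq h (e i) (e j) = (if i = j then of_real (\<mu> i) else 0)"
  shows "wedge_pow CARD('n) (assoc_form h) (\<lambda>a. if even a then e (b (a div 2)) else \<i> *s e (b (a div 2))) =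
    of_nat (card (pair_perms CARD('n))) / 2 ^ CARD('n) * of_real (\<Prod>i\<in>UNIV. 2 * \<mu> i)"
proof -
  define v where "v a = (if even a then e (b (a div 2)) else \<i> *s e (b (a div 2)))" for a
  define E where "E x y = complex_of_real (- 2 * Im (sesq h x y))" for x y
  have "wedge_pow CARD('n) (\<lambda>w. E (w 0) (w 1)) v =
    of_nat (card (pair_perms CARD('n))) / 2 ^ CARD('n) * (\<Prod>k<CARD('n). of_real (2 * \<mu> (b k)))"
  proof (rule wedge_pow_diagonal)
    fix p q assume pq: "p < 2 * CARD('n)" "q < 2 * CARD('n)"
    then have "p div 2 < CARD('n)" "q div 2 < CARD('n)" by auto
    then have beq: "b (p div 2) = b (q div 2) \<longleftrightarrow> p div 2 = q div 2"
      using b by (auto simp: bij_betw_def inj_on_def)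
    have par: "q = partner p \<longleftrightarrow> p div 2 = q div 2 \<and> (even p \<longleftrightarrow> odd q)"
      unfolding partner_def by (cases "even p") (auto; presburger)+
    show "E (v p) (v q) = (if q = partner p then (if even p then of_real (2 * \<mu> (b (p div 2))) else - of_real (2 * \<mu> (b (p div 2)))) else 0)"
      unfolding par E_def v_def by (auto simp: sesq_simps e beq)
  qed
  moreover have "(\<Prod>k<CARD('n). complex_of_real (2 * \<mu> (b k))) = of_real (\<Prod>i\<in>UNIV. 2 * \<mu> i)"
    using prod.reindex_bij_betw[OF b, of "\<lambda>i. complex_of_real (2 * \<mu> i)"] by simp
  ultimately show ?thesis unfolding assoc_form_eq[OF h] E_def v_def by simp
qed

text \<open>AM-GM for the eigenvalues of \<open>h\<close> relative to \<open>k\<close>: equality of the top powers says that their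
  product is 1.\<close>

lemma equal_top_power_imp_trace_ge:
  fixes h k :: "complex^'n^'n::finite"
  assumes h: "pos_def_hermitian h" and k: "pos_def_hermitian k"
    and eq: "\<And>v. wedge_pow CARD('n) (assoc_form h) v = wedge_pow CARD('n) (assoc_form k) v"
  obtains e :: "'n \<Rightarrow> complex^'n" where
    "\<And>i j. sesq k (e i) (e j) = (if i = j then 1 else 0)"
    "(\<Sum>i\<in>UNIV. Re (sesq h (e i) (e i)) - Re (sesq k (e i) (e i))) \<ge> 0"
proof -
  have hh: "hermitian h" "hermitian k" using h k by (auto intro: pos_def_hermitian_imp_hermitian)
  obtain e :: "'n \<Rightarrow> complex^'n" and l :: "'n \<Rightarrow> real" where
    e: "\<And>i j. sesq k (e i) (e j) = (if i = j then 1 else 0)"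
    and el: "\<And>i j. sesq h (e i) (e j) = (if i = j then of_real (l i) else 0)"
    using exists_generalized_eigenbasis[OF hh(1) k] by metis
  obtain b where b: "bij_betw b {..<CARD('n)} (UNIV :: 'n set)"
    using ex_bij_betw_nat_finite[of "UNIV :: 'n set"] by (auto simp: atLeast0LessThan)
  \<comment> \<open>Relative to itself \<open>k\<close> has all eigenvalues 1, so both powers can be
    evaluated on the same tuple.\<close>
  have e': "sesq k (e i) (e j) = (if i = j then of_real 1 else 0)" for i j by (simp add: e)
  have c: "complex_of_nat (card (pair_perms CARD('n))) / 2 ^ CARD('n) \<noteq> 0"
    using card_pair_perms_pos[of "CARD('n)"] by simp
  have "complex_of_nat (card (pair_perms CARD('n))) / 2 ^ CARD('n) * of_real (\<Prod>i\<in>UNIV. 2 * l i) =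
     complex_of_nat (card (pair_perms CARD('n))) / 2 ^ CARD('n) * of_real (\<Prod>i\<in>(UNIV :: 'n set). 2 * 1)"
    unfolding wedge_pow_assoc_form_diagonal[OF hh(1) b, of e l, OF el, symmetric]
      wedge_pow_assoc_form_diagonal[OF hh(2) b, of e "\<lambda>_. 1", OF e', symmetric] by (rule eq)
  then have "complex_of_real (\<Prod>i\<in>UNIV. 2 * l i) = of_real (\<Prod>i\<in>(UNIV :: 'n set). 2 * 1)"
    using c mult_left_cancel by blast
  then have "(\<Prod>i\<in>UNIV. 2 * l i) = (\<Prod>i\<in>(UNIV :: 'n set). 2 * 1)" by (simp only: of_real_eq_iff)
  then have prod: "(\<Prod>i\<in>UNIV. l i) = 1" unfolding prod.distrib by simp
  have "e i \<noteq> 0" for i using e[of i i] by (auto simp: sesq_simps)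
  then have "Re (sesq h (e i) (e i)) > 0" for i using h unfolding pos_def_hermitian_def by blast
  then have pos: "l i > 0" for i using el[of i i] by (metis Re_complex_of_real)
  \<comment> \<open>AM-GM in the form ln l \<le> l - 1, summed over the eigenvalues.\<close>
  have "0 = ln (\<Prod>i\<in>UNIV. l i)" by (simp add: prod)
  also have "\<dots> = (\<Sum>i\<in>UNIV. ln (l i))" using pos by (intro ln_prod) (auto simp: less_le)
  also have "\<dots> \<le> (\<Sum>i\<in>UNIV. l i - 1)" using pos by (intro sum_mono ln_le_minus_one)
  finally have "(\<Sum>i\<in>UNIV. Re (sesq h (e i) (e i)) - Re (sesq k (e i) (e i))) \<ge> 0"
    by (simp add: e el)
  then show ?thesis using that e by blast
qed

text \<open>\<open>A\<close> holds the coefficient functionals and \<open>B\<close> the frame.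
  Orthonormality says \<open>A ** B = mat 1\<close>, and for square matrices this gives
  \<open>B ** A = mat 1\<close>, which is the expansion.\<close>

lemma orthonormal_expansion:
  fixes k :: "complex^'n^'n::finite" and e :: "'n \<Rightarrow> complex^'n"
  assumes e: "\<And>i j. sesq k (e i) (e j) = (if i = j then 1 else 0)"
  shows "v = (\<Sum>j\<in>UNIV. sesq k v (e j) *s e j)"
proof -
  define A :: "complex^'n^'n" where "A = (\<chi> i j. \<Sum>l\<in>UNIV. k $ j $ l * cnj (e i $ l))"
  define B :: "complex^'n^'n" where "B = (\<chi> i j. e j $ i)"
  have A: "(A *v w) $ i = sesq k w (e i)" for w i
    by (simp add: A_def matrix_vector_mult_def sesq_def sum_distrib_left sum_distrib_right mult_ac)
  have "(A ** B) $ i $ j = (A *v e j) $ i" for i j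
    by (simp add: matrix_matrix_mult_def matrix_vector_mult_def B_def)
  then have "A ** B = mat 1"
    by (simp add: vec_eq_iff A e mat_def)
  then have "B ** A = mat 1" using matrix_left_right_inverse by metis
  then have "v = B *v (A *v v)" by (simp add: matrix_vector_mul_assoc)
  also have "\<dots> = (\<Sum>j\<in>UNIV. sesq k v (e j) *s e j)"
    unfolding vec_eq_iff matrix_vector_mult_def[of B] A by (simp add: B_def mult.commute)
  finally show ?thesis .
qed

text \<open>Uniform ellipticity of the operator built from the frame. The square of the norm of
  \<xi> is the pairing of its coefficients with its inner products against the frame, and the
  squares of the coefficients sum to \<open>sesq k \<xi> \<xi>\<close>, which is at most
  \<open>C\<close> times that square.\<close>

lemma frame_norm_bounds:
  fixes k :: "complex^'n^'n::finite" and e :: "'n \<Rightarrow> complex^'n"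
  assumes e: "\<And>i j. sesq k (e i) (e j) = (if i = j then 1 else 0)"
    and low: "\<And>v. c * (norm v)\<^sup>2 \<le> Re (sesq k v v)" and upp: "\<And>v. Re (sesq k v v) \<le> C * (norm v)\<^sup>2"
    and c: "c > 0"
  shows "(norm (e i))\<^sup>2 \<le> 1 / c"
    and "(norm \<xi>)\<^sup>2 / C \<le> (\<Sum>i\<in>UNIV. (\<xi> \<bullet> e i)\<^sup>2 + (\<xi> \<bullet> (\<i> *s e i))\<^sup>2)"
proof -
  show "(norm (e i))\<^sup>2 \<le> 1 / c" using low[of "e i"] e[of i i] c by (simp add: field_simps)
  define a where "a j = sesq k \<xi> (e j)" for j
  have exp: "\<xi> = (\<Sum>j\<in>UNIV. a j *s e j)"
    unfolding a_def by (rule orthonormal_expansion[OF e])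
  have sq: "Re (sesq k \<xi> \<xi>) = (\<Sum>j\<in>UNIV. (cmod (a j))\<^sup>2)"
  proof -
    have "sesq k \<xi> \<xi> = sesq k \<xi> (\<Sum>j\<in>UNIV. a j *s e j)" using exp by simp
    also have "\<dots> = (\<Sum>j\<in>UNIV. of_real ((cmod (a j))\<^sup>2))"
      unfolding sesq_sum_right sesq_simps a_def[symmetric] complex_norm_square by (simp add: mult.commute)
    finally show ?thesis by simp
  qed
  have dec: "z *s w = Re z *\<^sub>R w + Im z *\<^sub>R (\<i> *s w)" for z and w :: "complex^'n"
    by (simp add: vec_eq_iff complex_eq_iff)
  have inn: "(norm \<xi>)\<^sup>2 = (\<Sum>j\<in>UNIV. Re (a j) * (\<xi> \<bullet> e j) + Im (a j) * (\<xi> \<bullet> (\<i> *s e j)))"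
  proof -
    have "(norm \<xi>)\<^sup>2 = \<xi> \<bullet> (\<Sum>j\<in>UNIV. a j *s e j)" using exp by (simp add: power2_norm_eq_inner)
    also have "\<dots> = (\<Sum>j\<in>UNIV. Re (a j) * (\<xi> \<bullet> e j) + Im (a j) * (\<xi> \<bullet> (\<i> *s e j)))"
      unfolding inner_sum_right dec[of "a _"] inner_add_right inner_scaleR_right ..
    finally show ?thesis .
  qed
  define T where "T = (\<Sum>i\<in>UNIV. (\<xi> \<bullet> e i)\<^sup>2 + (\<xi> \<bullet> (\<i> *s e i))\<^sup>2)"
  have "(norm \<xi>)\<^sup>2 / C \<le> T"
  proof (cases "\<xi> = 0")
    case True
    then show ?thesis by (simp add: T_def sum_nonneg)
  next
    case False
    have "c * (norm \<xi>)\<^sup>2 > 0" using c False by simp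
    then have "C * (norm \<xi>)\<^sup>2 > 0" using low[of \<xi>] upp[of \<xi>] by linarith
    then have C: "C > 0" using False by (simp add: zero_less_mult_iff)
    \<comment> \<open>The weight \<open>C\<close> makes the coefficient part at most half of the
      left-hand side, so that it can be absorbed.\<close>
    have young: "x * p \<le> x\<^sup>2 / (2 * C) + C * p\<^sup>2 / 2" for x p :: real
    proof -
      have "0 \<le> (x - C * p)\<^sup>2 / (2 * C)" using C by simp
      also have "\<dots> = x\<^sup>2 / (2 * C) + C * p\<^sup>2 / 2 - x * p" using C by (simp add: field_simps power2_eq_square)
      finally show ?thesis by simp
    qed
    have "(norm \<xi>)\<^sup>2 \<le> (\<Sum>j\<in>UNIV. (cmod (a j))\<^sup>2 / (2 * C) + C / 2 * ((\<xi> \<bullet> e j)\<^sup>2 + (\<xi> \<bullet> (\<i> *s e j))\<^sup>2))"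
      unfolding inn
    proof (rule sum_mono)
      fix j
      show "Re (a j) * (\<xi> \<bullet> e j) + Im (a j) * (\<xi> \<bullet> (\<i> *s e j)) \<le>
        (cmod (a j))\<^sup>2 / (2 * C) + C / 2 * ((\<xi> \<bullet> e j)\<^sup>2 + (\<xi> \<bullet> (\<i> *s e j))\<^sup>2)"
        using young[of "Re (a j)" "\<xi> \<bullet> e j"] young[of "Im (a j)" "\<xi> \<bullet> (\<i> *s e j)"]
        by (simp add: cmod_power2 add_divide_distrib algebra_simps)
    qed
    also have "\<dots> = Re (sesq k \<xi> \<xi>) / (2 * C) + C / 2 * T"
      by (simp add: sum.distrib sum_distrib_left[symmetric] sum_divide_distrib[symmetric] sq T_def)
    also have "\<dots> \<le> (norm \<xi>)\<^sup>2 / 2 + C / 2 * T"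
      using upp[of \<xi>] C by (simp add: field_simps)
    finally show ?thesis using C by (simp add: field_simps)
  qed
  then show "(norm \<xi>)\<^sup>2 / C \<le> (\<Sum>i\<in>UNIV. (\<xi> \<bullet> e i)\<^sup>2 + (\<xi> \<bullet> (\<i> *s e i))\<^sup>2)"
    by (simp add: T_def)
qed

section \<open>The strong maximum principle\<close>

text \<open>A positive derivative of \<open>f'\<close> at 0, where \<open>f'\<close> vanishes, would
  make \<open>f'\<close> positive just to the right and lift \<open>f\<close> above its
  maximum.\<close>

lemma real_second_derivative_test:
  fixes f f' :: "real \<Rightarrow> real"
  assumes d: "d > 0" and f: "\<And>t. \<bar>t\<bar> < d \<Longrightarrow> (f has_real_derivative f' t) (at t)"
    and f2: "(f' has_real_derivative l) (at 0)" and max: "\<And>t. \<bar>t\<bar> < d \<Longrightarrow> f t \<le> f 0"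
  shows "l \<le> 0"
proof (rule ccontr)
  assume "\<not> l \<le> 0"
  have 0: "f' 0 = 0"
    using f[of 0] d max by (intro DERIV_local_max[of f "f' 0" 0 d]) auto
  obtain e where e: "e > 0" "\<And>h. 0 < h \<Longrightarrow> h < e \<Longrightarrow> f' 0 < f' (0 + h)"
    using DERIV_pos_inc_right[OF f2] \<open>\<not> l \<le> 0\<close> by auto
  define b where "b = min d e / 2"
  have b: "0 < b" "b < d" "b < e" using d e by (auto simp: b_def)
  have "\<exists>z>0. z < b \<and> f b - f 0 = (b - 0) * f' z"
    by (rule MVT2[OF b(1)]) (use b in \<open>auto intro!: f\<close>)
  then obtain z where z: "0 < z" "z < b" "f b - f 0 = b * f' z" by auto
  have "f' z > 0" using e(2)[of z] z b 0 by simp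
  then have "f b > f 0" using z b by (smt (verit) mult_pos_pos)
  then show False using max[of b] b by simp
qed

lemma interior_max_second_derivative:
  fixes w :: "'v::real_normed_vector \<Rightarrow> real"
  assumes S: "open S" "q \<in> S" and max: "\<And>x. x \<in> S \<Longrightarrow> w x \<le> w q"
    and w: "\<And>x. x \<in> S \<Longrightarrow> (w has_derivative D x) (at x)"
    and w1: "((\<lambda>x. D x v) has_derivative DD) (at q)"
  shows "DD v \<le> 0"
proof -
  obtain e where e: "e > 0" "ball q e \<subseteq> S" using S open_contains_ball by blast
  define d where "d = e / (norm v + 1)"
  have d: "d > 0" using e by (simp add: d_def add_nonneg_pos)
  have inS: "q + t *\<^sub>R v \<in> S" if "\<bar>t\<bar> < d" for t
  proof -
    have "\<bar>t\<bar> * norm v \<le> \<bar>t\<bar> * (norm v + 1)" by (intro mult_left_mono) auto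
    also have "\<dots> < d * (norm v + 1)" using that by (intro mult_strict_right_mono) (auto simp: add_nonneg_pos)
    also have "\<dots> = e" unfolding d_def using add_nonneg_pos[of "norm v" 1] by simp
    finally show ?thesis using e(2) by (auto simp: dist_norm)
  qed
  have line: "((\<lambda>t. q + t *\<^sub>R v) has_derivative (\<lambda>r. r *\<^sub>R v)) (at t)" for t
    by (auto intro!: derivative_eq_intros)
  show ?thesis
  proof (rule real_second_derivative_test[OF d])
    fix t :: real assume t: "\<bar>t\<bar> < d"
    from has_derivative_compose[OF line w[OF inS[OF t]]]
    have "((\<lambda>t. w (q + t *\<^sub>R v)) has_derivative (\<lambda>r. D (q + t *\<^sub>R v) (r *\<^sub>R v))) (at t)" .
    then show "((\<lambda>t. w (q + t *\<^sub>R v)) has_real_derivative D (q + t *\<^sub>R v) v) (at t)"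
      using linear_scale[OF has_derivative_linear[OF w[OF inS[OF t]]]]
      by (simp add: has_field_derivative_def mult.commute[of _ "D (q + t *\<^sub>R v) v"])
    show "w (q + t *\<^sub>R v) \<le> w (q + 0 *\<^sub>R v)" using max[OF inS[OF t]] by simp
  next
    have "((\<lambda>t. D (q + t *\<^sub>R v) v) has_derivative (\<lambda>r. DD (r *\<^sub>R v))) (at 0)"
      using has_derivative_compose[OF line[of 0], of "\<lambda>x. D x v" DD] w1 by simp
    then show "((\<lambda>t. D (q + t *\<^sub>R v) v) has_real_derivative DD v) (at 0)"
      using linear_scale[OF has_derivative_linear[OF w1]]
      by (simp add: has_field_derivative_def mult.commute[of _ "DD v"])
  qed
qed

lemma has_derivative_gaussian:
  fixes y :: "'v::euclidean_space"
  shows "((\<lambda>x. exp (- a * ((x - y) \<bullet> (x - y)))) has_derivative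
    (\<lambda>v. - 2 * a * ((x - y) \<bullet> v) * exp (- a * ((x - y) \<bullet> (x - y))))) (at x)"
  by (auto intro!: derivative_eq_intros simp: inner_commute algebra_simps)

text \<open>The term of order \<open>a\<close> squared dominates the term of order \<open>a\<close>
  away from the centre when \<open>a\<close> is large; this makes the Gaussian a strict subsolution
  there.\<close>

lemma has_derivative_gaussian2:
  fixes y :: "'v::euclidean_space"
  shows "((\<lambda>x. - 2 * a * ((x - y) \<bullet> v) * exp (- a * ((x - y) \<bullet> (x - y)))) has_derivative
    (\<lambda>w. (4 * a\<^sup>2 * ((x - y) \<bullet> v) * ((x - y) \<bullet> w) - 2 * a * (v \<bullet> w)) * exp (- a * ((x - y) \<bullet> (x - y))))) (at x)"
  by (auto intro!: derivative_eq_intros simp: inner_commute algebra_simps power2_eq_square)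

text \<open>Hopf's argument: a ball in the set where \<open>u\<close> is below its maximum touches the maximum set at a
  single point \<open>z\<close>, and adding a small multiple of a Gaussian barrier centred in that ball produces
  a strict subsolution with an interior maximum near \<open>z\<close>.\<close>

lemma strong_maximum_principle_local:
  fixes u :: "'v::euclidean_space \<Rightarrow> real"
  assumes u: "Ck_on 2 (ball x0 R) u"
    and max: "\<And>x. x \<in> ball x0 R \<Longrightarrow> u x \<le> u x0"
    and ell: "\<And>K. compact K \<Longrightarrow> K \<subseteq> ball x0 R \<Longrightarrow> \<exists>A \<mu>. \<mu> > 0 \<and>
      (\<forall>x\<in>K. \<exists>e :: 'i::finite \<Rightarrow> 'v. (\<Sum>i\<in>UNIV. dir_deriv (e i) (dir_deriv (e i) u) x) \<ge> 0 \<and>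
        (\<Sum>i\<in>UNIV. (norm (e i))\<^sup>2) \<le> A \<and> (\<forall>\<xi>. \<mu> * (norm \<xi>)\<^sup>2 \<le> (\<Sum>i\<in>UNIV. (\<xi> \<bullet> e i)\<^sup>2)))"
    and x: "x \<in> ball x0 (R / 4)"
  shows "u x = u x0"
proof (rule ccontr)
  assume "u x \<noteq> u x0"
  have R: "R > 0" using x by (auto simp: dist_norm) (smt (verit) norm_ge_zero)
  have xR: "x \<in> ball x0 R" using x R by auto
  have lt: "u x < u x0" using max[OF xR] \<open>u x \<noteq> u x0\<close> by simp
  have du: "u differentiable at p" "dir_deriv v u differentiable at p" if "p \<in> ball x0 R" for p v
    using u that by (auto simp: numeral_2_eq_2)
  have cu: "continuous_on (ball x0 R) u" using u Ck_on_imp_continuous_on by blast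
  \<comment> \<open>The maximum set near \<open>x0\<close>. Since \<open>x0\<close> belongs to it
    and \<open>x\<close> is within \<open>R / 4\<close> of \<open>x0\<close>, a point
    \<open>z\<close> of it nearest to \<open>x\<close> lies well inside the big ball.\<close>
  define Z where "Z = {p \<in> cball x0 (R / 2). u p = u x0}"
  have "continuous_on (cball x0 (R / 2)) u" using R by (intro continuous_on_subset[OF cu]) auto
  then have "closed Z" unfolding Z_def
    by (intro continuous_closed_preimage_constant) auto
  moreover have "Z \<noteq> {}" using R by (auto simp: Z_def intro!: exI[of _ x0])
  ultimately obtain z where z: "z \<in> Z" "\<And>p. p \<in> Z \<Longrightarrow> dist x z \<le> dist x p"
    using distance_attains_inf by metis
  have xz: "dist x z < R / 4"
    using z(2)[of x0] x R by (auto simp: Z_def dist_commute)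
  have uz: "u z = u x0" using z(1) by (simp add: Z_def)
  have zR: "dist x0 z < R / 2"
    using dist_triangle[of x0 z x] x xz by simp
  have "x \<noteq> z" using lt uz by auto
  \<comment> \<open>The ball around \<open>x\<close> through \<open>z\<close> may touch
    \<open>Z\<close> in many points; the ball of half the radius centred at the midpoint touches it
    only in \<open>z\<close>.\<close>
  define y where "y = (1 / 2) *\<^sub>R (x + z)"
  define \<rho> where "\<rho> = dist x z / 2"
  have \<rho>: "\<rho> > 0" "\<rho> < R / 8" using \<open>x \<noteq> z\<close> xz by (auto simp: \<rho>_def)
  have yz: "norm (z - y) = \<rho>"
  proof -
    have "z - y = (1 / 2) *\<^sub>R (z - x)" by (simp add: y_def algebra_simps scaleR_2[symmetric])
    then show ?thesis by (simp add: \<rho>_def dist_norm norm_minus_commute)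
  qed
  have yx: "norm (x - y) = \<rho>"
  proof -
    have "x - y = (1 / 2) *\<^sub>R (x - z)" by (simp add: y_def algebra_simps scaleR_2[symmetric])
    then show ?thesis by (simp add: \<rho>_def dist_norm)
  qed
  have inside: "u p < u x0" if "norm (p - y) \<le> \<rho>" "p \<noteq> z" for p
  proof -
    have "dist x p < dist x z"
    proof (rule ccontr)
      assume "\<not> dist x p < dist x z"
      \<comment> \<open>Vectors of length at most \<open>\<rho>\<close> whose difference has length
        at least \<open>2 * \<rho>\<close> are opposite, by the parallelogram law; so
        \<open>p\<close> is the antipode of \<open>x\<close>, which is \<open>z\<close>.\<close>
      then have ge: "norm ((p - y) - (x - y)) \<ge> 2 * \<rho>"
        by (simp add: \<rho>_def dist_norm norm_minus_commute)
      have xy: "x - y = - (z - y)" by (simp add: y_def algebra_simps scaleR_2[symmetric])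
      have s: "(norm ((p - y) - (x - y)))\<^sup>2 + (norm ((p - y) + (x - y)))\<^sup>2 = 2 * (norm (p - y))\<^sup>2 + 2 * (norm (x - y))\<^sup>2"
        by (simp only: power2_norm_eq_inner inner_diff_left inner_diff_right inner_add_left inner_add_right) (simp add: inner_commute)
      have "(norm (p - y))\<^sup>2 \<le> \<rho>\<^sup>2" using that \<rho> by (intro power_mono) auto
      moreover have "(norm ((p - y) - (x - y)))\<^sup>2 \<ge> (2 * \<rho>)\<^sup>2" using ge \<rho> by (intro power_mono) auto
      ultimately have "(norm ((p - y) + (x - y)))\<^sup>2 \<le> 0" using s yx by (simp add: power2_eq_square)
      then have "(p - y) + (x - y) = 0" by simp
      then have "p = z" using xy by (simp add: add_eq_0_iff)
      with that show False by simp
    qed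
    then have "p \<notin> Z" using z(2)[of p] by auto
    moreover have "dist x0 p < R / 2" using dist_triangle[of x0 p x] x xz \<open>dist x p < dist x z\<close> by simp
    ultimately have "u p \<noteq> u x0" by (simp add: Z_def)
    moreover have "u p \<le> u x0" using \<open>dist x0 p < R / 2\<close> R by (intro max) simp
    ultimately show ?thesis by simp
  qed
  \<comment> \<open>Every point of \<open>cball z \<delta>\<close> keeps distance at least
    \<open>\<rho> / 2\<close> from the centre \<open>y\<close> of the barrier.\<close>
  define \<delta> where "\<delta> = \<rho> / 2"
  have \<delta>: "\<delta> > 0" using \<rho> by (simp add: \<delta>_def)
  have K: "compact (cball z \<delta>)" "cball z \<delta> \<subseteq> ball x0 R"
  proof -
    show "cball z \<delta> \<subseteq> ball x0 R"
    proof
      fix p assume "p \<in> cball z \<delta>"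
      then have "dist z p \<le> R / 16" using \<rho> by (simp add: \<delta>_def)
      then show "p \<in> ball x0 R" using dist_triangle[of x0 p z] zR R by simp
    qed
  qed simp
  obtain A \<mu> where \<mu>: "\<mu> > 0" and E: "\<And>p. p \<in> cball z \<delta> \<Longrightarrow> \<exists>e :: 'i \<Rightarrow> 'v.
      (\<Sum>i\<in>UNIV. dir_deriv (e i) (dir_deriv (e i) u) p) \<ge> 0 \<and>
        (\<Sum>i\<in>UNIV. (norm (e i))\<^sup>2) \<le> A \<and> (\<forall>\<xi>. \<mu> * (norm \<xi>)\<^sup>2 \<le> (\<Sum>i\<in>UNIV. (\<xi> \<bullet> e i)\<^sup>2))"
    using ell[OF K] by blast
  \<comment> \<open>Large enough that, at distance \<open>\<rho> / 2\<close> from \<open>y\<close>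
    or more, the convex part of the barrier's second derivatives beats the trace bound
    \<open>A\<close>.\<close>
  define a where "a = 2 * \<bar>A\<bar> / (\<mu> * \<rho>\<^sup>2) + 1"
  have a: "a > 0" using \<mu> \<rho> by (simp add: a_def add_nonneg_pos)
  have aA: "2 * a * \<mu> * (\<rho> / 2)\<^sup>2 > A"
  proof -
    have "a * (\<mu> * \<rho>\<^sup>2) = 2 * \<bar>A\<bar> + \<mu> * \<rho>\<^sup>2" using \<mu> \<rho> by (simp add: a_def field_simps)
    moreover have "\<mu> * \<rho>\<^sup>2 > 0" using \<mu> \<rho> by simp
    ultimately have "a * (\<mu> * \<rho>\<^sup>2) / 2 > A" by linarith
    then show ?thesis by (simp add: power_divide algebra_simps)
  qed
  \<comment> \<open>The barrier vanishes on the sphere of radius \<open>\<rho>\<close> around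
    \<open>y\<close>, hence at \<open>z\<close>, and is negative outside it.\<close>
  define h where "h p = exp (- a * ((p - y) \<bullet> (p - y))) - exp (- a * \<rho>\<^sup>2)" for p
  have hz: "h z = 0" using yz by (simp add: h_def power2_norm_eq_inner[symmetric])
  have h1: "h p \<le> 1" for p
  proof -
    have "exp (- a * ((p - y) \<bullet> (p - y))) \<le> 1" using a by simp
    then show ?thesis using exp_gt_zero[of "- a * \<rho>\<^sup>2"] unfolding h_def by linarith
  qed
  have hneg: "h p < 0" if "norm (p - y) > \<rho>" for p
  proof -
    have "\<rho>\<^sup>2 < (p - y) \<bullet> (p - y)" using that \<rho> by (simp add: power2_norm_eq_inner[symmetric] power_strict_mono)
    then show ?thesis using a by (simp add: h_def)
  qed
  have ch: "continuous_on T h" for T unfolding h_def by (intro continuous_intros)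
  \<comment> \<open>The part of the small sphere where the barrier may be nonnegative. It is compact
    and avoids \<open>z\<close>, so \<open>u\<close> stays below its maximum there by a fixed amount
    \<open>\<eta>\<close>, of which adding \<open>\<epsilon> * h\<close> uses up at most
    half.\<close>
  define C where "C = sphere z \<delta> \<inter> cball y \<rho>"
  have "\<exists>\<eta>>0. \<forall>p\<in>C. u p \<le> u x0 - \<eta>"
  proof (cases "C = {}")
    case True
    then show ?thesis by (auto intro: exI[of _ 1])
  next
    case False
    have "compact C" unfolding C_def by (intro compact_Int compact_sphere compact_cball)
    moreover have "C \<subseteq> ball x0 R" using K(2) by (auto simp: C_def)
    ultimately obtain p where p: "p \<in> C" "\<And>q. q \<in> C \<Longrightarrow> u q \<le> u p"
      using continuous_attains_sup[OF _ False continuous_on_subset[OF cu]] by blast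
    have "p \<noteq> z" using p(1) \<delta> by (auto simp: C_def)
    moreover have "norm (p - y) \<le> \<rho>" using p(1) by (simp add: C_def dist_norm norm_minus_commute)
    ultimately have "u p < u x0" by (intro inside)
    then show ?thesis using p by (intro exI[of _ "u x0 - u p"]) auto
  qed
  then obtain \<eta> where \<eta>: "\<eta> > 0" "\<And>p. p \<in> C \<Longrightarrow> u p \<le> u x0 - \<eta>" by blast
  define \<epsilon> where "\<epsilon> = \<eta> / 2"
  have \<epsilon>: "\<epsilon> > 0" using \<eta> by (simp add: \<epsilon>_def)
  define w where "w p = u p + \<epsilon> * h p" for p
  have wz: "w z = u x0" by (simp add: w_def uz hz)
  have bdry: "w p < u x0" if "p \<in> sphere z \<delta>" for p
  proof (cases "p \<in> C")
    case True
    have "\<epsilon> * h p \<le> \<epsilon> * 1" using h1 \<epsilon> by (intro mult_left_mono) auto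
    then show ?thesis using \<eta>(2)[OF True] \<eta>(1) \<epsilon>_def unfolding w_def by linarith
  next
    case False
    then have "norm (p - y) > \<rho>" using that by (auto simp: C_def dist_norm norm_minus_commute)
    then have "\<epsilon> * h p < 0" using \<epsilon> hneg by (simp add: mult_pos_neg)
    moreover have "p \<in> ball x0 R" using that K(2) by auto
    ultimately show ?thesis using max[of p] by (simp add: w_def)
  qed
  have "continuous_on (cball z \<delta>) w" unfolding w_def
    by (intro continuous_intros continuous_on_subset[OF cu K(2)] ch)
  then obtain q where q: "q \<in> cball z \<delta>" "\<And>p. p \<in> cball z \<delta> \<Longrightarrow> w p \<le> w q"
    using continuous_attains_sup[OF K(1)] \<delta> by (metis cball_eq_empty not_less_iff_gr_or_eq)
  have "w q \<ge> u x0" using q(2)[of z] \<delta> wz by simp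
  then have "q \<notin> sphere z \<delta>" using bdry by force
  then have qb: "q \<in> ball z \<delta>" using q(1) by auto
  have qR: "q \<in> ball x0 R" using q(1) K(2) by blast
  have second: "dir_deriv v (dir_deriv v u) q +
      \<epsilon> * ((4 * a\<^sup>2 * ((q - y) \<bullet> v) * ((q - y) \<bullet> v) - 2 * a * (v \<bullet> v)) * exp (- a * ((q - y) \<bullet> (q - y)))) \<le> 0" for v
  proof (rule interior_max_second_derivative[OF open_ball qb, where w=w and v=v and
        D="\<lambda>p v. dir_deriv v u p + \<epsilon> * (- 2 * a * ((p - y) \<bullet> v) * exp (- a * ((p - y) \<bullet> (p - y))))" and
        DD="\<lambda>v'. dir_deriv v' (dir_deriv v u) q + \<epsilon> * ((4 * a\<^sup>2 * ((q - y) \<bullet> v) * ((q - y) \<bullet> v') - 2 * a * (v \<bullet> v')) * exp (- a * ((q - y) \<bullet> (q - y))))"])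
    fix p assume p: "p \<in> ball z \<delta>"
    then show "w p \<le> w q" using q(2) by simp
    have "p \<in> ball x0 R" using p K(2) ball_subset_cball by blast
    from has_derivative_dir_deriv[OF du(1)[OF this]]
    have "((\<lambda>p. u p + \<epsilon> * (exp (- a * ((p - y) \<bullet> (p - y))) - exp (- a * \<rho>\<^sup>2))) has_derivative
       (\<lambda>v. dir_deriv v u p + \<epsilon> * (- 2 * a * ((p - y) \<bullet> v) * exp (- a * ((p - y) \<bullet> (p - y))) - 0))) (at p)"
      by (intro has_derivative_add has_derivative_mult_right has_derivative_diff has_derivative_const has_derivative_gaussian)
    then show "(w has_derivative (\<lambda>v. dir_deriv v u p + \<epsilon> * (- 2 * a * ((p - y) \<bullet> v) * exp (- a * ((p - y) \<bullet> (p - y)))))) (at p)"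
      unfolding w_def h_def by simp
  next
    show "((\<lambda>x. dir_deriv v u x + \<epsilon> * (- 2 * a * ((x - y) \<bullet> v) * exp (- a * ((x - y) \<bullet> (x - y))))) has_derivative
       (\<lambda>v'. dir_deriv v' (dir_deriv v u) q + \<epsilon> * ((4 * a\<^sup>2 * ((q - y) \<bullet> v) * ((q - y) \<bullet> v') - 2 * a * (v \<bullet> v')) * exp (- a * ((q - y) \<bullet> (q - y)))))) (at q)"
      by (intro has_derivative_add has_derivative_mult_right has_derivative_gaussian2
          has_derivative_dir_deriv du(2)[OF qR])
  qed
  obtain e :: "'i \<Rightarrow> 'v" where e: "(\<Sum>i\<in>UNIV. dir_deriv (e i) (dir_deriv (e i) u) q) \<ge> 0"
    "(\<Sum>i\<in>UNIV. (norm (e i))\<^sup>2) \<le> A" "\<And>\<xi>. \<mu> * (norm \<xi>)\<^sup>2 \<le> (\<Sum>i\<in>UNIV. (\<xi> \<bullet> e i)\<^sup>2)"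
    using E[OF q(1)] by blast
  define G where "G = exp (- a * ((q - y) \<bullet> (q - y)))"
  \<comment> \<open>At the interior maximum \<open>q\<close> the frame sum of second derivatives of
    \<open>w\<close> is at most 0, while the part from \<open>u\<close> is nonnegative and the part
    from the Gaussian positive.\<close>
  have "(\<Sum>i\<in>UNIV. dir_deriv (e i) (dir_deriv (e i) u) q +
      \<epsilon> * ((4 * a\<^sup>2 * ((q - y) \<bullet> e i) * ((q - y) \<bullet> e i) - 2 * a * (e i \<bullet> e i)) * G)) \<le> 0"
    unfolding G_def by (intro sum_nonpos second)
  then have "(\<Sum>i\<in>UNIV. dir_deriv (e i) (dir_deriv (e i) u) q) +
      \<epsilon> * G * 2 * a * (2 * a * (\<Sum>i\<in>UNIV. ((q - y) \<bullet> e i)\<^sup>2) - (\<Sum>i\<in>UNIV. (norm (e i))\<^sup>2)) \<le> 0"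
    unfolding power2_norm_eq_inner
    by (simp add: sum.distrib sum_distrib_left sum_distrib_right sum_subtractf power2_eq_square algebra_simps)
  moreover have "2 * a * (\<Sum>i\<in>UNIV. ((q - y) \<bullet> e i)\<^sup>2) - (\<Sum>i\<in>UNIV. (norm (e i))\<^sup>2) > 0"
  proof -
    have "norm (q - y) \<ge> \<rho> / 2"
      using norm_triangle_sub[of "z - y" "z - q"] yz q(1) by (simp add: \<delta>_def dist_norm)
    then have "(\<rho> / 2)\<^sup>2 \<le> (norm (q - y))\<^sup>2" using \<rho> by (intro power_mono) auto
    then have "2 * a * (\<mu> * (\<rho> / 2)\<^sup>2) \<le> 2 * a * (\<mu> * (norm (q - y))\<^sup>2)"
      using a \<mu> by (intro mult_left_mono) auto
    also have "\<dots> \<le> 2 * a * (\<Sum>i\<in>UNIV. ((q - y) \<bullet> e i)\<^sup>2)" using a e(3) by (intro mult_left_mono) auto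
    finally show ?thesis using aA e(2) by (simp add: mult.assoc)
  qed
  moreover have "\<epsilon> * G * 2 * a > 0" using \<epsilon> a by (simp add: G_def)
  ultimately show False using e(1) by (smt (verit) mult_pos_pos)
qed

section \<open>The complex Hessian\<close>

definition levi :: "(complex^'n::finite \<Rightarrow> real) \<Rightarrow> complex^'n \<Rightarrow> complex^'n^'n"
  where "levi f x = (\<chi> i j. wirt i (wirtbar j (\<lambda>y. of_real (f y))) x)"

lemma dir_deriv_add:
  "f differentiable at x \<Longrightarrow> g differentiable at x \<Longrightarrow>
    dir_deriv v (\<lambda>y. f y + g y) x = dir_deriv v f x + dir_deriv v g x"
  by (rule dir_deriv_eqI) (intro has_derivative_add has_derivative_dir_deriv)

lemma dir_deriv_mult_const:
  fixes f :: "'a::real_normed_vector \<Rightarrow> 'b::real_normed_algebra"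
  shows "f differentiable at x \<Longrightarrow> dir_deriv v (\<lambda>y. c * f y) x = c * dir_deriv v f x"
  by (rule dir_deriv_eqI) (intro has_derivative_mult_right has_derivative_dir_deriv)

lemma dir_deriv_diff:
  "f differentiable at x \<Longrightarrow> g differentiable at x \<Longrightarrow>
    dir_deriv v (\<lambda>y. f y - g y) x = dir_deriv v f x - dir_deriv v g x"
  by (rule dir_deriv_eqI) (intro has_derivative_diff has_derivative_dir_deriv)

lemma Ck2_differentiable:
  assumes "Ck_on 2 S f" "x \<in> S"
  shows "f differentiable at x" "dir_deriv v f differentiable at x"
  using assms by (auto simp: numeral_2_eq_2)

lemma Ck2_continuous_on_second:
  "Ck_on 2 S f \<Longrightarrow> continuous_on S (dir_deriv v (dir_deriv w f))"
  by (simp add: numeral_2_eq_2)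

lemma smooth_on_imp_Ck2: "smooth_on S f \<Longrightarrow> Ck_on 2 S f"
  by (simp add: smooth_on_def)

context
  fixes S :: "(complex^'n::finite) set" and f :: "complex^'n \<Rightarrow> real"
  assumes S: "open S" and f: "Ck_on 2 S f"
begin

lemma wirtbar_of_real:
  assumes "x \<in> S"
  shows "wirtbar j (\<lambda>y. of_real (f y)) x =
    (of_real (dir_deriv (axis j 1) f x) + \<i> * of_real (dir_deriv (axis j \<i>) f x)) / 2"
  unfolding wirtbar_def
  by (simp add: dir_deriv_linear_map[OF bounded_linear_of_real] Ck2_differentiable(1)[OF f assms])

lemma wirtbar_differentiable:
  assumes "x \<in> S"
  shows "wirtbar j (\<lambda>y. of_real (f y)) differentiable at x"
proof -
  have d: "((\<lambda>y. of_real (dir_deriv v f y) :: complex) has_derivative (\<lambda>h. of_real (dir_deriv h (dir_deriv v f) x))) (at x)" for v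
    by (rule bounded_linear.has_derivative[OF bounded_linear_of_real has_derivative_dir_deriv[OF Ck2_differentiable(2)[OF f assms]]])
  have "((\<lambda>y. (of_real (dir_deriv (axis j 1) f y) + \<i> * of_real (dir_deriv (axis j \<i>) f y)) / 2) has_derivative
     (\<lambda>h. (of_real (dir_deriv h (dir_deriv (axis j 1) f) x) + \<i> * of_real (dir_deriv h (dir_deriv (axis j \<i>) f) x)) / 2)) (at x)"
    by (intro bounded_linear.has_derivative[OF bounded_linear_divide] has_derivative_add has_derivative_mult_right d)
  then have "(wirtbar j (\<lambda>y. of_real (f y)) has_derivative
     (\<lambda>h. (of_real (dir_deriv h (dir_deriv (axis j 1) f) x) + \<i> * of_real (dir_deriv h (dir_deriv (axis j \<i>) f) x)) / 2)) (at x)"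
    by (rule has_derivative_transform_within_open[OF _ S assms]) (simp add: wirtbar_of_real)
  then show ?thesis by (rule differentiableI)
qed

lemma levi_nth:
  assumes "x \<in> S"
  shows "levi f x $ i $ j =
    Complex ((dir_deriv (axis i 1) (dir_deriv (axis j 1) f) x + dir_deriv (axis i \<i>) (dir_deriv (axis j \<i>) f) x) / 4)
      ((dir_deriv (axis i 1) (dir_deriv (axis j \<i>) f) x - dir_deriv (axis i \<i>) (dir_deriv (axis j 1) f) x) / 4)"
proof -
  have d: "((\<lambda>y. of_real (dir_deriv v f y) :: complex) has_derivative (\<lambda>h. of_real (dir_deriv h (dir_deriv v f) x))) (at x)" for v
    by (rule bounded_linear.has_derivative[OF bounded_linear_of_real has_derivative_dir_deriv[OF Ck2_differentiable(2)[OF f assms]]])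
  have "((\<lambda>y. (of_real (dir_deriv (axis j 1) f y) + \<i> * of_real (dir_deriv (axis j \<i>) f y)) / 2) has_derivative
     (\<lambda>h. (of_real (dir_deriv h (dir_deriv (axis j 1) f) x) + \<i> * of_real (dir_deriv h (dir_deriv (axis j \<i>) f) x)) / 2)) (at x)"
    by (intro bounded_linear.has_derivative[OF bounded_linear_divide] has_derivative_add has_derivative_mult_right d)
  then have D: "(wirtbar j (\<lambda>y. of_real (f y)) has_derivative
     (\<lambda>h. (of_real (dir_deriv h (dir_deriv (axis j 1) f) x) + \<i> * of_real (dir_deriv h (dir_deriv (axis j \<i>) f) x)) / 2)) (at x)"
    by (rule has_derivative_transform_within_open[OF _ S assms]) (simp add: wirtbar_of_real)
  show ?thesis
    by (simp add: levi_def wirt_def dir_deriv_eqI[OF D] complex_eq_iff)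
qed

lemma levi_hermitian: "x \<in> S \<Longrightarrow> hermitian (levi f x)"
  unfolding hermitian_def
proof (intro allI)
  fix i j assume x: "x \<in> S"
  note c = dir_deriv_commute[OF S f x]
  show "levi f x $ j $ i = cnj (levi f x $ i $ j)"
    unfolding levi_nth[OF x]
    using c[of "axis i 1" "axis j 1"] c[of "axis i \<i>" "axis j \<i>"] c[of "axis i 1" "axis j \<i>"] c[of "axis i \<i>" "axis j 1"]
    by (simp add: complex_eq_iff add.commute diff_divide_distrib)
qed

text \<open>With \<open>assoc_form_add\<close> this turns the deformed form into the associated form
  of the matrix sum of metric and complex Hessian, so that statements about forms become statements
  about Hermitian matrices.\<close>

lemma i_ddbar_eq_assoc_form:
  assumes x: "x \<in> S"
  shows "i_ddbar f x v = assoc_form (levi f x) v"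
proof -
  have w0: "wedge 1 0 (dzbar j) (\<lambda>w'. c) w = cnj (w 0 $ j) * c" for j c and w :: "nat \<Rightarrow> complex^'n"
  proof -
    have "{..<1 + 0::nat} = {0}" by auto
    then show ?thesis unfolding wedge_def by (simp add: dzbar_def)
  qed
  have db: "delbar 0 (\<lambda>y w. of_real (f y)) y w = (\<Sum>j\<in>UNIV. cnj (w 0 $ j) * wirtbar j (\<lambda>y. of_real (f y)) y)" for y w
    unfolding delbar_def w0 ..
  have D: "dir_deriv u (\<lambda>y. \<Sum>j\<in>UNIV. cnj (w 0 $ j) * wirtbar j (\<lambda>y. of_real (f y)) y) x =
      (\<Sum>j\<in>UNIV. cnj (w 0 $ j) * dir_deriv u (wirtbar j (\<lambda>y. of_real (f y))) x)" for u and w :: "nat \<Rightarrow> complex^'n"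
    by (rule dir_deriv_eqI)
      (intro has_derivative_sum has_derivative_mult_right has_derivative_dir_deriv wirtbar_differentiable x)
  have W: "wirt i (\<lambda>y. delbar 0 (\<lambda>y w. of_real (f y)) y w) x = (\<Sum>j\<in>UNIV. levi f x $ i $ j * cnj (w 0 $ j))" for i w
    unfolding db wirt_def D levi_def
    by (simp add: sum_distrib_left sum_subtractf[symmetric] sum_divide_distrib algebra_simps)
  have "del 1 (delbar 0 (\<lambda>y w. of_real (f y))) x v =
     (\<Sum>i\<in>UNIV. \<Sum>j\<in>UNIV. levi f x $ i $ j * wedge 1 1 (dz i) (dzbar j) v)"
  proof -
    have "wedge 1 1 (dz i) (\<lambda>w. \<Sum>j\<in>UNIV. levi f x $ i $ j * cnj (w 0 $ j)) v =
       (\<Sum>j\<in>UNIV. levi f x $ i $ j * wedge 1 1 (dz i) (dzbar j) v)" for i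
      unfolding wedge_def dzbar_def
      by (simp add: sum_distrib_left mult_ac) (rule sum.swap)
    then show ?thesis unfolding del_def W by simp
  qed
  then show ?thesis by (simp add: i_ddbar_def assoc_form_def)
qed

text \<open>Linearity in the outer direction is that of the derivative; linearity in the inner one
  follows by symmetry.\<close>

lemma second_deriv_bilinear:
  assumes x: "x \<in> S"
  shows "bilinear (\<lambda>v w. dir_deriv v (dir_deriv w f) x)"
  unfolding bilinear_def
proof (intro conjI allI)
  show "linear (\<lambda>v. dir_deriv v (dir_deriv w f) x)" for w
    by (rule has_derivative_linear[OF has_derivative_dir_deriv[OF Ck2_differentiable(2)[OF f x]]])
  show "linear (\<lambda>w. dir_deriv v (dir_deriv w f) x)" for v
    unfolding dir_deriv_commute[OF S f x, of v]
    by (rule has_derivative_linear[OF has_derivative_dir_deriv[OF Ck2_differentiable(2)[OF f x]]])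
qed

end

lemma complex_vec_expansion:
  "w = (\<Sum>i\<in>UNIV. Re (w $ i) *\<^sub>R axis i 1 + Im (w $ i) *\<^sub>R axis i \<i>)" for w :: "complex^'n::finite"
proof -
  have "w = (\<Sum>i\<in>UNIV. w $ i *s axis i 1)" by (simp add: basis_expansion)
  also have "\<dots> = (\<Sum>i\<in>UNIV. Re (w $ i) *\<^sub>R axis i 1 + Im (w $ i) *\<^sub>R axis i \<i>)"
    by (rule sum.cong[OF refl]) (auto simp: vec_eq_iff complex_eq_iff axis_def)
  finally show ?thesis .
qed

text \<open>Passing from a real bilinear form to its (1,1) part averages it over multiplication by
  \<open>\<i>\<close>.\<close>

lemma real_sesq_bilinear:
  fixes B :: "complex^'n::finite \<Rightarrow> complex^'n \<Rightarrow> real"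
  assumes B: "bilinear B"
  shows "Re (sesq (\<chi> i j. Complex ((B (axis i 1) (axis j 1) + B (axis i \<i>) (axis j \<i>)) / 4)
      ((B (axis i 1) (axis j \<i>) - B (axis i \<i>) (axis j 1)) / 4)) v v) = (B v v + B (\<i> *s v) (\<i> *s v)) / 4"
proof -
  have Bexp: "B w w = (\<Sum>i\<in>UNIV. \<Sum>j\<in>UNIV.
      Re (w $ i) * Re (w $ j) * B (axis i 1) (axis j 1) + Re (w $ i) * Im (w $ j) * B (axis i 1) (axis j \<i>) +
      Im (w $ i) * Re (w $ j) * B (axis i \<i>) (axis j 1) + Im (w $ i) * Im (w $ j) * B (axis i \<i>) (axis j \<i>))" for w
    by (subst (1 2) complex_vec_expansion) (simp only: bilinear_sum[OF B] sum.cartesian_product[symmetric],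
      simp add: bilinear_ladd[OF B] bilinear_radd[OF B] bilinear_lmul[OF B] bilinear_rmul[OF B] algebra_simps)
  show ?thesis
    unfolding Bexp sesq_def
    by (simp add: sum.distrib[symmetric] sum_divide_distrib)
      (intro sum.cong refl, simp add: add_divide_distrib diff_divide_distrib algebra_simps)
qed

text \<open>Turns a complex trace into a sum of real second derivatives along \<open>v\<close> and
  \<open>\<i> *s v\<close>, the shape the maximum principle expects.\<close>

lemma levi_quadratic:
  fixes f :: "complex^'n::finite \<Rightarrow> real"
  assumes "open S" "Ck_on 2 S f" "x \<in> S"
  shows "Re (sesq (levi f x) v v) =
    (dir_deriv v (dir_deriv v f) x + dir_deriv (\<i> *s v) (dir_deriv (\<i> *s v) f) x) / 4"
proof -
  have "levi f x = (\<chi> i j. Complex ((dir_deriv (axis i 1) (dir_deriv (axis j 1) f) x + dir_deriv (axis i \<i>) (dir_deriv (axis j \<i>) f) x) / 4)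
      ((dir_deriv (axis i 1) (dir_deriv (axis j \<i>) f) x - dir_deriv (axis i \<i>) (dir_deriv (axis j 1) f) x) / 4))"
    by (simp add: vec_eq_iff levi_nth[OF assms])
  then show ?thesis using real_sesq_bilinear[OF second_deriv_bilinear[OF assms], of v] by simp
qed

lemma continuous_on_levi:
  assumes "open S" "Ck_on 2 S f"
  shows "continuous_on S (levi f)"
proof -
  have "continuous_on S (\<lambda>x. \<chi> i j. Complex ((dir_deriv (axis i 1) (dir_deriv (axis j 1) f) x + dir_deriv (axis i \<i>) (dir_deriv (axis j \<i>) f) x) / 4)
      ((dir_deriv (axis i 1) (dir_deriv (axis j \<i>) f) x - dir_deriv (axis i \<i>) (dir_deriv (axis j 1) f) x) / 4))"
    unfolding Complex_eq
    by (intro continuous_intros continuous_on_of_real Ck2_continuous_on_second assms) auto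
  then show ?thesis
    by (rule continuous_on_eq) (simp add: vec_eq_iff levi_nth[OF assms])
qed

section \<open>Positivity of forms and of matrices\<close>

lemma assoc_form_add: "assoc_form h v + assoc_form k v = assoc_form (h + k) v"
  by (simp add: assoc_form_def sum.distrib algebra_simps)

lemma hermitian_add: "hermitian h \<Longrightarrow> hermitian k \<Longrightarrow> hermitian (h + k)"
  unfolding hermitian_def vector_add_component complex_cnj_add by metis

lemma positive_assoc_form_imp_pos_def:
  assumes "hermitian h" "positive_form (assoc_form h)"
  shows "pos_def_hermitian h"
proof -
  have "Re (sesq h v v) > 0" if "v \<noteq> 0" for v
  proof -
    define w where "w = (\<lambda>i::nat. if i = 0 then v else \<i> *s v)"
    have "Re (assoc_form h w) > 0"
      using assms(2) that unfolding positive_form_def w_def by (metis (no_types, lifting))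
    then show ?thesis unfolding assoc_form_eq[OF assms(1)] by (simp add: w_def sesq_simps)
  qed
  then show ?thesis using assms(1) unfolding pos_def_hermitian_def hermitian_def by blast
qed

text \<open>By homogeneity in \<open>v\<close> the form only has to be bounded on the product of
  \<open>K\<close> with the unit sphere, which is compact.\<close>

lemma uniform_pos_def_bounds:
  fixes H :: "complex^'n::finite \<Rightarrow> complex^'n^'n"
  assumes K: "compact K" and H: "continuous_on K H" and pos: "\<And>x. x \<in> K \<Longrightarrow> pos_def_hermitian (H x)"
  obtains c C where "c > 0" "C > 0" "\<And>x v. x \<in> K \<Longrightarrow> c * (norm v)\<^sup>2 \<le> Re (sesq (H x) v v)"
    "\<And>x v. x \<in> K \<Longrightarrow> Re (sesq (H x) v v) \<le> C * (norm v)\<^sup>2"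
proof (cases "K = {}")
  case True
  then show ?thesis using that[of 1 1] by simp
next
  case False
  define P where "P = K \<times> sphere (0 :: complex^'n) 1"
  define q where "q p = Re (sesq (H (fst p)) (snd p) (snd p))" for p
  have "axis undefined 1 \<in> sphere (0 :: complex^'n) 1" by simp
  then have ne: "P \<noteq> {}" using False by (auto simp: P_def)
  have cP: "compact P" unfolding P_def by (intro compact_Times K compact_sphere)
  have cq: "continuous_on P q" unfolding q_def P_def
    by (intro continuous_intros continuous_on_compose2[OF H continuous_on_fst] continuous_on_id) auto
  obtain p where p: "p \<in> P" "\<And>p'. p' \<in> P \<Longrightarrow> q p \<le> q p'"
    using continuous_attains_inf[OF cP ne cq] by blast
  obtain p2 where p2: "p2 \<in> P" "\<And>p'. p' \<in> P \<Longrightarrow> q p' \<le> q p2"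
    using continuous_attains_sup[OF cP ne cq] by blast
  have "snd p \<noteq> 0" using p(1) by (auto simp: P_def)
  then have pos1: "q p > 0" using pos[of "fst p"] p(1) by (auto simp: P_def q_def pos_def_hermitian_def)
  have scale: "Re (sesq (H x) v v) = (norm v)\<^sup>2 * q (x, (1 / norm v) *\<^sub>R v)" "(x, (1 / norm v) *\<^sub>R v) \<in> P"
    if "x \<in> K" "v \<noteq> 0" for x v
    using that by (simp_all add: q_def P_def sesq_simps power2_eq_square)
  have b: "q p * (norm v)\<^sup>2 \<le> Re (sesq (H x) v v) \<and> Re (sesq (H x) v v) \<le> q p2 * (norm v)\<^sup>2" if "x \<in> K" for x v
  proof (cases "v = 0")
    case False
    have "q p \<le> q (x, (1 / norm v) *\<^sub>R v)" "q (x, (1 / norm v) *\<^sub>R v) \<le> q p2"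
      using p(2)[OF scale(2)[OF that False]] p2(2)[OF scale(2)[OF that False]] by blast+
    then have "q p * (norm v)\<^sup>2 \<le> q (x, (1 / norm v) *\<^sub>R v) * (norm v)\<^sup>2"
      "q (x, (1 / norm v) *\<^sub>R v) * (norm v)\<^sup>2 \<le> q p2 * (norm v)\<^sup>2"
      by (simp_all add: mult_right_mono)
    then show ?thesis
      unfolding scale(1)[OF that False] mult.commute[of "(norm v)\<^sup>2"] by blast
  qed (simp_all add: sesq_simps)
  have "q p2 > 0" using pos1 p(2)[OF p2(1)] by simp
  with pos1 b that show ?thesis by blast
qed

section \<open>Uniqueness of the solution in a chart\<close>

text \<open>In a frame orthonormal for the second deformed metric, the second derivatives of the
  difference along \<open>e i\<close> and \<open>\<i> *s e i\<close> sum to 4 times the trace of the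
  difference of the deformed metrics, nonnegative by \<open>equal_top_power_imp_trace_ge\<close>.
  The maximum principle lets the frame be chosen separately at each point, with uniform ellipticity
  on compact sets.\<close>

lemma local_uniqueness:
  fixes f1 f2 :: "complex^'n::finite \<Rightarrow> real" and G :: "complex^'n \<Rightarrow> complex^'n^'n"
  assumes S: "open S" and f1: "Ck_on 2 S f1" and f2: "Ck_on 2 S f2"
    and G: "continuous_on S G" "\<And>x. x \<in> S \<Longrightarrow> hermitian (G x)"
    and pos: "\<And>x. x \<in> S \<Longrightarrow> positive_form (\<lambda>v. assoc_form (G x) v + i_ddbar f1 x v)"
      "\<And>x. x \<in> S \<Longrightarrow> positive_form (\<lambda>v. assoc_form (G x) v + i_ddbar f2 x v)"
    and eq: "\<And>x v. x \<in> S \<Longrightarrow> wedge_pow CARD('n) (\<lambda>v. assoc_form (G x) v + i_ddbar f1 x v) v =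
      wedge_pow CARD('n) (\<lambda>v. assoc_form (G x) v + i_ddbar f2 x v) v"
    and x0: "x0 \<in> S" and max: "\<And>x. x \<in> S \<Longrightarrow> f1 x - f2 x \<le> f1 x0 - f2 x0"
  shows "\<exists>r>0. \<forall>x\<in>ball x0 r. f1 x - f2 x = f1 x0 - f2 x0"
proof -
  define u where "u x = f1 x - f2 x" for x
  define H1 where "H1 x = G x + levi f1 x" for x
  define H2 where "H2 x = G x + levi f2 x" for x
  have herm: "hermitian (H1 x)" "hermitian (H2 x)" if "x \<in> S" for x
    unfolding H1_def H2_def
    by (intro hermitian_add G(2) that levi_hermitian[OF S f1] levi_hermitian[OF S f2])+
  have form: "(\<lambda>v. assoc_form (G x) v + i_ddbar f1 x v) = assoc_form (H1 x)"
    "(\<lambda>v. assoc_form (G x) v + i_ddbar f2 x v) = assoc_form (H2 x)" if "x \<in> S" for x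
    by (simp_all add: fun_eq_iff i_ddbar_eq_assoc_form[OF S f1 that] i_ddbar_eq_assoc_form[OF S f2 that]
        assoc_form_add H1_def H2_def)
  have pd: "pos_def_hermitian (H1 x)" "pos_def_hermitian (H2 x)" if "x \<in> S" for x
    using pos[OF that] herm[OF that] by (auto simp: form[OF that] intro: positive_assoc_form_imp_pos_def)
  have u: "Ck_on 2 S u"
    using Ck_on_add[OF S f1 Ck_on_bilinear[OF bounded_bilinear_mult S Ck_on_const[of 2 S "-1"] f2]]
    by (rule Ck_on_cong[OF S]) (simp add: u_def)
  have uD: "dir_deriv v (dir_deriv v u) x = dir_deriv v (dir_deriv v f1) x - dir_deriv v (dir_deriv v f2) x"
    if x: "x \<in> S" for v x
  proof -
    have "dir_deriv v u y = dir_deriv v f1 y - dir_deriv v f2 y" if "y \<in> S" for y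
      unfolding u_def by (rule dir_deriv_diff[OF Ck2_differentiable(1)[OF f1 that] Ck2_differentiable(1)[OF f2 that]])
    then have "dir_deriv v (dir_deriv v u) x = dir_deriv v (\<lambda>y. dir_deriv v f1 y - dir_deriv v f2 y) x"
      by (rule dir_deriv_cong_open[OF S x])
    also have "\<dots> = dir_deriv v (dir_deriv v f1) x - dir_deriv v (dir_deriv v f2) x"
      by (rule dir_deriv_diff[OF Ck2_differentiable(2)[OF f1 x] Ck2_differentiable(2)[OF f2 x]])
    finally show ?thesis .
  qed
  obtain R where R: "R > 0" "ball x0 R \<subseteq> S" using S x0 open_contains_ball by blast
  have "u x = u x0" if "x \<in> ball x0 (R / 4)" for x
  proof (rule strong_maximum_principle_local[where 'i = "'n \<times> bool" and u=u and R=R])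
    show "Ck_on 2 (ball x0 R) u"
      by (rule Ck_on_subset[OF u R(2)])
    show "u y \<le> u x0" if "y \<in> ball x0 R" for y using max[of y] that R(2) by (auto simp: u_def)
    show "x \<in> ball x0 (R / 4)" by fact
    fix K assume K: "compact K" "K \<subseteq> ball x0 R"
    then have KS: "K \<subseteq> S" using R(2) by blast
    have "continuous_on K H2" unfolding H2_def
      by (intro continuous_on_add continuous_on_subset[OF G(1) KS] continuous_on_subset[OF continuous_on_levi[OF S f2] KS])
    from uniform_pos_def_bounds[OF K(1) this pd(2)] KS
    obtain c C where cC: "c > 0" "C > 0" "\<And>x v. x \<in> K \<Longrightarrow> c * (norm v)\<^sup>2 \<le> Re (sesq (H2 x) v v)"
      "\<And>x v. x \<in> K \<Longrightarrow> Re (sesq (H2 x) v v) \<le> C * (norm v)\<^sup>2" by blast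
    have "\<exists>e :: 'n \<times> bool \<Rightarrow> complex^'n. (\<Sum>i\<in>UNIV. dir_deriv (e i) (dir_deriv (e i) u) x) \<ge> 0 \<and>
        (\<Sum>i\<in>UNIV. (norm (e i))\<^sup>2) \<le> CARD('n) * (2 / c) \<and> (\<forall>\<xi>. 1 / C * (norm \<xi>)\<^sup>2 \<le> (\<Sum>i\<in>UNIV. (\<xi> \<bullet> e i)\<^sup>2))"
      if x: "x \<in> K" for x
    proof -
      have xS: "x \<in> S" using x KS by blast
      obtain e :: "'n \<Rightarrow> complex^'n" where e: "\<And>i j. sesq (H2 x) (e i) (e j) = (if i = j then 1 else 0)"
        "(\<Sum>i\<in>UNIV. Re (sesq (H1 x) (e i) (e i)) - Re (sesq (H2 x) (e i) (e i))) \<ge> 0"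
        using equal_top_power_imp_trace_ge[OF pd[OF xS]] eq[OF xS] unfolding form[OF xS] by metis
      \<comment> \<open>A complex frame serves as a real one once each vector is accompanied by its
        multiple by \<open>\<i>\<close>; hence the index type with a \<open>bool\<close>
        factor.\<close>
      define e' where "e' p = (if snd p then e (fst p) else \<i> *s e (fst p))" for p
      have pair: "(\<Sum>p\<in>UNIV. F (e' p)) = (\<Sum>i\<in>UNIV. F (e i) + F (\<i> *s e i))" for F :: "complex^'n \<Rightarrow> real"
      proof -
        have "(\<Sum>p\<in>UNIV. F (e' p)) = (\<Sum>i\<in>UNIV. \<Sum>b\<in>UNIV. F (e' (i, b)))"
          by (simp add: sum.cartesian_product)
        then show ?thesis by (simp add: e'_def UNIV_bool add.commute)
      qed
      note nb = frame_norm_bounds[OF e(1) cC(3)[OF x] cC(4)[OF x] cC(1)]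
      have "(\<Sum>p\<in>UNIV. dir_deriv (e' p) (dir_deriv (e' p) u) x) =
        (\<Sum>i\<in>UNIV. 4 * (Re (sesq (H1 x) (e i) (e i)) - Re (sesq (H2 x) (e i) (e i))))"
        unfolding uD[OF xS] pair[of "\<lambda>v. dir_deriv v (dir_deriv v f1) x - dir_deriv v (dir_deriv v f2) x"]
        by (rule sum.cong[OF refl]) (simp add: H1_def H2_def sesq_add_matrix
            levi_quadratic[OF S f1 xS] levi_quadratic[OF S f2 xS] algebra_simps add_divide_distrib)
      then have 1: "(\<Sum>p\<in>UNIV. dir_deriv (e' p) (dir_deriv (e' p) u) x) \<ge> 0"
        using e(2) by (simp only: sum_distrib_left[symmetric])
      have "(\<Sum>p\<in>UNIV. (norm (e' p))\<^sup>2) = (\<Sum>i\<in>UNIV. 2 * (norm (e i))\<^sup>2)"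
        unfolding pair[of "\<lambda>v. (norm v)\<^sup>2"] by (simp add: norm_scalar_mult_complex)
      also have "\<dots> \<le> (\<Sum>i\<in>(UNIV::'n set). 2 * (1 / c))" using nb(1) by (intro sum_mono mult_left_mono) auto
      finally have 2: "(\<Sum>p\<in>UNIV. (norm (e' p))\<^sup>2) \<le> CARD('n) * (2 / c)" by simp
      have 3: "1 / C * (norm \<xi>)\<^sup>2 \<le> (\<Sum>p\<in>UNIV. (\<xi> \<bullet> e' p)\<^sup>2)" for \<xi>
        using nb(2)[of \<xi>] unfolding pair[of "\<lambda>v. (\<xi> \<bullet> v)\<^sup>2"] by simp
      show ?thesis using 1 2 3 by blast
    qed
    then show "\<exists>A \<mu>. \<mu> > 0 \<and> (\<forall>x\<in>K. \<exists>e :: 'n \<times> bool \<Rightarrow> complex^'n. (\<Sum>i\<in>UNIV. dir_deriv (e i) (dir_deriv (e i) u) x) \<ge> 0 \<and>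
        (\<Sum>i\<in>UNIV. (norm (e i))\<^sup>2) \<le> A \<and> (\<forall>\<xi>. \<mu> * (norm \<xi>)\<^sup>2 \<le> (\<Sum>i\<in>UNIV. (\<xi> \<bullet> e i)\<^sup>2)))"
      using cC(2) by (intro exI[of _ "CARD('n) * (2 / c)"] exI[of _ "1 / C"]) auto
  qed
  then have "\<forall>x\<in>ball x0 (R / 4). f1 x - f2 x = f1 x0 - f2 x0" unfolding u_def by blast
  moreover have "R / 4 > 0" using R(1) by simp
  ultimately show ?thesis by blast
qed

section \<open>Charts\<close>

lemma complex_manifold_chart:
  assumes "complex_manifold X \<A>" "c \<in> \<A>"
  shows "openin X (chart_dom c)" "open (chart_img c)"
    "homeomorphic_map (subtopology X (chart_dom c)) (top_of_set (chart_img c)) (chart_map c)"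
    "chart_dom c \<subseteq> topspace X"
  using assms openin_subset by (auto simp: complex_manifold_def)

lemma complex_manifold_cover:
  assumes "complex_manifold X \<A>" "p \<in> topspace X"
  obtains c where "c \<in> \<A>" "p \<in> chart_dom c"
proof -
  have "p \<in> (\<Union>c\<in>\<A>. chart_dom c)" using assms by (simp only: complex_manifold_def)
  then show ?thesis using that by blast
qed

lemma chart_map_in_img: "p \<in> chart_dom c \<Longrightarrow> chart_map c p \<in> chart_img c"
  by (simp add: chart_img_def)

lemma chart_inv_in_dom: "x \<in> chart_img c \<Longrightarrow> chart_inv c x \<in> chart_dom c"
  unfolding chart_img_def chart_inv_def by (rule inv_into_into)

lemma chart_map_inv: "x \<in> chart_img c \<Longrightarrow> chart_map c (chart_inv c x) = x"
  unfolding chart_img_def chart_inv_def by (rule f_inv_into_f)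

lemma chart_inv_map:
  assumes "complex_manifold X \<A>" "c \<in> \<A>" "p \<in> chart_dom c"
  shows "chart_inv c (chart_map c p) = p"
proof -
  have "inj_on (chart_map c) (topspace (subtopology X (chart_dom c)))"
    by (rule homeomorphic_imp_injective_map[OF complex_manifold_chart(3)[OF assms(1,2)]])
  moreover have "topspace (subtopology X (chart_dom c)) = chart_dom c"
    using complex_manifold_chart(4)[OF assms(1,2)] by auto
  ultimately show ?thesis unfolding chart_inv_def using assms(3) by (simp add: inv_into_f_f)
qed

lemma open_chart_image:
  assumes "complex_manifold X \<A>" "c \<in> \<A>" "openin X U" "U \<subseteq> chart_dom c"
  shows "open (chart_map c ` U)"
proof -
  have "openin (subtopology X (chart_dom c)) U"
    using assms(3,4) by (auto simp: openin_subtopology)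
  then have "openin (top_of_set (chart_img c)) (chart_map c ` U)"
    using homeomorphic_map_openness_eq[OF complex_manifold_chart(3)[OF assms(1,2)]] by blast
  then show ?thesis
    using complex_manifold_chart(2)[OF assms(1,2)] openin_open_trans by blast
qed

lemma openin_chart_preimage:
  assumes "complex_manifold X \<A>" "c \<in> \<A>" "open V"
  shows "openin X {p \<in> chart_dom c. chart_map c p \<in> V}"
proof -
  have ts: "topspace (subtopology X (chart_dom c)) = chart_dom c"
    using complex_manifold_chart(4)[OF assms(1,2)] by auto
  have "continuous_map (subtopology X (chart_dom c)) (top_of_set (chart_img c)) (chart_map c)"
    by (rule homeomorphic_imp_continuous_map[OF complex_manifold_chart(3)[OF assms(1,2)]])
  then have "continuous_map (subtopology X (chart_dom c)) euclidean (chart_map c)"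
    by (simp add: continuous_map_in_subtopology)
  from openin_continuous_map_preimage[OF this, of V]
  have "openin (subtopology X (chart_dom c)) {p \<in> chart_dom c. chart_map c p \<in> V}"
    using assms(3) unfolding ts by simp
  then show ?thesis
    using complex_manifold_chart(1)[OF assms(1,2)] openin_trans_full by blast
qed

lemma in_chart_map:
  "complex_manifold X \<A> \<Longrightarrow> c \<in> \<A> \<Longrightarrow> p \<in> chart_dom c \<Longrightarrow> in_chart c f (chart_map c p) = f p"
  by (simp add: in_chart_def chart_inv_map)

lemma smooth_function_continuous_map:
  assumes M: "complex_manifold X \<A>" and f: "smooth_function \<A> f"
  shows "continuous_map X euclideanreal f"
  unfolding continuous_map_def
proof (intro conjI allI impI)
  fix V :: "real set" assume "openin euclideanreal V"
  then have V: "open V" by simp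
  show "openin X {p \<in> topspace X. f p \<in> V}"
  proof (subst openin_subopen, rule ballI)
    fix p assume p: "p \<in> {p \<in> topspace X. f p \<in> V}"
    then obtain c where c: "c \<in> \<A>" "p \<in> chart_dom c" using complex_manifold_cover[OF M] by blast
    define W where "W = {x \<in> chart_img c. in_chart c f x \<in> V}"
    have "continuous_on (chart_img c) (in_chart c f)"
      using f c(1) smooth_on_imp_continuous_on by (auto simp: smooth_function_def)
    then have "open W" unfolding W_def
      using continuous_open_preimage[OF _ complex_manifold_chart(2)[OF M c(1)] V]
      by (simp add: vimage_def Int_def)
    then have 1: "openin X {q \<in> chart_dom c. chart_map c q \<in> W}"
      by (rule openin_chart_preimage[OF M c(1)])
    have 2: "p \<in> {q \<in> chart_dom c. chart_map c q \<in> W}"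
      using p c in_chart_map[OF M c, of f] by (simp add: W_def chart_map_in_img)
    have 3: "{q \<in> chart_dom c. chart_map c q \<in> W} \<subseteq> {p \<in> topspace X. f p \<in> V}"
      using in_chart_map[OF M c(1), of _ f] complex_manifold_chart(4)[OF M c(1)]
      by (auto simp: W_def)
    show "\<exists>T. openin X T \<and> p \<in> T \<and> T \<subseteq> {p \<in> topspace X. f p \<in> V}" using 1 2 3 by blast
  qed
qed simp

section \<open>Uniqueness of the solution\<close>

text \<open>The set where the difference attains its maximum is closed, and open by
  \<open>local_uniqueness\<close> in a chart around each of its points; connectedness makes it the
  whole space.\<close>

lemma monge_ampere_unique_up_to_const:
  fixes g :: "('a, 'n::finite) metric"
  assumes M: "complex_manifold X \<A>" and comp: "compact_space X" and conn: "connected_space X"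
    and g: "hermitian_metric \<A> g"
    and \<phi>: "smooth_function \<A> \<phi>" "monge_ampere \<A> g F \<phi>" "deformed_positive \<A> g \<phi>"
    and \<psi>: "smooth_function \<A> \<psi>" "monge_ampere \<A> g F \<psi>" "deformed_positive \<A> g \<psi>"
  shows "\<exists>C. \<forall>p\<in>topspace X. \<phi> p = \<psi> p + C"
proof (cases "topspace X = {}")
  case True
  then show ?thesis by simp
next
  case False
  define u where "u p = \<phi> p - \<psi> p" for p
  have cu: "continuous_map X euclideanreal u" unfolding u_def
    by (intro continuous_map_diff smooth_function_continuous_map[OF M] \<phi>(1) \<psi>(1))
  have "compactin X (topspace X)" using comp by (simp add: compact_space_def)
  from image_compactin[OF this cu] have "compact (u ` topspace X)" by simp
  then obtain m where m: "m \<in> topspace X" "\<And>p. p \<in> topspace X \<Longrightarrow> u p \<le> u m"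
    using compact_attains_sup[of "u ` topspace X"] False by auto
  define T where "T = {p \<in> topspace X. u p = u m}"
  have "closedin X T"
    unfolding T_def using closedin_continuous_map_preimage[OF cu, of "{u m}"] by simp
  moreover have "openin X T"
  proof (subst openin_subopen, rule ballI)
    fix p assume "p \<in> T"
    then have p: "p \<in> topspace X" "u p = u m" by (auto simp: T_def)
    then obtain c where c: "c \<in> \<A>" "p \<in> chart_dom c" using complex_manifold_cover[OF M] by blast
    define x0 where "x0 = chart_map c p"
    have x0: "x0 \<in> chart_img c" using c(2) by (simp add: x0_def chart_map_in_img)
    have uc: "in_chart c \<phi> x - in_chart c \<psi> x = u (chart_inv c x)" for x
      by (simp add: in_chart_def u_def)
    have "\<exists>r>0. \<forall>x\<in>ball x0 r. in_chart c \<phi> x - in_chart c \<psi> x = in_chart c \<phi> x0 - in_chart c \<psi> x0"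
    proof (rule local_uniqueness[where G="g c"])
      show "open (chart_img c)" by (rule complex_manifold_chart(2)[OF M c(1)])
      show "Ck_on 2 (chart_img c) (in_chart c \<phi>)" "Ck_on 2 (chart_img c) (in_chart c \<psi>)"
        using \<phi>(1) \<psi>(1) c(1) by (auto simp: smooth_function_def intro: smooth_on_imp_Ck2)
      show "continuous_on (chart_img c) (g c)"
        using g c(1) smooth_on_imp_continuous_on by (auto simp: hermitian_metric_def)
      show "hermitian (g c x)" if "x \<in> chart_img c" for x
        using g c(1) that pos_def_hermitian_imp_hermitian by (auto simp: hermitian_metric_def)
      show "positive_form (\<lambda>v. assoc_form (g c x) v + i_ddbar (in_chart c \<phi>) x v)" if "x \<in> chart_img c" for x
        using \<phi>(3) c(1) that by (auto simp: deformed_positive_def deformed_form_def[abs_def])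
      show "positive_form (\<lambda>v. assoc_form (g c x) v + i_ddbar (in_chart c \<psi>) x v)" if "x \<in> chart_img c" for x
        using \<psi>(3) c(1) that by (auto simp: deformed_positive_def deformed_form_def[abs_def])
      show "wedge_pow CARD('n) (\<lambda>v. assoc_form (g c x) v + i_ddbar (in_chart c \<phi>) x v) v =
        wedge_pow CARD('n) (\<lambda>v. assoc_form (g c x) v + i_ddbar (in_chart c \<psi>) x v) v" if "x \<in> chart_img c" for x v
        using \<phi>(2) \<psi>(2) c(1) that by (simp add: monge_ampere_def deformed_form_def[abs_def])
      show "x0 \<in> chart_img c" by (rule x0)
      show "in_chart c \<phi> x - in_chart c \<psi> x \<le> in_chart c \<phi> x0 - in_chart c \<psi> x0" if "x \<in> chart_img c" for x
      proof -
        have "chart_inv c x \<in> topspace X"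
          using chart_inv_in_dom[OF that] complex_manifold_chart(4)[OF M c(1)] by blast
        then show ?thesis unfolding uc using m(2) p(2) chart_inv_map[OF M c] by (simp add: x0_def)
      qed
    qed
    then obtain r where r: "r > 0" "\<And>x. x \<in> ball x0 r \<Longrightarrow> u (chart_inv c x) = u m"
      unfolding uc using p(2) chart_inv_map[OF M c] by (auto simp: x0_def)
    have 1: "openin X {q \<in> chart_dom c. chart_map c q \<in> ball x0 r}"
      by (rule openin_chart_preimage[OF M c(1) open_ball])
    have 2: "p \<in> {q \<in> chart_dom c. chart_map c q \<in> ball x0 r}" using c(2) r(1) by (simp add: x0_def)
    have 3: "{q \<in> chart_dom c. chart_map c q \<in> ball x0 r} \<subseteq> T"
    proof
      fix q assume q: "q \<in> {q \<in> chart_dom c. chart_map c q \<in> ball x0 r}"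
      then have "u q = u m" using r(2)[of "chart_map c q"] chart_inv_map[OF M c(1), of q] by simp
      then show "q \<in> T" using q complex_manifold_chart(4)[OF M c(1)] by (auto simp: T_def)
    qed
    show "\<exists>U. openin X U \<and> p \<in> U \<and> U \<subseteq> T" using 1 2 3 by blast
  qed
  ultimately have "T = {} \<or> T = topspace X" using conn connected_space_clopen_in by blast
  then have "T = topspace X" using m(1) by (auto simp: T_def)
  have "\<phi> p = \<psi> p + u m" if "p \<in> topspace X" for p
  proof -
    have "p \<in> T" using that \<open>T = topspace X\<close> by blast
    then show ?thesis by (simp add: T_def u_def)
  qed
  then show ?thesis by blast
qed

text \<open>Equal suprema leave no room for an additive constant; compactness bounds the functions,
  so that \<open>SUP\<close> on the reals is a true supremum.\<close>

lemma monge_ampere_unique: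
  fixes g :: "('a, 'n::finite) metric"
  assumes M: "complex_manifold X \<A>" and comp: "compact_space X" and conn: "connected_space X"
    and g: "hermitian_metric \<A> g"
    and \<phi>: "smooth_function \<A> \<phi>" "monge_ampere \<A> g F \<phi>" "deformed_positive \<A> g \<phi>" "(SUP p\<in>topspace X. \<phi> p) = 0"
    and \<psi>: "smooth_function \<A> \<psi>" "monge_ampere \<A> g F \<psi>" "deformed_positive \<A> g \<psi>" "(SUP p\<in>topspace X. \<psi> p) = 0"
    and p: "p \<in> topspace X"
  shows "\<phi> p = \<psi> p"
proof -
  obtain C where C: "\<And>p. p \<in> topspace X \<Longrightarrow> \<phi> p = \<psi> p + C"
    using monge_ampere_unique_up_to_const[OF M comp conn g \<phi>(1-3) \<psi>(1-3)] by blast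
  have bdd: "bdd_above (f ` topspace X)" if "smooth_function \<A> f" for f
  proof -
    have "compactin X (topspace X)" using comp by (simp add: compact_space_def)
    from image_compactin[OF this smooth_function_continuous_map[OF M that]]
    have "compact (f ` topspace X)" by simp
    then show ?thesis by (intro bounded_imp_bdd_above compact_imp_bounded)
  qed
  have ne: "topspace X \<noteq> {}" using p by blast
  have "(SUP p\<in>topspace X. \<phi> p) \<le> (SUP p\<in>topspace X. \<psi> p) + C"
    by (rule cSUP_least[OF ne]) (simp add: C cSUP_upper[OF _ bdd[OF \<psi>(1)]])
  moreover have "(SUP p\<in>topspace X. \<psi> p) \<le> (SUP p\<in>topspace X. \<phi> p) - C"
  proof (rule cSUP_least[OF ne])
    fix q assume q: "q \<in> topspace X"
    have "\<phi> q \<le> (SUP p\<in>topspace X. \<phi> p)" by (rule cSUP_upper[OF q bdd[OF \<phi>(1)]])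
    then show "\<psi> q \<le> (SUP p\<in>topspace X. \<phi> p) - C" using C[OF q] by simp
  qed
  ultimately show ?thesis using C[OF p] \<phi>(4) \<psi>(4) by simp
qed

section \<open>Multilinear forms\<close>

text \<open>\<open>cov_deriv\<close> takes whole sequences of vectors; the first conjunct lets them
  stand for \<open>j\<close>-tuples.\<close>

definition multilinear_form :: "nat \<Rightarrow> ((nat \<Rightarrow> 'v::real_vector) \<Rightarrow> real) \<Rightarrow> bool"
  where "multilinear_form j T \<longleftrightarrow>
    (\<forall>w w'. (\<forall>i<j. w i = w' i) \<longrightarrow> T w = T w') \<and> (\<forall>i<j. \<forall>w. linear (\<lambda>z. T (w(i := z))))"

lemma multilinear_form_cong: "multilinear_form j T \<Longrightarrow> (\<And>i. i < j \<Longrightarrow> w i = w' i) \<Longrightarrow> T w = T w'"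
  unfolding multilinear_form_def by blast

lemma multilinear_form_linear: "multilinear_form j T \<Longrightarrow> i < j \<Longrightarrow> linear (\<lambda>z. T (w(i := z)))"
  unfolding multilinear_form_def by blast

lemma multilinear_form_expand:
  fixes T :: "(nat \<Rightarrow> 'v::euclidean_space) \<Rightarrow> real"
  assumes T: "multilinear_form j T" and i: "i < j"
  shows "T (w(i := z)) = (\<Sum>b\<in>Basis. (z \<bullet> b) * T (w(i := b)))"
proof -
  note lin = multilinear_form_linear[OF T i, of w]
  have "T (w(i := (\<Sum>b\<in>Basis. (z \<bullet> b) *\<^sub>R b))) = (\<Sum>b\<in>Basis. T (w(i := (z \<bullet> b) *\<^sub>R b)))"
    by (rule linear_sum[OF lin])
  also have "\<dots> = (\<Sum>b\<in>Basis. (z \<bullet> b) * T (w(i := b)))"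
    by (rule sum.cong[OF refl]) (simp only: linear_scale[OF lin] real_scaleR_def)
  finally show ?thesis by (simp add: euclidean_representation)
qed

lemma multilinear_form_bound:
  fixes T :: "(nat \<Rightarrow> 'v::euclidean_space) \<Rightarrow> real" and B M :: real
  assumes T: "multilinear_form j T" and B: "B \<ge> 0"
    and M: "\<And>w. (\<And>i. i < j \<Longrightarrow> w i \<in> Basis) \<Longrightarrow> \<bar>T w\<bar> \<le> M"
    and w: "\<And>i. i < j \<Longrightarrow> norm (w i) \<le> B"
  shows "\<bar>T w\<bar> \<le> M * (real DIM('v) * B) ^ j"
proof -
  \<comment> \<open>The slots from \<open>m\<close> on already hold basis vectors; expanding one
    more slot costs a factor of the dimension times \<open>B\<close>.\<close>
  have "\<bar>T w\<bar> \<le> M * (real DIM('v) * B) ^ m"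
    if "m \<le> j" "\<And>i. i < m \<Longrightarrow> norm (w i) \<le> B" "\<And>i. m \<le> i \<Longrightarrow> i < j \<Longrightarrow> w i \<in> Basis" for m w
    using that
  proof (induction m arbitrary: w)
    case 0
    then show ?case using M by simp
  next
    case (Suc m)
    have "T w = T (w(m := w m))" by simp
    also have "\<dots> = (\<Sum>b\<in>Basis. (w m \<bullet> b) * T (w(m := b)))"
      using Suc.prems by (intro multilinear_form_expand[OF T]) simp
    finally have "\<bar>T w\<bar> \<le> (\<Sum>b\<in>Basis. \<bar>(w m \<bullet> b) * T (w(m := b))\<bar>)"
      by (simp add: sum_abs)
    also have "\<dots> \<le> (\<Sum>b\<in>(Basis :: 'v set). B * (M * (real DIM('v) * B) ^ m))"
    proof (rule sum_mono)
      fix b :: 'v assume b: "b \<in> Basis"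
      have "\<bar>w m \<bullet> b\<bar> \<le> B"
        using Basis_le_norm[OF b, of "w m"] Suc.prems(2)[of m] by simp
      moreover have "\<bar>T (w(m := b))\<bar> \<le> M * (real DIM('v) * B) ^ m"
        using Suc.prems b by (intro Suc.IH) auto
      ultimately show "\<bar>(w m \<bullet> b) * T (w(m := b))\<bar> \<le> B * (M * (real DIM('v) * B) ^ m)"
        using B by (simp add: abs_mult mult_mono)
    qed
    also have "\<dots> = M * (real DIM('v) * B) ^ Suc m" by simp
    finally show ?case .
  qed
  from this[of j w] w show ?thesis by simp
qed

text \<open>The Leibniz rule when both the form and its arguments vary. The slots below
  \<open>m\<close> move and the others are frozen at \<open>c\<close>; in the induction, slot
  \<open>m\<close> is expanded in the basis, so that the form itself is only ever differentiated at
  fixed arguments.\<close>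

lemma multilinear_form_has_derivative_partial:
  fixes a :: "'u::real_normed_vector \<Rightarrow> (nat \<Rightarrow> 'v::euclidean_space) \<Rightarrow> real"
  assumes U: "open U" "x \<in> U" and a: "\<And>y. y \<in> U \<Longrightarrow> multilinear_form j (a y)"
    and L: "\<And>w. ((\<lambda>y. a y w) has_derivative L w) (at x)" and Lm: "\<And>h. multilinear_form j (\<lambda>w. L w h)"
    and W: "\<And>i. i < j \<Longrightarrow> (W i has_derivative W' i) (at x)" and m: "m \<le> j"
  shows "((\<lambda>y. a y (\<lambda>i. if i < m then W i y else c i)) has_derivative
    (\<lambda>h. L (\<lambda>i. if i < m then W i x else c i) h +
      (\<Sum>i<m. a x ((\<lambda>i. if i < m then W i x else c i)(i := W' i h))))) (at x)"
  using m
proof (induction m arbitrary: c)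
  case 0
  then show ?case using L[of c] by simp
next
  case (Suc m)
  then have mj: "m < j" by simp
  define w where "w b y = (\<lambda>i. if i < m then W i y else (c(m := b)) i)" for b y
  have weq: "(\<lambda>i. if i < Suc m then W i y else c i) = w (W m y) y" for y
    by (auto simp: w_def fun_eq_iff less_Suc_eq)
  have wm: "(w b y)(m := b') = w b' y" for b b' y by (auto simp: w_def fun_eq_iff)
  have exp: "a y (\<lambda>i. if i < Suc m then W i y else c i) = (\<Sum>b\<in>Basis. (W m y \<bullet> b) * a y (w b y))" if "y \<in> U" for y
    unfolding weq by (rule multilinear_form_expand[OF a[OF that] mj, of "w 0 y", unfolded wm])
  have D: "((\<lambda>y. \<Sum>b\<in>Basis. (W m y \<bullet> b) * a y (w b y)) has_derivative
     (\<lambda>h. \<Sum>b\<in>Basis. (W m x \<bullet> b) * (L (w b x) h + (\<Sum>i<m. a x ((w b x)(i := W' i h)))) + (W' m h \<bullet> b) * a x (w b x))) (at x)"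
  proof (rule has_derivative_sum)
    fix b :: 'v
    have d1: "((\<lambda>y. W m y \<bullet> b) has_derivative (\<lambda>h. W' m h \<bullet> b)) (at x)"
      by (rule bounded_linear.has_derivative[OF bounded_linear_inner_left W[OF mj]])
    have d2: "((\<lambda>y. a y (w b y)) has_derivative
        (\<lambda>h. L (w b x) h + (\<Sum>i<m. a x ((w b x)(i := W' i h))))) (at x)"
      unfolding w_def by (rule Suc.IH[OF less_imp_le[OF mj]])
    show "((\<lambda>y. (W m y \<bullet> b) * a y (w b y)) has_derivative
        (\<lambda>h. (W m x \<bullet> b) * (L (w b x) h + (\<Sum>i<m. a x ((w b x)(i := W' i h)))) + (W' m h \<bullet> b) * a x (w b x))) (at x)"
      by (rule has_derivative_mult[OF d1 d2])
  qed
  \<comment> \<open>Multilinearity reassembles the basis sums into the derivative of the form, those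
    of the earlier slots and that of slot \<open>m\<close>.\<close>
  have E: "(\<Sum>b\<in>Basis. (W m x \<bullet> b) * (L (w b x) h + (\<Sum>i<m. a x ((w b x)(i := W' i h)))) + (W' m h \<bullet> b) * a x (w b x)) =
      L (\<lambda>i. if i < Suc m then W i x else c i) h +
      (\<Sum>i<Suc m. a x ((\<lambda>i. if i < Suc m then W i x else c i)(i := W' i h)))" for h
  proof -
    have 1: "(\<Sum>b\<in>Basis. (W m x \<bullet> b) * L (w b x) h) = L (\<lambda>i. if i < Suc m then W i x else c i) h"
      unfolding weq by (rule multilinear_form_expand[OF Lm mj, of "w 0 x", unfolded wm, symmetric])
    have 2: "(\<Sum>b\<in>Basis. (W m x \<bullet> b) * a x ((w b x)(i := W' i h))) =
      a x ((\<lambda>i. if i < Suc m then W i x else c i)(i := W' i h))" if "i < m" for i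
    proof -
      have sw: "(w b x)(i := W' i h) = ((w 0 x)(i := W' i h))(m := b)" for b
        using that by (auto simp: w_def fun_eq_iff)
      have "(\<Sum>b\<in>Basis. (W m x \<bullet> b) * a x ((w b x)(i := W' i h))) =
          (\<Sum>b\<in>Basis. (W m x \<bullet> b) * a x (((w 0 x)(i := W' i h))(m := b)))"
        by (rule sum.cong[OF refl]) (rule arg_cong[OF sw])
      also have "\<dots> = a x (((w 0 x)(i := W' i h))(m := W m x))"
        by (rule multilinear_form_expand[OF a[OF U(2)] mj, symmetric])
      also have "\<dots> = a x ((w (W m x) x)(i := W' i h))"
        by (rule arg_cong[OF sw[symmetric]])
      finally show ?thesis unfolding weq .
    qed
    have 3: "(\<Sum>b\<in>Basis. (W' m h \<bullet> b) * a x (w b x)) =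
      a x ((\<lambda>i. if i < Suc m then W i x else c i)(m := W' m h))"
      unfolding weq wm by (rule multilinear_form_expand[OF a[OF U(2)] mj, of "w 0 x", unfolded wm, symmetric])
    have "(\<Sum>b\<in>Basis. (W m x \<bullet> b) * (L (w b x) h + (\<Sum>i<m. a x ((w b x)(i := W' i h)))) + (W' m h \<bullet> b) * a x (w b x)) =
      (\<Sum>b\<in>Basis. (W m x \<bullet> b) * L (w b x) h) + (\<Sum>i<m. \<Sum>b\<in>Basis. (W m x \<bullet> b) * a x ((w b x)(i := W' i h))) +
      (\<Sum>b\<in>Basis. (W' m h \<bullet> b) * a x (w b x))"
      unfolding sum.distrib distrib_left sum_distrib_left by (subst sum.swap) simp
    also have "(\<Sum>i<m. \<Sum>b\<in>Basis. (W m x \<bullet> b) * a x ((w b x)(i := W' i h))) =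
       (\<Sum>i<m. a x ((\<lambda>i. if i < Suc m then W i x else c i)(i := W' i h)))"
      by (rule sum.cong[OF refl]) (simp add: 2)
    finally show ?thesis unfolding 1 3 sum.lessThan_Suc add.assoc .
  qed
  show ?case
    by (rule has_derivative_transform_within_open[OF D[unfolded E] U]) (simp only: exp)
qed

lemma multilinear_form_has_derivative:
  fixes a :: "'u::real_normed_vector \<Rightarrow> (nat \<Rightarrow> 'v::euclidean_space) \<Rightarrow> real"
  assumes U: "open U" "x \<in> U" and a: "\<And>y. y \<in> U \<Longrightarrow> multilinear_form j (a y)"
    and L: "\<And>w. ((\<lambda>y. a y w) has_derivative L w) (at x)" and Lm: "\<And>h. multilinear_form j (\<lambda>w. L w h)"
    and W: "\<And>i. i < j \<Longrightarrow> (W i has_derivative W' i) (at x)"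
  shows "((\<lambda>y. a y (\<lambda>i. W i y)) has_derivative
    (\<lambda>h. L (\<lambda>i. W i x) h + (\<Sum>i<j. a x ((\<lambda>i. W i x)(i := W' i h))))) (at x)"
proof -
  define w where "w y = (\<lambda>i. if i < j then W i y else 0)" for y
  have "((\<lambda>y. a y (w y)) has_derivative (\<lambda>h. L (w x) h + (\<Sum>i<j. a x ((w x)(i := W' i h))))) (at x)"
    unfolding w_def by (rule multilinear_form_has_derivative_partial[OF U a L Lm W order_refl])
  moreover have "L (w x) h = L (\<lambda>i. W i x) h" for h
    by (rule multilinear_form_cong[OF Lm]) (simp add: w_def)
  moreover have "a x ((w x)(i := z)) = a x ((\<lambda>i. W i x)(i := z))" for i z
    by (rule multilinear_form_cong[OF a[OF U(2)]]) (simp add: w_def)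
  ultimately have "((\<lambda>y. a y (w y)) has_derivative
    (\<lambda>h. L (\<lambda>i. W i x) h + (\<Sum>i<j. a x ((\<lambda>i. W i x)(i := W' i h))))) (at x)" by simp
  then show ?thesis
  proof (rule has_derivative_transform_within_open[OF _ U])
    show "a y (w y) = a y (\<lambda>i. W i y)" if "y \<in> U" for y
      by (rule multilinear_form_cong[OF a[OF that]]) (simp add: w_def)
  qed
qed

lemma dir_deriv_multilinear_form:
  fixes a :: "'u::real_normed_vector \<Rightarrow> (nat \<Rightarrow> 'v::real_vector) \<Rightarrow> real"
  assumes U: "open U" "x \<in> U" and a: "\<And>y. y \<in> U \<Longrightarrow> multilinear_form j (a y)"
    and d: "\<And>w. (\<lambda>y. a y w) differentiable at x"
  shows "multilinear_form j (\<lambda>w. dir_deriv h (\<lambda>y. a y w) x)"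
  unfolding multilinear_form_def
proof (intro conjI allI impI)
  fix w w' :: "nat \<Rightarrow> 'v" assume "\<forall>i<j. w i = w' i"
  then show "dir_deriv h (\<lambda>y. a y w) x = dir_deriv h (\<lambda>y. a y w') x"
    by (intro dir_deriv_cong_open[OF U] multilinear_form_cong[OF a]) auto
next
  fix i and w :: "nat \<Rightarrow> 'v" assume i: "i < j"
  show "linear (\<lambda>z. dir_deriv h (\<lambda>y. a y (w(i := z))) x)"
  proof (rule linearI)
    fix z z'
    have "dir_deriv h (\<lambda>y. a y (w(i := z + z'))) x = dir_deriv h (\<lambda>y. a y (w(i := z)) + a y (w(i := z'))) x"
      by (rule dir_deriv_cong_open[OF U]) (rule linear_add[OF multilinear_form_linear[OF a i]])
    then show "dir_deriv h (\<lambda>y. a y (w(i := z + z'))) x = dir_deriv h (\<lambda>y. a y (w(i := z))) x + dir_deriv h (\<lambda>y. a y (w(i := z'))) x"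
      by (simp add: dir_deriv_add d)
  next
    fix r z
    have "dir_deriv h (\<lambda>y. a y (w(i := r *\<^sub>R z))) x = dir_deriv h (\<lambda>y. r * a y (w(i := z))) x"
      by (rule dir_deriv_cong_open[OF U]) (simp add: linear_scale[OF multilinear_form_linear[OF a i]])
    then show "dir_deriv h (\<lambda>y. a y (w(i := r *\<^sub>R z))) x = r *\<^sub>R dir_deriv h (\<lambda>y. a y (w(i := z))) x"
      by (simp add: dir_deriv_mult_const d)
  qed
qed

section \<open>Covariant derivatives in a chart\<close>

lemma smooth_on_vec:
  fixes f :: "'a::real_normed_vector \<Rightarrow> complex^'m::finite"
  shows "open S \<Longrightarrow> (\<And>i. smooth_on S (\<lambda>x. f x $ i)) \<Longrightarrow> smooth_on S f"
  by (simp add: smooth_on_def Ck_on_vec)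

lemma smooth_on_det:
  fixes A :: "'a::real_normed_vector \<Rightarrow> complex^'m^'m::finite"
  assumes "open S" "\<And>i j. smooth_on S (\<lambda>x. A x $ i $ j)"
  shows "smooth_on S (\<lambda>x. det (A x))"
  unfolding det_def using assms
  by (intro smooth_on_sum smooth_on_mult smooth_on_prod smooth_on_const) auto

lemma bounded_linear_sesq_matrix: "bounded_linear (\<lambda>k :: complex^'n^'n::finite. sesq k a b)"
proof -
  have "linear (\<lambda>k. sesq k a b)"
    by (rule linearI) (simp_all add: sesq_add_matrix sesq_scaleR_matrix)
  then show ?thesis by (simp add: linear_conv_bounded_linear)
qed

lemma bounded_linear_Re_sesq_matrix: "bounded_linear (\<lambda>k :: complex^'n^'n::finite. Re (sesq k a b))"
  by (rule bounded_linear_compose[OF bounded_linear_Re bounded_linear_sesq_matrix])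

locale hermitian_chart =
  fixes S :: "(complex^'n::finite) set" and h :: "complex^'n \<Rightarrow> complex^'n^'n"
  assumes open_S: "open S" and smooth_h: "smooth_on S h"
    and pos_h: "\<And>x. x \<in> S \<Longrightarrow> pos_def_hermitian (h x)"
begin

text \<open>The right-hand side of the Koszul formula; the 2 in \<open>riem\<close> cancels the
  division by 2.\<close>

definition koszul :: "complex^'n \<Rightarrow> complex^'n \<Rightarrow> complex^'n \<Rightarrow> complex^'n \<Rightarrow> real"
  where "koszul x v w u = Re (sesq (dir_deriv v h x) w u) + Re (sesq (dir_deriv w h x) v u)
    - Re (sesq (dir_deriv u h x) v w)"

lemma h_differentiable: "x \<in> S \<Longrightarrow> h differentiable at x"
  using smooth_h by (rule smooth_on_imp_differentiable)

lemma linear_dir_deriv_h: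
  assumes "x \<in> S"
  shows "dir_deriv (v + v') h x = dir_deriv v h x + dir_deriv v' h x"
    "dir_deriv (r *\<^sub>R v) h x = r *\<^sub>R dir_deriv v h x"
proof -
  note lin = has_derivative_linear[OF has_derivative_dir_deriv[OF h_differentiable[OF assms]]]
  show "dir_deriv (v + v') h x = dir_deriv v h x + dir_deriv v' h x" by (rule linear_add[OF lin])
  show "dir_deriv (r *\<^sub>R v) h x = r *\<^sub>R dir_deriv v h x" by (rule linear_scale[OF lin])
qed

lemma riem_simps:
  "riem h x (v + v') w = riem h x v w + riem h x v' w"
  "riem h x v (w + w') = riem h x v w + riem h x v w'"
  "riem h x (v - v') w = riem h x v w - riem h x v' w"
  "riem h x (r *\<^sub>R v) w = r * riem h x v w"
  "riem h x v (r *\<^sub>R w) = r * riem h x v w"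
  by (simp_all add: riem_def sesq_simps)

lemma dir_deriv_riem:
  assumes "x \<in> S"
  shows "dir_deriv v (\<lambda>y. riem h y a b) x = 2 * Re (sesq (dir_deriv v h x) a b)"
  unfolding riem_def
  by (rule dir_deriv_linear_map[OF bounded_linear_const_mult[OF bounded_linear_Re_sesq_matrix] h_differentiable[OF assms]])

lemma koszul_eq:
  assumes "x \<in> S"
  shows "(dir_deriv v (\<lambda>y. riem h y w u) x + dir_deriv w (\<lambda>y. riem h y v u) x
               - dir_deriv u (\<lambda>y. riem h y v w) x) / 2 = koszul x v w u"
  unfolding dir_deriv_riem[OF assms] koszul_def by simp

lemma koszul_linear:
  assumes "x \<in> S"
  shows "koszul x (v + v') w u = koszul x v w u + koszul x v' w u"
    "koszul x (r *\<^sub>R v) w u = r * koszul x v w u"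
    "koszul x v (w + w') u = koszul x v w u + koszul x v w' u"
    "koszul x v (r *\<^sub>R w) u = r * koszul x v w u"
    "koszul x v w (u + u') = koszul x v w u + koszul x v w u'"
    "koszul x v w (r *\<^sub>R u) = r * koszul x v w u"
  unfolding koszul_def linear_dir_deriv_h[OF assms] sesq_simps sesq_add_matrix sesq_scaleR_matrix
  by (simp_all add: algebra_simps)

section \<open>The Christoffel symbols by Cramer's rule\<close>

lemma riem_nondegenerate:
  assumes "x \<in> S" "\<And>u. riem h x z u = riem h x z' u"
  shows "z = z'"
proof (rule ccontr)
  assume "z \<noteq> z'"
  then have "Re (sesq (h x) (z - z') (z - z')) > 0"
    using pos_h[OF assms(1)] unfolding pos_def_hermitian_def by simp
  then have "riem h x (z - z') (z - z') > 0" by (simp add: riem_def)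
  then show False unfolding riem_simps(3) using assms(2)[of "z - z'"] by simp
qed

definition tmat :: "complex^'n \<Rightarrow> complex^'n^'n"
  where "tmat x = (\<chi> j i. h x $ i $ j)"

text \<open>The complex vector representing the real functional \<open>koszul x v w\<close>: its
  real part of the hermitian pairing with \<open>u\<close>, doubled as in \<open>riem\<close>, gives
  \<open>koszul x v w u\<close>.\<close>

definition kvec :: "complex^'n \<Rightarrow> complex^'n \<Rightarrow> complex^'n \<Rightarrow> complex^'n"
  where "kvec v w x = (\<chi> j. (of_real (koszul x v w (axis j 1)) + \<i> * of_real (koszul x v w (axis j \<i>))) / 2)"

lemma tmat_mult: "sesq (h x) z u = (\<Sum>j\<in>UNIV. (tmat x *v z) $ j * cnj (u $ j))"
  unfolding sesq_def matrix_vector_mult_def tmat_def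
  by (subst sum.swap) (simp add: sum_distrib_right)

lemma det_tmat: 
  assumes x: "x \<in> S"
  shows "det (tmat x) \<noteq> 0"
proof -
  have "z = 0" if "tmat x *v z = 0" for z
  proof (rule ccontr)
    assume "z \<noteq> 0"
    then have "Re (sesq (h x) z z) > 0" using pos_h[OF x] unfolding pos_def_hermitian_def by simp
    then show False using that by (simp add: tmat_mult)
  qed
  then have "\<exists>B. B ** tmat x = mat 1" by (simp add: matrix_left_invertible_ker)
  then have "invertible (tmat x)"
    unfolding invertible_def using matrix_left_right_inverse by blast
  then show ?thesis by (simp add: invertible_det_nz)
qed

lemma riem_eq_koszul:
  assumes x: "x \<in> S" and z: "tmat x *v z = kvec v w x"
  shows "riem h x z u = koszul x v w u"
proof -
  have lin: "linear (koszul x v w)"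
    by (rule linearI) (simp_all add: koszul_linear[OF x])
  have "riem h x z u = (\<Sum>j\<in>UNIV. Re (u $ j) * koszul x v w (axis j 1) + Im (u $ j) * koszul x v w (axis j \<i>))"
    unfolding riem_def tmat_mult z Re_sum sum_distrib_left kvec_def vec_lambda_beta
    by (rule sum.cong[OF refl]) (simp add: algebra_simps)
  also have "\<dots> = koszul x v w (\<Sum>j\<in>UNIV. Re (u $ j) *\<^sub>R axis j 1 + Im (u $ j) *\<^sub>R axis j \<i>)"
    by (simp add: linear_sum[OF lin] linear_add[OF lin] linear_scale[OF lin])
  also have "\<dots> = koszul x v w u" using complex_vec_expansion[of u] by simp
  finally show ?thesis .
qed

text \<open>\<open>christoffel\<close> is given by \<open>THE\<close>, which says nothing about its
  dependence on \<open>x\<close>; Cramer's rule exhibits it as a quotient of determinants of smooth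
  entries.\<close>

definition cramer_vec :: "complex^'n \<Rightarrow> complex^'n \<Rightarrow> complex^'n \<Rightarrow> complex^'n"
  where "cramer_vec v w x =
    (\<chi> k. det (\<chi> i j. if j = k then kvec v w x $ i else tmat x $ i $ j) / det (tmat x))"

lemma christoffel_eq_cramer:
  assumes x: "x \<in> S"
  shows "christoffel (riem h) x v w = cramer_vec v w x"
proof -
  have "tmat x *v cramer_vec v w x = kvec v w x"
    unfolding cramer_vec_def using cramer[OF det_tmat[OF x]] by blast
  from riem_eq_koszul[OF x this] have K: "riem h x (cramer_vec v w x) u = koszul x v w u" for u .
  show ?thesis unfolding christoffel_def koszul_eq[OF x]
  proof (rule the_equality)
    show "\<forall>u. riem h x (cramer_vec v w x) u = koszul x v w u" by (simp add: K)
    fix z assume "\<forall>u. riem h x z u = koszul x v w u"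
    then show "z = cramer_vec v w x" by (intro riem_nondegenerate[OF x]) (simp add: K)
  qed
qed

lemma riem_christoffel:
  assumes x: "x \<in> S"
  shows "riem h x (christoffel (riem h) x v w) u = koszul x v w u"
proof -
  have "tmat x *v cramer_vec v w x = kvec v w x"
    unfolding cramer_vec_def using cramer[OF det_tmat[OF x]] by blast
  from riem_eq_koszul[OF x this] show ?thesis by (simp add: christoffel_eq_cramer[OF x])
qed

lemma christoffel_linear:
  assumes x: "x \<in> S"
  shows "linear (\<lambda>v. christoffel (riem h) x v w)" "linear (\<lambda>w. christoffel (riem h) x v w)"
  by (rule linearI; rule riem_nondegenerate[OF x];
      simp add: riem_simps riem_christoffel[OF x] koszul_linear[OF x])+

lemma smooth_koszul: "smooth_on S (\<lambda>x. koszul x v w u)"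
  unfolding koszul_def
  by (intro smooth_on_diff smooth_on_add open_S smooth_on_dir_deriv smooth_h
      smooth_on_linear[OF bounded_linear_Re_sesq_matrix])

lemma smooth_h_nth: "smooth_on S (\<lambda>x. h x $ i $ j)"
  by (intro smooth_on_linear[OF bounded_linear_compose[OF bounded_linear_vec_nth bounded_linear_vec_nth]] open_S smooth_h)

lemma smooth_christoffel: "smooth_on S (\<lambda>x. christoffel (riem h) x v w)"
proof -
  have k: "smooth_on S (\<lambda>x. kvec v w x $ i)" for i
    unfolding kvec_def vec_lambda_beta
    by (intro smooth_on_linear[OF bounded_linear_divide] smooth_on_add smooth_on_mult smooth_on_const
        smooth_on_linear[OF bounded_linear_of_real] smooth_koszul open_S)
  have t: "smooth_on S (\<lambda>x. tmat x $ i $ j)" for i j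
    unfolding tmat_def vec_lambda_beta by (rule smooth_h_nth)
  have N: "smooth_on S (\<lambda>x. det (\<chi> i j. if j = k then kvec v w x $ i else tmat x $ i $ j))" for k
  proof (rule smooth_on_det[OF open_S])
    show "smooth_on S (\<lambda>x. (\<chi> i j. if j = k then kvec v w x $ i else tmat x $ i $ j) $ i $ j)" for i j
      by (cases "j = k") (simp_all add: k t)
  qed
  have D: "smooth_on S (\<lambda>x. inverse (det (tmat x)))"
    by (rule smooth_on_inverse[OF open_S smooth_on_det[OF open_S t] det_tmat])
  have "smooth_on S (\<lambda>x. cramer_vec v w x $ k)" for k
    unfolding cramer_vec_def vec_lambda_beta divide_inverse by (rule smooth_on_mult[OF open_S N D])
  then have "smooth_on S (cramer_vec v w)" by (rule smooth_on_vec[OF open_S])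
  then show ?thesis
    by (rule smooth_on_cong[OF open_S]) (simp add: christoffel_eq_cramer)
qed

text \<open>The two claims feed each other: smoothness of the correction terms comes from expanding
  the Christoffel symbol in a slot by multilinearity, and multilinearity of the leading term needs
  the components to be differentiable.\<close>

lemma cov_deriv_multilinear_smooth:
  assumes f: "smooth_on S f"
  shows "(\<forall>x\<in>S. multilinear_form j (cov_deriv (riem h) f j x)) \<and>
    (\<forall>w. smooth_on S (\<lambda>x. cov_deriv (riem h) f j x w))"
proof (induction j)
  case 0
  then show ?case using f by (simp add: multilinear_form_def)
next
  case (Suc j)
  define a where "a = cov_deriv (riem h) f j"
  define \<Gamma> where "\<Gamma> = christoffel (riem h)"
  have am: "multilinear_form j (a x)" if "x \<in> S" for x using Suc that by (simp add: a_def)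
  have as: "smooth_on S (\<lambda>x. a x w)" for w using Suc by (simp add: a_def)
  have ad: "(\<lambda>y. a y w) differentiable at x" if "x \<in> S" for x w
    using as that by (rule smooth_on_imp_differentiable)
  have \<Gamma>l: "linear (\<lambda>v. \<Gamma> x v w)" "linear (\<lambda>v. \<Gamma> x w v)" if "x \<in> S" for x w
    using christoffel_linear[OF that] by (auto simp: \<Gamma>_def)
  have eq: "cov_deriv (riem h) f (Suc j) x v = dir_deriv (v 0) (\<lambda>y. a y (\<lambda>i. v (Suc i))) x -
      (\<Sum>i<j. a x ((\<lambda>i. v (Suc i))(i := \<Gamma> x (v 0) (v (Suc i)))))" for x v
    by (simp add: a_def \<Gamma>_def Let_def)
  have "smooth_on S (\<lambda>x. cov_deriv (riem h) f (Suc j) x w)" for w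
  proof -
    have "smooth_on S (\<lambda>x. a x ((\<lambda>i. w (Suc i))(i := \<Gamma> x (w 0) (w (Suc i)))))" if i: "i < j" for i
    proof (rule smooth_on_cong[OF open_S])
      show "smooth_on S (\<lambda>x. \<Sum>b\<in>Basis. (\<Gamma> x (w 0) (w (Suc i)) \<bullet> b) * a x ((\<lambda>i. w (Suc i))(i := b)))"
        unfolding \<Gamma>_def
        by (intro smooth_on_sum smooth_on_mult open_S as smooth_on_linear[OF bounded_linear_inner_left] smooth_christoffel)
    qed (rule multilinear_form_expand[OF am i, symmetric])
    then show ?thesis unfolding eq
      by (intro smooth_on_diff smooth_on_sum open_S smooth_on_dir_deriv as) auto
  qed
  moreover have "multilinear_form (Suc j) (cov_deriv (riem h) f (Suc j) x)" if x: "x \<in> S" for x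
    unfolding multilinear_form_def
  proof (intro conjI allI impI)
    fix w w' :: "nat \<Rightarrow> complex^'n" assume w: "\<forall>i<Suc j. w i = w' i"
    have "dir_deriv (w' 0) (\<lambda>y. a y (\<lambda>i. w (Suc i))) x = dir_deriv (w' 0) (\<lambda>y. a y (\<lambda>i. w' (Suc i))) x"
      using w by (intro dir_deriv_cong_open[OF open_S x] multilinear_form_cong[OF am]) auto
    moreover have "a x ((\<lambda>i. w (Suc i))(i := \<Gamma> x (w 0) (w (Suc i)))) = a x ((\<lambda>i. w' (Suc i))(i := \<Gamma> x (w' 0) (w' (Suc i))))"
      if "i < j" for i using w that by (intro multilinear_form_cong[OF am[OF x]]) auto
    ultimately show "cov_deriv (riem h) f (Suc j) x w = cov_deriv (riem h) f (Suc j) x w'"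
      unfolding eq using w by simp
  next
    fix i and w :: "nat \<Rightarrow> complex^'n" assume i: "i < Suc j"
    show "linear (\<lambda>z. cov_deriv (riem h) f (Suc j) x (w(i := z)))"
    proof (cases i)
      \<comment> \<open>Slot 0 is the direction of differentiation and enters every term linearly,
        through \<open>dir_deriv\<close> or the first argument of \<open>\<Gamma>\<close>.\<close>
      case 0
      have "linear (\<lambda>z. dir_deriv z (\<lambda>y. a y (\<lambda>i. w (Suc i))) x -
          (\<Sum>i<j. a x ((\<lambda>i. w (Suc i))(i := \<Gamma> x z (w (Suc i))))))"
        by (intro linear_compose_sub linear_compose_sum ballI
            has_derivative_linear[OF has_derivative_dir_deriv[OF ad[OF x]]])
          (auto intro!: linear_compose[OF \<Gamma>l(1)[OF x] multilinear_form_linear[OF am[OF x]], unfolded o_def])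
      then show ?thesis unfolding eq by (simp add: 0)
    next
      case (Suc i')
      with i have i': "i' < j" by simp
      define w' where "w' = (\<lambda>i. w (Suc i))"
      have shift: "(\<lambda>k. (w(i := z)) (Suc k)) = w'(i' := z)" for z
        by (auto simp: Suc w'_def fun_eq_iff)
      have "linear (\<lambda>z. dir_deriv (w 0) (\<lambda>y. a y (w'(i' := z))) x -
          (\<Sum>k<j. a x ((w'(i' := z))(k := \<Gamma> x (w 0) ((w'(i' := z)) k)))))"
      proof (intro linear_compose_sub linear_compose_sum ballI)
        show "linear (\<lambda>z. dir_deriv (w 0) (\<lambda>y. a y (w'(i' := z))) x)"
          by (rule multilinear_form_linear[OF dir_deriv_multilinear_form[OF open_S x am ad[OF x]] i'])
        fix k assume "k \<in> {..<j}"
        then have k: "k < j" by simp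
        \<comment> \<open>For \<open>k = i'\<close> the vector \<open>z\<close> sits inside the
          Christoffel symbol; for the other slots the two updates commute.\<close>
        show "linear (\<lambda>z. a x ((w'(i' := z))(k := \<Gamma> x (w 0) ((w'(i' := z)) k))))"
        proof (cases "k = i'")
          case True
          then show ?thesis
            using linear_compose[OF \<Gamma>l(2)[OF x] multilinear_form_linear[OF am[OF x] i', of w']]
            by (simp add: o_def)
        next
          case False
          then have "(w'(i' := z))(k := \<Gamma> x (w 0) ((w'(i' := z)) k)) = (w'(k := \<Gamma> x (w 0) (w' k)))(i' := z)" for z
            by (auto simp: fun_eq_iff)
          then show ?thesis using multilinear_form_linear[OF am[OF x] i'] by simp
        qed
      qed
      moreover have "cov_deriv (riem h) f (Suc j) x (w(i := z)) = dir_deriv (w 0) (\<lambda>y. a y (w'(i' := z))) x -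
          (\<Sum>k<j. a x ((w'(i' := z))(k := \<Gamma> x (w 0) ((w'(i' := z)) k))))" for z
      proof -
        have "(w(i := z)) 0 = w 0" using Suc by simp
        moreover have "(w(i := z)) (Suc k) = (w'(i' := z)) k" for k using shift[of z] by metis
        ultimately show ?thesis unfolding eq by (simp only:)
      qed
      ultimately show ?thesis by simp
    qed
  qed
  ultimately show ?case by blast
qed

end

lemma cov_deriv_cong:
  assumes "open S" "\<And>x. x \<in> S \<Longrightarrow> f x = f' x" "x \<in> S"
  shows "cov_deriv G f j x w = cov_deriv G f' j x w"
  using assms(3)
proof (induction j arbitrary: x w)
  case 0
  then show ?case by (simp add: assms(2))
next
  case (Suc j)
  have "dir_deriv v (\<lambda>y. cov_deriv G f j y w) x = dir_deriv v (\<lambda>y. cov_deriv G f' j y w) x" for v w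
    by (rule dir_deriv_cong_open[OF assms(1) Suc.prems Suc.IH])
  then show ?case unfolding cov_deriv.simps Let_def Suc.IH[OF Suc.prems] by simp
qed

section \<open>Coordinate invariance of covariant derivatives\<close>

lemma (in hermitian_chart) riem_commute: "x \<in> S \<Longrightarrow> riem h x v w = riem h x w v"
  using sesq_commute[OF pos_def_hermitian_imp_hermitian[OF pos_h], of x w v] by (simp add: riem_def)

text \<open>Abstracts a transition map between charts, with the C^2 regularity obtained from
  Cauchy's formula.\<close>

locale hermitian_isometry =
  dom: hermitian_chart U h + cod: hermitian_chart V k
  for U V :: "(complex^'n::finite) set" and h k +
  fixes T :: "complex^'n \<Rightarrow> complex^'n"
  assumes T: "Ck_on 2 U T" and T_in: "\<And>x. x \<in> U \<Longrightarrow> T x \<in> V"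
    and iso: "\<And>x v w. x \<in> U \<Longrightarrow> sesq (h x) v w = sesq (k (T x)) (dir_deriv v T x) (dir_deriv w T x)"
begin

lemma T_derivative: "x \<in> U \<Longrightarrow> (T has_derivative (\<lambda>v. dir_deriv v T x)) (at x)"
  by (intro has_derivative_dir_deriv Ck2_differentiable(1)[OF T])

lemma dT_derivative: "x \<in> U \<Longrightarrow> (dir_deriv a T has_derivative (\<lambda>v. dir_deriv v (dir_deriv a T) x)) (at x)"
  by (intro has_derivative_dir_deriv Ck2_differentiable(2)[OF T])

lemma riem_iso: "x \<in> U \<Longrightarrow> riem h x v w = riem k (T x) (dir_deriv v T x) (dir_deriv w T x)"
  by (simp add: riem_def iso)

text \<open>An isometric derivative is injective, hence onto by dimension; so identities of vectors
  can be tested against images of vectors.\<close>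

lemma dT_surj:
  assumes x: "x \<in> U"
  obtains v where "dir_deriv v T x = u"
proof -
  have lin: "linear (\<lambda>v. dir_deriv v T x)" by (rule has_derivative_linear[OF T_derivative[OF x]])
  have "inj (\<lambda>v. dir_deriv v T x)"
  proof (subst linear_injective_0[OF lin], intro allI impI)
    fix v assume "dir_deriv v T x = 0"
    then have "sesq (h x) v v = 0" using iso[OF x, of v v] by (simp add: sesq_simps)
    then show "v = 0" using dom.pos_h[OF x] unfolding pos_def_hermitian_def by force
  qed
  then have "surj (\<lambda>v. dir_deriv v T x)" using linear_injective_imp_surjective[OF lin] by simp
  then show ?thesis using that by (metis surjD)
qed

text \<open>The Leibniz rule for a bilinear form whose coefficients and two arguments all move with
  the point.\<close>

lemma dir_deriv_riem_pullback:
  assumes x: "x \<in> U"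
  shows "dir_deriv v (\<lambda>y. riem h y a b) x =
    2 * Re (sesq (dir_deriv (dir_deriv v T x) k (T x)) (dir_deriv a T x) (dir_deriv b T x)) +
    riem k (T x) (dir_deriv v (dir_deriv a T) x) (dir_deriv b T x) +
    riem k (T x) (dir_deriv a T x) (dir_deriv v (dir_deriv b T) x)"
proof -
  define A where "A y w = riem k (T y) (w 0) (w 1)" for y and w :: "nat \<Rightarrow> complex^'n"
  define L where "L w s = 2 * Re (sesq (dir_deriv (dir_deriv s T x) k (T x)) (w 0) (w 1))" for w :: "nat \<Rightarrow> complex^'n" and s
  define W where "W i = (if i = 0 then dir_deriv a T else dir_deriv b T)" for i :: nat
  define W' where "W' i s = (if i = 0 then dir_deriv s (dir_deriv a T) x else dir_deriv s (dir_deriv b T) x)" for i :: nat and s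
  have mult: "multilinear_form 2 (\<lambda>w. 2 * Re (sesq H (w 0) (w 1)))" for H :: "complex^'n^'n"
    unfolding multilinear_form_def
  proof (intro conjI allI impI)
    fix w w' :: "nat \<Rightarrow> complex^'n" assume "\<forall>i<2. w i = w' i"
    then show "2 * Re (sesq H (w 0) (w 1)) = 2 * Re (sesq H (w' 0) (w' 1))" by simp
  next
    fix i :: nat and w :: "nat \<Rightarrow> complex^'n" assume "i < 2"
    then have "i = 0 \<or> i = 1" by linarith
    then show "linear (\<lambda>z. 2 * Re (sesq H ((w(i := z)) 0) ((w(i := z)) 1)))"
      by (auto intro!: linearI simp: sesq_simps)
  qed
  have kd: "(k has_derivative (\<lambda>v. dir_deriv v k (T x))) (at (T x))"
    by (intro has_derivative_dir_deriv cod.h_differentiable T_in x)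
  have "((\<lambda>y. A y (\<lambda>i. W i y)) has_derivative
      (\<lambda>s. L (\<lambda>i. W i x) s + (\<Sum>i<2. A x ((\<lambda>i. W i x)(i := W' i s))))) (at x)"
  proof (rule multilinear_form_has_derivative[OF dom.open_S x])
    show "multilinear_form 2 (A y)" for y unfolding A_def riem_def by (rule mult)
    show "multilinear_form 2 (\<lambda>w. L w s)" for s unfolding L_def by (rule mult)
    show "((\<lambda>y. A y w) has_derivative L w) (at x)" for w
      unfolding A_def L_def riem_def
      by (rule bounded_linear.has_derivative[OF bounded_linear_const_mult[OF bounded_linear_Re_sesq_matrix]])
        (rule has_derivative_compose[OF T_derivative[OF x] kd])
    show "(W i has_derivative W' i) (at x)" for i
      unfolding W_def W'_def using dT_derivative[OF x] by simp
  qed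
  then have "((\<lambda>y. riem k (T y) (dir_deriv a T y) (dir_deriv b T y)) has_derivative
      (\<lambda>s. L (\<lambda>i. W i x) s + (\<Sum>i<2. A x ((\<lambda>i. W i x)(i := W' i s))))) (at x)"
    by (simp add: A_def W_def)
  then have "dir_deriv v (\<lambda>y. riem k (T y) (dir_deriv a T y) (dir_deriv b T y)) x =
     L (\<lambda>i. W i x) v + (\<Sum>i<2. A x ((\<lambda>i. W i x)(i := W' i v)))"
    by (rule dir_deriv_eqI)
  moreover have "dir_deriv v (\<lambda>y. riem h y a b) x = dir_deriv v (\<lambda>y. riem k (T y) (dir_deriv a T y) (dir_deriv b T y)) x"
    by (rule dir_deriv_cong_open[OF dom.open_S x riem_iso])
  ultimately show ?thesis by (simp add: numeral_2_eq_2 L_def A_def W_def W'_def)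
qed

text \<open>Six terms contain second derivatives of \<open>T\<close>. Symmetry of these and of the
  metric cancels four of them, and the remaining two coincide.\<close>

lemma koszul_pullback:
  assumes x: "x \<in> U"
  shows "dom.koszul x v w u = cod.koszul (T x) (dir_deriv v T x) (dir_deriv w T x) (dir_deriv u T x) +
    riem k (T x) (dir_deriv v (dir_deriv w T) x) (dir_deriv u T x)"
proof -
  note c = dir_deriv_commute[OF dom.open_S T x]
  note rc = cod.riem_commute[OF T_in[OF x]]
  show ?thesis
    unfolding dom.koszul_eq[OF x, symmetric] dir_deriv_riem_pullback[OF x] cod.koszul_def
    using c[of v w] c[of v u] c[of w u]
      rc[of "dir_deriv w T x" "dir_deriv v (dir_deriv u T) x"]
      rc[of "dir_deriv v T x" "dir_deriv w (dir_deriv u T) x"]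
    by simp
qed

text \<open>The inhomogeneous transformation law of the connection, tested against all vectors in
  the image of the derivative of \<open>T\<close>.\<close>

lemma christoffel_pullback:
  assumes x: "x \<in> U"
  shows "dir_deriv (christoffel (riem h) x v w) T x =
    christoffel (riem k) (T x) (dir_deriv v T x) (dir_deriv w T x) + dir_deriv v (dir_deriv w T) x"
proof (rule cod.riem_nondegenerate[OF T_in[OF x]])
  fix u'
  obtain u where u: "dir_deriv u T x = u'" using dT_surj[OF x] by blast
  show "riem k (T x) (dir_deriv (christoffel (riem h) x v w) T x) u' =
    riem k (T x) (christoffel (riem k) (T x) (dir_deriv v T x) (dir_deriv w T x) + dir_deriv v (dir_deriv w T) x) u'"
    unfolding u[symmetric] riem_iso[OF x, symmetric] cod.riem_simps(1)
      dom.riem_christoffel[OF x] cod.riem_christoffel[OF T_in[OF x]]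
    by (rule koszul_pullback[OF x])
qed

text \<open>Differentiating the pulled-back tensor puts a second derivative of \<open>T\<close> into
  each slot in turn; the inhomogeneous term of \<open>christoffel_pullback\<close> removes exactly
  these. No higher derivative of \<open>T\<close> appears at any order.\<close>

lemma cov_deriv_pullback:
  assumes f: "smooth_on V f" and x: "x \<in> U"
  shows "cov_deriv (riem h) (f \<circ> T) j x w = cov_deriv (riem k) f j (T x) (\<lambda>i. dir_deriv (w i) T x)"
  using x
proof (induction j arbitrary: x w)
  case 0
  then show ?case by simp
next
  case (Suc j)
  note x = Suc.prems
  define a where "a = cov_deriv (riem k) f j"
  have am: "multilinear_form j (a y)" if "y \<in> V" for y
    using cod.cov_deriv_multilinear_smooth[OF f] that by (simp add: a_def)
  have ad: "(\<lambda>y. a y p) differentiable at y" if "y \<in> V" for y p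
    using cod.cov_deriv_multilinear_smooth[OF f] that smooth_on_imp_differentiable by (fastforce simp: a_def)
  define v where "v = (\<lambda>i. w (Suc i))"
  define L where "L p s = dir_deriv (dir_deriv s T x) (\<lambda>y. a y p) (T x)" for p s
  have "((\<lambda>y. a (T y) (\<lambda>i. dir_deriv (v i) T y)) has_derivative
      (\<lambda>s. L (\<lambda>i. dir_deriv (v i) T x) s +
        (\<Sum>i<j. a (T x) ((\<lambda>i. dir_deriv (v i) T x)(i := dir_deriv s (dir_deriv (v i) T) x))))) (at x)"
  proof (rule multilinear_form_has_derivative[OF dom.open_S x, where W="\<lambda>i. dir_deriv (v i) T"])
    show "multilinear_form j (a (T y))" if "y \<in> U" for y by (rule am[OF T_in[OF that]])
    show "multilinear_form j (\<lambda>p. L p s)" for s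
      unfolding L_def by (rule dir_deriv_multilinear_form[OF cod.open_S T_in[OF x] am ad[OF T_in[OF x]]])
    show "((\<lambda>y. a (T y) p) has_derivative L p) (at x)" for p
      unfolding L_def by (rule has_derivative_compose[OF T_derivative[OF x] has_derivative_dir_deriv[OF ad[OF T_in[OF x]]]])
    show "(dir_deriv (v i) T has_derivative (\<lambda>s. dir_deriv s (dir_deriv (v i) T) x)) (at x)" for i
      by (rule dT_derivative[OF x])
  qed
  then have "dir_deriv (w 0) (\<lambda>y. a (T y) (\<lambda>i. dir_deriv (v i) T y)) x = L (\<lambda>i. dir_deriv (v i) T x) (w 0) +
        (\<Sum>i<j. a (T x) ((\<lambda>i. dir_deriv (v i) T x)(i := dir_deriv (w 0) (dir_deriv (v i) T) x)))"
    by (rule dir_deriv_eqI)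
  moreover have "dir_deriv (w 0) (\<lambda>y. cov_deriv (riem h) (f \<circ> T) j y v) x =
      dir_deriv (w 0) (\<lambda>y. a (T y) (\<lambda>i. dir_deriv (v i) T y)) x"
    unfolding a_def by (rule dir_deriv_cong_open[OF dom.open_S x Suc.IH])
  moreover have "cov_deriv (riem h) (f \<circ> T) j x (v(i := christoffel (riem h) x (w 0) (v i))) =
      a (T x) ((\<lambda>i. dir_deriv (v i) T x)(i := christoffel (riem k) (T x) (dir_deriv (w 0) T x) (dir_deriv (v i) T x))) +
      a (T x) ((\<lambda>i. dir_deriv (v i) T x)(i := dir_deriv (w 0) (dir_deriv (v i) T) x))" if i: "i < j" for i
  proof -
    have "(\<lambda>l. dir_deriv ((v(i := christoffel (riem h) x (w 0) (v i))) l) T x) =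
        (\<lambda>i. dir_deriv (v i) T x)(i := christoffel (riem k) (T x) (dir_deriv (w 0) T x) (dir_deriv (v i) T x) + dir_deriv (w 0) (dir_deriv (v i) T) x)"
      by (auto simp: fun_eq_iff christoffel_pullback[OF x])
    then show ?thesis
      unfolding Suc.IH[OF x] a_def[symmetric]
      using linear_add[OF multilinear_form_linear[OF am[OF T_in[OF x]] i]] by simp
  qed
  ultimately have "dir_deriv (w 0) (\<lambda>y. cov_deriv (riem h) (f \<circ> T) j y v) x -
      (\<Sum>i<j. cov_deriv (riem h) (f \<circ> T) j x (v(i := christoffel (riem h) x (w 0) (v i)))) =
    L (\<lambda>i. dir_deriv (v i) T x) (w 0) - (\<Sum>i<j. a (T x) ((\<lambda>i. dir_deriv (v i) T x)(i :=
      christoffel (riem k) (T x) (dir_deriv (w 0) T x) (dir_deriv (v i) T x))))"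
    by (simp add: sum.distrib)
  then show ?case unfolding cov_deriv.simps Let_def v_def L_def a_def .
qed

end

section \<open>Finiteness of the \<open>C^k\<close> norm of a smooth function\<close>

context hermitian_chart
begin

text \<open>The factor 1 / sqrt 2 compensates the 2 in \<open>riem\<close>. Existence matters
  because \<open>tensor_norm\<close> picks its frame with \<open>SOME\<close>.\<close>

lemma exists_orthonormal_frame:
  assumes x: "x \<in> S"
  shows "\<exists>e. orthonormal_frame (riem h x) e"
proof -
  have herm: "hermitian (h x)" by (rule pos_def_hermitian_imp_hermitian[OF pos_h[OF x]])
  obtain e :: "'n \<Rightarrow> complex^'n" where e: "\<And>i j. sesq (h x) (e i) (e j) = (if i = j then 1 else 0)"
    using exists_generalized_eigenbasis[OF herm pos_h[OF x]] by metis
  obtain b where b: "bij_betw b {..<CARD('n)} (UNIV :: 'n set)"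
    using ex_bij_betw_nat_finite[of "UNIV :: 'n set"] by (auto simp: atLeast0LessThan)
  define v where "v a = (if even a then e (b (a div 2)) else \<i> *s e (b (a div 2)))" for a
  have "riem h x ((1 / sqrt 2) *\<^sub>R v p) ((1 / sqrt 2) *\<^sub>R v q) = (if p = q then 1 else 0)"
    if "p < DIM(complex^'n)" "q < DIM(complex^'n)" for p q
  proof -
    from that have "p div 2 < CARD('n)" "q div 2 < CARD('n)" by auto
    then have beq: "b (p div 2) = b (q div 2) \<longleftrightarrow> p div 2 = q div 2"
      using b by (auto simp: bij_betw_def inj_on_def)
    have pq: "p = q \<longleftrightarrow> p div 2 = q div 2 \<and> (even p \<longleftrightarrow> even q)" by presburger
    have "riem h x ((1 / sqrt 2) *\<^sub>R v p) ((1 / sqrt 2) *\<^sub>R v q) = (1 / sqrt 2) * ((1 / sqrt 2) * riem h x (v p) (v q))"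
      by (simp only: riem_simps)
    also have "\<dots> = Re (sesq (h x) (v p) (v q))" by (simp add: riem_def)
    also have "\<dots> = (if p = q then 1 else 0)"
      unfolding pq v_def by (auto simp: sesq_simps e beq)
    finally show ?thesis .
  qed
  then have "orthonormal_frame (riem h x) (\<lambda>a. (1 / sqrt 2) *\<^sub>R v a)"
    unfolding orthonormal_frame_def by blast
  then show ?thesis by blast
qed

text \<open>Boundedness is stated for arguments of unit length in the metric, a condition that
  isometries preserve, so that it can be transported to other charts.\<close>

lemma cov_deriv_unit_bound:
  assumes f: "smooth_on S f" and K: "compact K" "K \<subseteq> S"
  obtains M where "M \<ge> 0"
    "\<And>y w. y \<in> K \<Longrightarrow> (\<And>i. i < j \<Longrightarrow> riem h y (w i) (w i) = 1) \<Longrightarrow> \<bar>cov_deriv (riem h) f j y w\<bar> \<le> M"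
proof -
  define a where "a = cov_deriv (riem h) f j"
  have am: "multilinear_form j (a y)" if "y \<in> S" for y
    using cov_deriv_multilinear_smooth[OF f] that by (simp add: a_def)
  have as: "smooth_on S (\<lambda>y. a y w)" for w
    using cov_deriv_multilinear_smooth[OF f] by (simp add: a_def)
  have ch: "continuous_on K h" by (rule continuous_on_subset[OF smooth_on_imp_continuous_on[OF smooth_h] K(2)])
  have pK: "pos_def_hermitian (h x)" if "x \<in> K" for x using K(2) that by (blast intro: pos_h)
  obtain c C where "c > 0" "C > 0" "\<And>x v. x \<in> K \<Longrightarrow> c * (norm v)\<^sup>2 \<le> Re (sesq (h x) v v)"
    "\<And>x v. x \<in> K \<Longrightarrow> Re (sesq (h x) v v) \<le> C * (norm v)\<^sup>2"
    by (rule uniform_pos_def_bounds[OF K(1) ch pK]) (assumption, (rule that; assumption))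
  note c = this(1,3)
  \<comment> \<open>Bounds the Euclidean length of metric unit vectors, by the lower bound
    \<open>c\<close> and the 2 in \<open>riem\<close>.\<close>
  define B where "B = sqrt (1 / (2 * c))"
  have B: "B \<ge> 0" using c(1) by (simp add: B_def)
  have nB: "norm v \<le> B" if "y \<in> K" "riem h y v v = 1" for y v
  proof -
    have "2 * (c * (norm v)\<^sup>2) \<le> 1" using c(2)[OF that(1), of v] that(2) by (simp add: riem_def)
    then have "(norm v)\<^sup>2 \<le> 1 / (2 * c)" using c(1) by (simp add: field_simps)
    then show ?thesis unfolding B_def by (rule real_le_rsqrt)
  qed
  \<comment> \<open>Extensional tuples of basis vectors are finite in number, so a sum of finitely
    many compactness bounds controls the components.\<close>
  define P where "P = {..<j} \<rightarrow>\<^sub>E (Basis :: (complex^'n) set)"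
  have finP: "finite P" unfolding P_def by (intro finite_PiE) auto
  have "\<exists>M. \<forall>y\<in>K. \<bar>a y w\<bar> \<le> M" for w
  proof -
    have "continuous_on K (\<lambda>y. a y w)"
      by (rule continuous_on_subset[OF smooth_on_imp_continuous_on[OF as] K(2)])
    then have "bounded ((\<lambda>y. a y w) ` K)"
      by (intro compact_imp_bounded compact_continuous_image K(1))
    then show ?thesis unfolding bounded_iff by auto
  qed
  then obtain m where m: "\<And>w y. y \<in> K \<Longrightarrow> \<bar>a y w\<bar> \<le> m w" by metis
  define M0 where "M0 = (\<Sum>w\<in>P. \<bar>m w\<bar>)"
  have M0: "M0 \<ge> 0" by (simp add: M0_def sum_nonneg)
  have basis: "\<bar>a y w\<bar> \<le> M0" if y: "y \<in> K" and w: "\<And>i. i < j \<Longrightarrow> w i \<in> Basis" for y w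
  proof -
    have P: "restrict w {..<j} \<in> P" using w by (auto simp: P_def)
    have "a y w = a y (restrict w {..<j})"
      using y K(2) by (intro multilinear_form_cong[OF am]) auto
    also have "\<bar>\<dots>\<bar> \<le> \<bar>m (restrict w {..<j})\<bar>" using m[OF y, of "restrict w {..<j}"] by linarith
    also have "\<dots> \<le> M0" unfolding M0_def by (rule member_le_sum[OF P _ finP]) simp
    finally show ?thesis .
  qed
  show ?thesis
  proof (rule that)
    show "M0 * (real DIM(complex^'n) * B) ^ j \<ge> 0" using M0 B by simp
    fix y w assume y: "y \<in> K" and w: "\<And>i. i < j \<Longrightarrow> riem h y (w i) (w i) = 1"
    have "y \<in> S" using y K(2) by blast
    from multilinear_form_bound[OF am[OF this] B basis[OF y] nB[OF y w]]
    show "\<bar>cov_deriv (riem h) f j y w\<bar> \<le> M0 * (real DIM(complex^'n) * B) ^ j"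
      unfolding a_def .
  qed
qed

end

text \<open>Whichever frame \<open>SOME\<close> selects, it consists of unit vectors.\<close>

lemma tensor_norm_le:
  fixes B :: "'v::euclidean_space \<Rightarrow> 'v \<Rightarrow> real" and M :: real
  assumes e: "\<exists>e. orthonormal_frame B e"
    and T: "\<And>w. (\<And>i. i < j \<Longrightarrow> B (w i) (w i) = 1) \<Longrightarrow> \<bar>T w\<bar> \<le> M"
  shows "tensor_norm B j T \<le> sqrt (real (card ({..<j} \<rightarrow>\<^sub>E {..<DIM('v)})) * M\<^sup>2)"
proof -
  define e where "e = (SOME e. orthonormal_frame B e)"
  have fr: "orthonormal_frame B e" unfolding e_def using assms(1) by (rule someI_ex)
  have "(\<Sum>I\<in>{..<j} \<rightarrow>\<^sub>E {..<DIM('v)}. (T (\<lambda>i. e (I i)))\<^sup>2) \<le> real (card ({..<j} \<rightarrow>\<^sub>E {..<DIM('v)})) * M\<^sup>2"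
  proof (rule sum_bounded_above)
    fix I assume I: "I \<in> {..<j} \<rightarrow>\<^sub>E {..<DIM('v)}"
    have "\<bar>T (\<lambda>i. e (I i))\<bar> \<le> M"
    proof (rule T)
      fix i assume "i < j"
      then have "I i < DIM('v)" using I by auto
      then show "B (e (I i)) (e (I i)) = 1" using fr by (simp add: orthonormal_frame_def)
    qed
    then have "\<bar>T (\<lambda>i. e (I i))\<bar>\<^sup>2 \<le> M\<^sup>2" by (intro power_mono) auto
    then show "(T (\<lambda>i. e (I i)))\<^sup>2 \<le> M\<^sup>2" by simp
  qed
  then show ?thesis unfolding tensor_norm_def Let_def e_def[symmetric] by simp
qed

section \<open>From one chart to the whole manifold\<close>

lemma chart_hermitian_chart:
  assumes M: "complex_manifold X \<A>" and g: "hermitian_metric \<A> g" and c: "c \<in> \<A>"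
  shows "hermitian_chart (chart_img c) (g c)"
  using complex_manifold_chart(2)[OF M c] g c by unfold_locales (auto simp: hermitian_metric_def)

lemma transition_hermitian_isometry:
  assumes M: "complex_manifold X \<A>" and g: "hermitian_metric \<A> g" and c: "c \<in> \<A>" and d: "d \<in> \<A>"
  shows "hermitian_isometry (transition_dom c d) (chart_img d) (g c) (g d) (transition c d)"
proof -
  interpret C: hermitian_chart "chart_img c" "g c" by (rule chart_hermitian_chart[OF M g c])
  interpret D: hermitian_chart "chart_img d" "g d" by (rule chart_hermitian_chart[OF M g d])
  have sub: "transition_dom c d \<subseteq> chart_img c" by (auto simp: transition_dom_def chart_img_def)
  have opn: "open (transition_dom c d)"
    unfolding transition_dom_def
    by (rule open_chart_image[OF M c])
      (auto intro: openin_Int complex_manifold_chart(1)[OF M c] complex_manifold_chart(1)[OF M d])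
  show ?thesis
  proof unfold_locales
    show "open (transition_dom c d)" by (rule opn)
    show "smooth_on (transition_dom c d) (g c)" by (rule smooth_on_subset[OF C.smooth_h sub])
    show "pos_def_hermitian (g c x)" if "x \<in> transition_dom c d" for x using C.pos_h that sub by blast
    have "holomorphic_map_on (transition_dom c d) (transition c d)"
      using M c d unfolding complex_manifold_def by blast
    then show "Ck_on 2 (transition_dom c d) (transition c d)" using opn by (rule holomorphic_map_on_Ck2)
    show "transition c d x \<in> chart_img d" if "x \<in> transition_dom c d" for x
      using that by (auto simp: transition_dom_def transition_def chart_inv_map[OF M c] chart_map_in_img)
    show "sesq (g c x) v w = sesq (g d (transition c d x)) (dir_deriv v (transition c d) x) (dir_deriv w (transition c d) x)"
      if "x \<in> transition_dom c d" for x v w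
      using g c d that unfolding hermitian_metric_def by blast
  qed
qed

text \<open>The bound is computed on a closed ball in one chart \<open>d\<close> around
  \<open>p\<close>. In any other chart the covariant derivative at a point of \<open>N\<close> is
  the pullback of the one in \<open>d\<close>, and the transition map takes unit vectors to unit
  vectors.\<close>

lemma tensor_norm_cov_deriv_locally_bounded:
  fixes g :: "('a, 'n::finite) metric"
  assumes M: "complex_manifold X \<A>" and g: "hermitian_metric \<A> g" and f: "smooth_function \<A> f"
    and p: "p \<in> topspace X"
  shows "\<exists>N K. openin X N \<and> p \<in> N \<and> (\<forall>c\<in>\<A>. \<forall>x\<in>chart_img c. chart_inv c x \<in> N \<longrightarrow>
    tensor_norm (riem (g c) x) j (cov_deriv (riem (g c)) (in_chart c f) j x) \<le> K)"
proof -
  obtain d where d: "d \<in> \<A>" "p \<in> chart_dom d" using complex_manifold_cover[OF M p] by blast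
  interpret D: hermitian_chart "chart_img d" "g d" by (rule chart_hermitian_chart[OF M g d(1)])
  have fd: "smooth_on (chart_img d) (in_chart d f)" using f d(1) by (simp add: smooth_function_def)
  obtain r where r: "r > 0" "cball (chart_map d p) r \<subseteq> chart_img d"
    using D.open_S chart_map_in_img[OF d(2)] open_contains_cball by blast
  obtain m where m: "\<And>y w. y \<in> cball (chart_map d p) r \<Longrightarrow> (\<And>i. i < j \<Longrightarrow> riem (g d) y (w i) (w i) = 1) \<Longrightarrow>
      \<bar>cov_deriv (riem (g d)) (in_chart d f) j y w\<bar> \<le> m"
    using D.cov_deriv_unit_bound[OF fd compact_cball r(2), of j] by blast
  define N where "N = {q \<in> chart_dom d. chart_map d q \<in> ball (chart_map d p) r}"
  have "openin X N" unfolding N_def by (rule openin_chart_preimage[OF M d(1) open_ball])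
  moreover have "p \<in> N" using d(2) r(1) by (simp add: N_def)
  moreover have "tensor_norm (riem (g c) x) j (cov_deriv (riem (g c)) (in_chart c f) j x) \<le>
      sqrt (card ({..<j} \<rightarrow>\<^sub>E {..<DIM(complex^'n)}) * m\<^sup>2)"
    if c: "c \<in> \<A>" and x: "x \<in> chart_img c" and xN: "chart_inv c x \<in> N" for c x
  proof (rule tensor_norm_le)
    interpret C: hermitian_chart "chart_img c" "g c" by (rule chart_hermitian_chart[OF M g c])
    interpret I: hermitian_isometry "transition_dom c d" "chart_img d" "g c" "g d" "transition c d"
      by (rule transition_hermitian_isometry[OF M g c d(1)])
    show "\<exists>e. orthonormal_frame (riem (g c) x) e" by (rule C.exists_orthonormal_frame[OF x])
    fix w :: "nat \<Rightarrow> complex^'n" assume w: "\<And>i. i < j \<Longrightarrow> riem (g c) x (w i) (w i) = 1"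
    have "chart_inv c x \<in> chart_dom c \<inter> chart_dom d"
      using xN chart_inv_in_dom[OF x] by (simp add: N_def)
    then have xU: "x \<in> transition_dom c d"
      unfolding transition_dom_def using chart_map_inv[OF x] by (metis imageI)
    have y: "transition c d x \<in> cball (chart_map d p) r"
      using xN by (simp add: N_def transition_def)
    have eq: "(in_chart d f \<circ> transition c d) y = in_chart c f y" if y: "y \<in> transition_dom c d" for y
    proof -
      obtain q where q: "q \<in> chart_dom c" "q \<in> chart_dom d" "y = chart_map c q"
        using y by (auto simp: transition_dom_def)
      then show ?thesis
        by (simp add: transition_def chart_inv_map[OF M c] in_chart_map[OF M c] in_chart_map[OF M d(1)])
    qed
    have "cov_deriv (riem (g c)) (in_chart c f) j x w =
        cov_deriv (riem (g c)) (in_chart d f \<circ> transition c d) j x w"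
      by (rule cov_deriv_cong[OF I.dom.open_S eq[symmetric] xU])
    also have "\<dots> = cov_deriv (riem (g d)) (in_chart d f) j (transition c d x) (\<lambda>i. dir_deriv (w i) (transition c d) x)"
      by (rule I.cov_deriv_pullback[OF fd xU])
    finally show "\<bar>cov_deriv (riem (g c)) (in_chart c f) j x w\<bar> \<le> m"
      using m[OF y] w I.riem_iso[OF xU] by simp
  qed
  ultimately show ?thesis by blast
qed

lemma tensor_norm_cov_deriv_bounded:
  fixes g :: "('a, 'n::finite) metric"
  assumes M: "complex_manifold X \<A>" and comp: "compact_space X" and g: "hermitian_metric \<A> g"
    and f: "smooth_function \<A> f"
  obtains K where "K \<ge> 0" "\<And>c x. c \<in> \<A> \<Longrightarrow> x \<in> chart_img c \<Longrightarrow>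
    tensor_norm (riem (g c) x) j (cov_deriv (riem (g c)) (in_chart c f) j x) \<le> K"
proof -
  define bd where "bd N K \<longleftrightarrow> (\<forall>c\<in>\<A>. \<forall>x\<in>chart_img c. chart_inv c x \<in> N \<longrightarrow>
    tensor_norm (riem (g c) x) j (cov_deriv (riem (g c)) (in_chart c f) j x) \<le> K)" for N K
  define \<U> where "\<U> = {N. openin X N \<and> (\<exists>K. bd N K)}"
  have cover: "topspace X \<subseteq> \<Union>\<U>"
  proof
    fix p assume "p \<in> topspace X"
    from tensor_norm_cov_deriv_locally_bounded[OF M g f this, of j]
    obtain N K where "openin X N" "p \<in> N" "bd N K" unfolding bd_def by blast
    then show "p \<in> \<Union>\<U>" unfolding \<U>_def by blast
  qed
  have opn: "openin X N" if "N \<in> \<U>" for N using that by (simp add: \<U>_def)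
  have "compactin X (topspace X)" using comp by (simp add: compact_space_def)
  from compactinD[OF this opn cover]
  obtain \<F> where F: "finite \<F>" "\<F> \<subseteq> \<U>" "topspace X \<subseteq> \<Union>\<F>" by blast
  have "\<forall>N\<in>\<F>. \<exists>K. bd N K" using F(2) unfolding \<U>_def by blast
  then obtain K where K: "\<And>N. N \<in> \<F> \<Longrightarrow> bd N (K N)" by metis
  show ?thesis
  proof (rule that)
    \<comment> \<open>A sum in place of a maximum: it dominates each \<open>K N\<close> and makes
      sense for an empty subcover too.\<close>
    show "(\<Sum>N\<in>\<F>. \<bar>K N\<bar>) \<ge> 0" by (simp add: sum_nonneg)
    fix c x assume c: "c \<in> \<A>" and x: "x \<in> chart_img c"
    have "chart_inv c x \<in> topspace X"
      using chart_inv_in_dom[OF x] complex_manifold_chart(4)[OF M c] by blast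
    then obtain N where N: "N \<in> \<F>" "chart_inv c x \<in> N" using F(3) by blast
    have "tensor_norm (riem (g c) x) j (cov_deriv (riem (g c)) (in_chart c f) j x) \<le> K N"
      using K[OF N(1)] N(2) c x unfolding bd_def by blast
    also have "\<dots> \<le> \<bar>K N\<bar>" by simp
    also have "\<dots> \<le> (\<Sum>N\<in>\<F>. \<bar>K N\<bar>)" by (rule member_le_sum[OF N(1) _ F(1)]) simp
    finally show "tensor_norm (riem (g c) x) j (cov_deriv (riem (g c)) (in_chart c f) j x) \<le> (\<Sum>N\<in>\<F>. \<bar>K N\<bar>)" .
  qed
qed

lemma Ck_norm_finite:
  fixes g :: "('a, 'n::finite) metric"
  assumes M: "complex_manifold X \<A>" and comp: "compact_space X" and g: "hermitian_metric \<A> g"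
    and f: "smooth_function \<A> f"
  shows "\<exists>C::real. Ck_norm \<A> g k f \<le> ennreal C"
proof -
  have "\<exists>K\<ge>0. \<forall>c\<in>\<A>. \<forall>x\<in>chart_img c.
      tensor_norm (riem (g c) x) j (cov_deriv (riem (g c)) (in_chart c f) j x) \<le> K" for j
    using tensor_norm_cov_deriv_bounded[OF M comp g f, of j] by metis
  then obtain K where K: "\<And>j. K j \<ge> 0" "\<And>j c x. c \<in> \<A> \<Longrightarrow> x \<in> chart_img c \<Longrightarrow>
      tensor_norm (riem (g c) x) j (cov_deriv (riem (g c)) (in_chart c f) j x) \<le> K j" by metis
  have "Ck_norm \<A> g k f \<le> (\<Sum>j\<le>k. ennreal (K j))"
    unfolding Ck_norm_def by (intro sum_mono SUP_least ennreal_leI K(2))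
  also have "\<dots> = ennreal (\<Sum>j\<le>k. K j)" using K(1) by simp
  finally show ?thesis by blast
qed

text \<open>Equality is only available on the space itself; it suffices because inverse charts take
  their values there and the derivatives are taken in open chart images.\<close>

lemma Ck_norm_cong:
  assumes M: "complex_manifold X \<A>" and eq: "\<And>p. p \<in> topspace X \<Longrightarrow> f p = f' p"
  shows "Ck_norm \<A> g k f = Ck_norm \<A> g k f'"
proof -
  have "cov_deriv (riem (g c)) (in_chart c f) j x = cov_deriv (riem (g c)) (in_chart c f') j x"
    if c: "c \<in> \<A>" and x: "x \<in> chart_img c" for c x j
  proof
    fix w
    have "in_chart c f y = in_chart c f' y" if "y \<in> chart_img c" for y
      using chart_inv_in_dom[OF that] complex_manifold_chart(4)[OF M c] by (auto simp: in_chart_def intro!: eq)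
    then show "cov_deriv (riem (g c)) (in_chart c f) j x w = cov_deriv (riem (g c)) (in_chart c f') j x w"
      by (rule cov_deriv_cong[OF complex_manifold_chart(2)[OF M c] _ x])
  qed
  then show ?thesis unfolding Ck_norm_def by (intro sum.cong SUP_cong refl) simp
qed

theorem mainTheorem1:
  fixes X :: "'a topology"
    and \<A> :: "('a, 'n::finite) chart set"
    and g :: "('a, 'n) metric"
    and F :: "'a \<Rightarrow> real"
  assumes "complex_manifold X \<A>"
    and "compact_space X"
    and "connected_space X"
    and "CARD('n) \<ge> 2"
    and "hermitian_metric \<A> g"
    and "smooth_function \<A> F"
  shows "\<forall>k::nat. \<exists>C::real. \<forall>\<phi>::'a \<Rightarrow> real.
    smooth_function \<A> \<phi> \<and>
    monge_ampere \<A> g F \<phi> \<and>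
    deformed_positive \<A> g \<phi> \<and>
    (SUP p\<in>topspace X. \<phi> p) = 0
    \<longrightarrow> Ck_norm \<A> g k \<phi> \<le> ennreal C"
proof
  fix k :: nat
  define sol where "sol \<phi> \<longleftrightarrow> smooth_function \<A> \<phi> \<and> monge_ampere \<A> g F \<phi> \<and>
    deformed_positive \<A> g \<phi> \<and> (SUP p\<in>topspace X. \<phi> p) = 0" for \<phi>
  show "\<exists>C::real. \<forall>\<phi>::'a \<Rightarrow> real.
    smooth_function \<A> \<phi> \<and> monge_ampere \<A> g F \<phi> \<and> deformed_positive \<A> g \<phi> \<and>
    (SUP p\<in>topspace X. \<phi> p) = 0 \<longrightarrow> Ck_norm \<A> g k \<phi> \<le> ennreal C"
  proof (cases "\<exists>\<phi>. sol \<phi>")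
    case True
    then obtain \<psi> where \<psi>: "sol \<psi>" by blast
    then obtain C where C: "Ck_norm \<A> g k \<psi> \<le> ennreal C"
      using Ck_norm_finite[OF assms(1,2,5)] unfolding sol_def by blast
    have "Ck_norm \<A> g k \<phi> \<le> ennreal C" if "sol \<phi>" for \<phi>
    proof -
      have "\<phi> p = \<psi> p" if "p \<in> topspace X" for p
        using monge_ampere_unique[OF assms(1-3,5), where \<phi>=\<phi> and \<psi>=\<psi> and F=F, OF _ _ _ _ _ _ _ _ that]
          \<open>sol \<phi>\<close> \<psi> unfolding sol_def by blast
      then show ?thesis using Ck_norm_cong[OF assms(1), of \<phi> \<psi>] C by simp
    qed
    then show ?thesis unfolding sol_def by blast
  qed (auto simp: sol_def)
qed

end
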